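(* Assume Setting (S) and the Distinctness assumptions (D). Assume moreover $\gamma>4\alpha$. Then for every $T>\frac{2\pi}{\sqrt{\gamma^2-16\alpha^2}}$, $$\int_0^T\big(|u_1(t)|^2+|u_2(t)|^2\big)dt\asymp\sum_{n=1}^\infty\big(|C_n|^2+|d_nD_n|^2\big),$$ i.e. there are constants $0<A\le B$ (depending on $T$ and the sequences $\omega_n,\zeta_n,r_n,c_n,d_n$ and the constants in (S), but not on $C_n,D_n,R_n,\mathcal{E}$) such that $A\sum_n(|C_n|^2+|d_nD_n|^2)\le\int_0^T(|u_1|^2+|u_2|^2)dt\le B\sum_n(|C_n|^2+|d_nD_n|^2)$.
   Context: Setting (S): $(\omega_n),(\zeta_n),(C_n),(D_n),(c_n),(d_n)$ ($n\ge1$) are complex sequences and $(r_n),(R_n)$ are real sequences. There are constants $\gamma>0$, $\alpha>0$, $\chi<0$, $n'\in\mathbb{N}$, $\mu>0$, $\nu>1/2$, $M>0$, $0<c_1\le c_2$ such that: (H1) $\liminf_{n\to\infty}(\operatorname{Re}\omega_{n+1}-\operatorname{Re}\omega_n)=\liminf_{n\to\infty}(\operatorname{Re}\zeta_{n+1}-\operatorname{Re}\zeta_n)=\gamma$; (H2) $\operatorname{Im}\omega_n\to\alpha$, $r_n\to\chi$, $\operatorname{Im}\zeta_n\to0$; (H3) $\omega_n\ne0$, $\zeta_n\neq0$, $c_1|\zeta_n|\le|d_n|\le c_2|\zeta_n|$ and $|c_n|\le M/|\omega_n|$ for all $n$; (H4) $|R_n|\le\mu n^{-\nu}(|C_n|^2+|d_nD_n|^2)^{1/2}$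 for $n\ge n'$ and $|R_n|\le\mu(|C_n|^2+|d_nD_n|^2)^{1/2}$ for $n\le n'$; (H5) $\sum_n(|C_n|^2+|d_nD_n|^2)<\infty$. For $n_0\in\mathbb{N}$ and $t\in\mathbb{R}$, $u_1^{n_0}(t)=\sum_{n\ge n_0}\big(C_ne^{i\omega_nt}+\overline{C_n}e^{-i\overline{\omega_n}t}+R_ne^{r_nt}+D_ne^{i\zeta_nt}+\overline{D_n}e^{-i\overline{\zeta_n}t}\big)$, $u_2^{n_0}(t)=\sum_{n\ge n_0}\big(d_nD_ne^{i\zeta_nt}+\overline{d_nD_n}e^{-i\overline{\zeta_n}t}+c_nC_ne^{i\omega_nt}+\overline{c_nC_n}e^{-i\overline{\omega_n}t}\big)$. Distinctness assumptions (D): $\eta\in\mathbb{R}$ and $\mathcal{E}\in\mathbb{R}$ with $|\mathcal{E}|^2\le M\sum_{n\ge1}(|C_n|^2+|d_nD_n|^2)$; the sequences $(\omega_n)$, $(r_n)$, $(\zeta_n)$ each consist of pairwise distinct numbers; $\omega_n\ne\zeta_m$, $\omega_n\ne\overline{\zeta_m}$, $r_n\ne i\omega_m$, $r_n\ne i\zeta_m$, $r_n\ne-\eta$ for all $n,m$; and $\operatorname{Re}\omega_n>0$, $\operatorname{Re}\zeta_n>0$ for all $n$. Set $u_1(t):=u_1^{1}(t)$ and $u_2(t):=u_2^{1}(t)+\mathcal{E}e^{-\eta t}$. *)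

theory Defs
  imports "HOL-Analysis.Analysis"
begin

text \<open>Sequences are indexed from 1; the value at index 0 is ignored.\<close>

definition energy :: "(nat \<Rightarrow> complex) \<Rightarrow> (nat \<Rightarrow> complex) \<Rightarrow> (nat \<Rightarrow> complex) \<Rightarrow> real" where
  "energy C D d = (\<Sum>n. (cmod (C (Suc n)))\<^sup>2 + (cmod (d (Suc n) * D (Suc n)))\<^sup>2)"

definition u1_part ::
  "(nat \<Rightarrow> complex) \<Rightarrow> (nat \<Rightarrow> complex) \<Rightarrow> (nat \<Rightarrow> real) \<Rightarrow>
   (nat \<Rightarrow> complex) \<Rightarrow> (nat \<Rightarrow> complex) \<Rightarrow> (nat \<Rightarrow> real) \<Rightarrow> nat \<Rightarrow> real \<Rightarrow> complex" where
  "u1_part \<omega> \<zeta> r C D R N t =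
     (\<Sum>n=1..N. C n * exp (\<i> * \<omega> n * of_real t) + cnj (C n) * exp (- \<i> * cnj (\<omega> n) * of_real t)
        + of_real (R n * exp (r n * t))
        + D n * exp (\<i> * \<zeta> n * of_real t) + cnj (D n) * exp (- \<i> * cnj (\<zeta> n) * of_real t))"

definition u2_part ::
  "(nat \<Rightarrow> complex) \<Rightarrow> (nat \<Rightarrow> complex) \<Rightarrow> (nat \<Rightarrow> complex) \<Rightarrow> (nat \<Rightarrow> complex) \<Rightarrow>
   (nat \<Rightarrow> complex) \<Rightarrow> (nat \<Rightarrow> complex) \<Rightarrow> real \<Rightarrow> real \<Rightarrow> nat \<Rightarrow> real \<Rightarrow> complex" where
  "u2_part \<omega> \<zeta> c d C D \<E> \<eta> N t =
     (\<Sum>n=1..N. d n * D n * exp (\<i> * \<zeta> n * of_real t) + cnj (d n * D n) * exp (- \<i> * cnj (\<zeta> n) * of_real t)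
        + c n * C n * exp (\<i> * \<omega> n * of_real t) + cnj (c n * C n) * exp (- \<i> * cnj (\<omega> n) * of_real t))
     + of_real (\<E> * exp (- \<eta> * t))"

end

theory Submission
  imports Defs "HOL-Complex_Analysis.Great_Picard"
begin

text \<open>
  Both observations are exponential sums over the same modes, with weights \<open>p\<close> and \<open>q\<close>: up to
  normalisation \<open>u\<^sub>1\<close> sees the \<open>\<omega>\<close>-modes and the residual modes with weight one, \<open>u\<^sub>2\<close> sees the
  \<open>\<zeta>\<close>-modes with weight one, and the cross weights \<open>1/d\<^sub>n\<close> and \<open>c\<^sub>n\<close> tend to zero. Ingham's method
  with the kernel \<open>sin (\<pi>t/T)\<close> tolerates exponents whose real parts are close to a common value, so
  it applies to the tail of each family as soon as \<open>T > 2\<pi>/\<gamma>\<close>; the coupling being a compact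
  perturbation, this gives the lower estimate up to finitely many modes and the residual modes.

  These remainders are removed by contradiction. A normalised sequence with vanishing
  observation has a coefficientwise limit. Applying \<open>j\<close>-fold difference quotients and letting
  first the step tend to \<open>0\<close> and then \<open>j\<close> to infinity shows that the limit contains no modes of
  high frequency; since the residual coefficients are dominated it is then a finite exponential
  sum. The estimate modulo finitely many modes, applied to differences, makes the convergence
  strong, so this finite sum vanishes on \<open>[0,T]\<close>, all its coefficients are zero, and the
  normalisation is contradicted.
\<close>

subsection \<open>Square integrals over an interval\<close>

definition square_integrable :: "real \<Rightarrow> (real \<Rightarrow> 'a::real_normed_vector) \<Rightarrow> bool" where
  "square_integrable T f \<longleftrightarrow> (\<lambda>t. (norm (f t))\<^sup>2) integrable_on {0..T}"

definition L2_sq :: "real \<Rightarrow> (real \<Rightarrow> 'a::real_normed_vector) \<Rightarrow> real" where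
  "L2_sq T f = integral {0..T} (\<lambda>t. (norm (f t))\<^sup>2)"

lemma square_integrable_continuous:
  "continuous_on {0..T} f \<Longrightarrow> square_integrable T f"
  unfolding square_integrable_def by (intro integrable_continuous_interval continuous_intros)

lemma L2_sq_nonneg: "L2_sq T f \<ge> 0"
  unfolding L2_sq_def by (cases "(\<lambda>t. (norm (f t))\<^sup>2) integrable_on {0..T}")
    (auto intro: integral_nonneg simp: not_integrable_integral)

lemma L2_sq_minus: "L2_sq T (\<lambda>t. - f t) = L2_sq T f"
  by (simp add: L2_sq_def)

lemma L2_sq_minus_commute: "L2_sq T (\<lambda>t. f t - g t) = L2_sq T (\<lambda>t. g t - f t)"
  by (simp add: L2_sq_def norm_minus_commute)

lemma L2_sq_scale:
  fixes f :: "real \<Rightarrow> 'a::real_normed_field"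
  shows "L2_sq T (\<lambda>t. c * f t) = (norm c)\<^sup>2 * L2_sq T f"
  by (simp add: L2_sq_def norm_mult power_mult_distrib)

lemma L2_sq_mono:
  assumes "square_integrable T f" "square_integrable T g"
    and "\<And>t. t \<in> {0..T} \<Longrightarrow> norm (f t) \<le> norm (g t)"
  shows "L2_sq T f \<le> L2_sq T g"
  using assms unfolding L2_sq_def square_integrable_def
  by (intro integral_le power_mono) auto

lemma L2_sq_le_bound:
  assumes "T \<ge> 0" "square_integrable T f" and "\<And>t. t \<in> {0..T} \<Longrightarrow> norm (f t) \<le> C"
  shows "L2_sq T f \<le> T * C\<^sup>2"
proof -
  have "L2_sq T f \<le> integral {0..T} (\<lambda>_. C\<^sup>2)"
    using assms unfolding L2_sq_def square_integrable_def
    by (intro integral_le power_mono integrable_const_ivl) auto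
  then show ?thesis using assms(1) by simp
qed

lemma norm_add_power2_le: "(norm (x + y))\<^sup>2 \<le> 2 * (norm x)\<^sup>2 + 2 * (norm y)\<^sup>2"
proof -
  have "(norm (x + y))\<^sup>2 \<le> (norm x + norm y)\<^sup>2"
    by (intro power_mono norm_triangle_ineq) auto
  then show ?thesis
    using sum_squares_bound[of "norm x" "norm y"] by (simp add: power2_sum)
qed

lemma L2_sq_add_le:
  assumes "square_integrable T f" "square_integrable T g" "square_integrable T (\<lambda>t. f t + g t)"
  shows "L2_sq T (\<lambda>t. f t + g t) \<le> 2 * L2_sq T f + 2 * L2_sq T g"
proof -
  have "L2_sq T (\<lambda>t. f t + g t) \<le> integral {0..T} (\<lambda>t. 2 * (norm (f t))\<^sup>2 + 2 * (norm (g t))\<^sup>2)"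
    using assms unfolding L2_sq_def square_integrable_def
    by (intro integral_le norm_add_power2_le integrable_add integrable_on_mult_right)
  also have "\<dots> = 2 * L2_sq T f + 2 * L2_sq T g"
    using assms unfolding L2_sq_def square_integrable_def
    by (intro integral_unique has_integral_add has_integral_mult_right integrable_integral)
  finally show ?thesis .
qed

lemma L2_sq_diff_le:
  assumes "square_integrable T f" "square_integrable T g" "square_integrable T (\<lambda>t. f t - g t)"
  shows "L2_sq T (\<lambda>t. f t - g t) \<le> 2 * L2_sq T f + 2 * L2_sq T g"
  using L2_sq_add_le[of T f "\<lambda>t. - g t"] assms by (simp add: L2_sq_minus square_integrable_def)

lemma integral_norm_power2_add:
  assumes "square_integrable T f" "square_integrable T g"
  shows "integral {0..T} (\<lambda>t. (norm (f t))\<^sup>2 + (norm (g t))\<^sup>2) = L2_sq T f + L2_sq T g"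
  using assms by (simp add: square_integrable_def L2_sq_def Henstock_Kurzweil_Integration.integral_add)

lemma L2_sq_interval_mono:
  assumes "S \<le> T" "continuous_on {0..T} f"
  shows "L2_sq S f \<le> L2_sq T f"
  unfolding L2_sq_def using assms
  by (intro integral_subset_le integrable_continuous_interval continuous_intros)
     (auto intro: continuous_on_subset)

lemma L2_sq_shift_le:
  assumes "h \<ge> 0" "continuous_on {0..T + h} f"
  shows "L2_sq T (\<lambda>t. f (t + h)) \<le> L2_sq (T + h) f"
proof -
  let ?g = "\<lambda>t. (norm (f t))\<^sup>2"
  have "L2_sq T (\<lambda>t. f (t + h)) = integral {h..T + h} ?g"
    using integral_shift_Icc_real[of 0 T ?g h] by (simp add: L2_sq_def comp_def add.commute)
  also have "\<dots> \<le> L2_sq (T + h) f"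
    unfolding L2_sq_def using assms
    by (intro integral_subset_le integrable_continuous_interval continuous_intros)
       (auto intro: continuous_on_subset)
  finally show ?thesis .
qed

lemma L2_sq_eq_0D:
  assumes "L2_sq T f = 0" "continuous_on {0..T} f" "T > 0" "t \<in> {0..T}"
  shows "f t = 0"
proof -
  have "continuous_on {0..T} (\<lambda>t. (norm (f t))\<^sup>2)" using assms(2) by (intro continuous_intros)
  from integral_eq_0_iff[OF this \<open>T > 0\<close>] assms(1,4) show ?thesis by (simp add: L2_sq_def)
qed

subsection \<open>Exponential sums\<close>

definition exp_sum :: "'i set \<Rightarrow> ('i \<Rightarrow> complex) \<Rightarrow> ('i \<Rightarrow> complex) \<Rightarrow> real \<Rightarrow> complex" where
  "exp_sum J \<mu> x t = (\<Sum>i\<in>J. x i * exp (\<mu> i * of_real t))"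

definition sum_sq :: "'i set \<Rightarrow> ('i \<Rightarrow> complex) \<Rightarrow> real" where
  "sum_sq J x = (\<Sum>i\<in>J. (cmod (x i))\<^sup>2)"

lemma continuous_on_exp_sum [continuous_intros]: "continuous_on S (exp_sum J \<mu> x)"
  unfolding exp_sum_def by (intro continuous_intros)

lemma square_integrable_exp_sum: "square_integrable T (exp_sum J \<mu> x)"
  by (intro square_integrable_continuous continuous_intros)

lemma exp_sum_cong:
  "(\<And>i. i \<in> J \<Longrightarrow> x i = y i) \<Longrightarrow> exp_sum J \<mu> x = exp_sum J \<mu> y"
  unfolding exp_sum_def fun_eq_iff by (intro allI sum.cong) auto

lemma exp_sum_diff: "exp_sum J \<mu> (\<lambda>i. x i - y i) t = exp_sum J \<mu> x t - exp_sum J \<mu> y t"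
  by (simp add: exp_sum_def sum_subtractf left_diff_distrib)

lemma exp_sum_scale: "exp_sum J \<mu> (\<lambda>i. c * x i) t = c * exp_sum J \<mu> x t"
  by (simp add: exp_sum_def sum_distrib_left mult.assoc)

lemma exp_sum_Un_disjoint:
  assumes "finite J" "finite K" "J \<inter> K = {}"
  shows "exp_sum (J \<union> K) \<mu> x t = exp_sum J \<mu> x t + exp_sum K \<mu> x t"
  using assms by (simp add: exp_sum_def sum.union_disjoint)

lemma exp_sum_mono_neutral:
  assumes "finite K" "J \<subseteq> K" "\<And>i. i \<in> K - J \<Longrightarrow> x i = 0"
  shows "exp_sum K \<mu> x = exp_sum J \<mu> x"
  unfolding exp_sum_def fun_eq_iff using assms by (intro allI sum.mono_neutral_right) auto

lemma exp_sum_shift: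
  "exp_sum J \<mu> x (t + s) = exp_sum J \<mu> (\<lambda>i. x i * exp (\<mu> i * of_real s)) t"
  unfolding exp_sum_def by (intro sum.cong) (auto simp: ring_distribs exp_add)

lemma sum_sq_nonneg: "sum_sq J x \<ge> 0"
  by (simp add: sum_sq_def sum_nonneg)

lemma sum_sq_mono: "finite K \<Longrightarrow> J \<subseteq> K \<Longrightarrow> sum_sq J x \<le> sum_sq K x"
  unfolding sum_sq_def by (intro sum_mono2) auto

lemma sum_sq_Un_disjoint:
  "finite J \<Longrightarrow> finite K \<Longrightarrow> J \<inter> K = {} \<Longrightarrow> sum_sq (J \<union> K) x = sum_sq J x + sum_sq K x"
  by (simp add: sum_sq_def sum.union_disjoint)

lemma sum_sq_scale: "sum_sq J (\<lambda>i. c * x i) = (cmod c)\<^sup>2 * sum_sq J x"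
  by (simp add: sum_sq_def sum_distrib_left norm_mult power_mult_distrib)

lemma sum_sq_mult_le:
  assumes "\<And>i. i \<in> J \<Longrightarrow> cmod (p i) \<le> C"
  shows "sum_sq J (\<lambda>i. p i * x i) \<le> C\<^sup>2 * sum_sq J x"
  unfolding sum_sq_def sum_distrib_left norm_mult power_mult_distrib
  using assms by (intro sum_mono mult_right_mono power_mono) auto

lemma sum_sq_diff_le: "sum_sq J (\<lambda>i. x i - y i) \<le> 2 * sum_sq J x + 2 * sum_sq J y"
proof -
  have "(cmod (u - v))\<^sup>2 \<le> 2 * (cmod u)\<^sup>2 + 2 * (cmod v)\<^sup>2" for u v
    using norm_add_power2_le[of u "- v"] by simp
  then show ?thesis unfolding sum_sq_def sum_distrib_left sum.distrib[symmetric] by (intro sum_mono)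
qed

lemma norm_exp_sum_le:
  assumes "\<And>i. i \<in> J \<Longrightarrow> \<bar>Re (\<mu> i)\<bar> \<le> \<rho>" "t \<in> {0..T}"
  shows "cmod (exp_sum J \<mu> x t) \<le> exp (\<rho> * T) * (\<Sum>i\<in>J. cmod (x i))"
  unfolding exp_sum_def sum_distrib_left
proof (rule sum_norm_le)
  fix i assume "i \<in> J"
  have "\<bar>Re (\<mu> i)\<bar> * t \<le> \<rho> * T"
    using assms(1)[OF \<open>i \<in> J\<close>] assms(2) by (intro mult_mono) auto
  moreover have "Re (\<mu> i) * t \<le> \<bar>Re (\<mu> i)\<bar> * t"
    using assms(2) by (intro mult_right_mono) auto
  ultimately have "cmod (exp (\<mu> i * of_real t)) \<le> exp (\<rho> * T)" by simp
  then show "cmod (x i * exp (\<mu> i * of_real t)) \<le> exp (\<rho> * T) * cmod (x i)"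
    by (simp add: norm_mult mult.commute mult_left_mono)
qed

lemma L2_sq_exp_sum_le_sum_norm:
  assumes "\<And>i. i \<in> J \<Longrightarrow> \<bar>Re (\<mu> i)\<bar> \<le> \<rho>" "T \<ge> 0"
  shows "L2_sq T (exp_sum J \<mu> x) \<le> T * exp (2 * \<rho> * T) * (\<Sum>i\<in>J. cmod (x i))\<^sup>2"
proof -
  have "L2_sq T (exp_sum J \<mu> x) \<le> T * (exp (\<rho> * T) * (\<Sum>i\<in>J. cmod (x i)))\<^sup>2"
    using assms by (intro L2_sq_le_bound square_integrable_exp_sum norm_exp_sum_le) auto
  also have "\<dots> = T * exp (2 * \<rho> * T) * (\<Sum>i\<in>J. cmod (x i))\<^sup>2"
    by (simp add: power_mult_distrib mult.assoc flip: exp_double)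
  finally show ?thesis .
qed

subsection \<open>Mean-square limits\<close>

definition nn_L2_sq :: "real \<Rightarrow> (real \<Rightarrow> 'a::real_normed_vector) \<Rightarrow> ennreal" where
  "nn_L2_sq T f = (\<integral>\<^sup>+t. ennreal (indicator {0..T} t * (norm (f t))\<^sup>2) \<partial>lborel)"

lemma nn_L2_sq_eq: "square_integrable T f \<Longrightarrow> nn_L2_sq T f = ennreal (L2_sq T f)"
  unfolding nn_L2_sq_def L2_sq_def square_integrable_def
  using nn_integral_has_integral_lebesgue[OF _ integrable_integral[of "\<lambda>t. (norm (f t))\<^sup>2" "{0..T}"]]
  by simp

lemma square_integrable_if_nn_L2_sq_le:
  fixes f :: "real \<Rightarrow> 'a::{real_normed_vector, second_countable_topology}"
  assumes f: "f \<in> borel_measurable borel" and bound: "nn_L2_sq T f \<le> ennreal r" and "r \<ge> 0"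
  shows "square_integrable T f" "L2_sq T f \<le> r"
proof -
  obtain r' where r': "r' \<ge> 0" "nn_L2_sq T f = ennreal r'"
    using le_less_trans[OF bound ennreal_less_top] by (auto simp: less_top_ennreal)
  have "((\<lambda>t. indicator {0..T} t * (norm (f t))\<^sup>2) has_integral r') UNIV"
    using f r' by (intro nn_integral_has_integral) (auto simp: nn_L2_sq_def)
  moreover have "(\<lambda>t. indicator {0..T} t * (norm (f t))\<^sup>2) = (\<lambda>t. if t \<in> {0..T} then (norm (f t))\<^sup>2 else 0)"
    by (auto simp: indicator_def)
  ultimately have "((\<lambda>t. (norm (f t))\<^sup>2) has_integral r') {0..T}" by (simp only: has_integral_restrict_UNIV)
  moreover have "r' \<le> r" using bound r' \<open>r \<ge> 0\<close> by simp
  ultimately show "square_integrable T f" "L2_sq T f \<le> r"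
    by (auto simp: square_integrable_def L2_sq_def integral_unique)
qed

lemma square_integrable_add:
  fixes f g :: "real \<Rightarrow> 'a::{real_normed_vector, second_countable_topology}"
  assumes [measurable]: "f \<in> borel_measurable borel" "g \<in> borel_measurable borel"
    and summands: "square_integrable T f" "square_integrable T g"
  shows "square_integrable T (\<lambda>t. f t + g t)"
proof (rule square_integrable_if_nn_L2_sq_le(1))
  let ?q = "\<lambda>f t. indicator {0..T} t * (norm (f t))\<^sup>2"
  have "nn_L2_sq T (\<lambda>t. f t + g t) \<le> (\<integral>\<^sup>+t. 2 * ennreal (?q f t) + 2 * ennreal (?q g t) \<partial>lborel)"
    unfolding nn_L2_sq_def
  proof (rule nn_integral_mono)
    fix t
    have "?q (\<lambda>t. f t + g t) t \<le> 2 * ?q f t + 2 * ?q g t"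
      using norm_add_power2_le[of "f t" "g t"] by (auto simp: indicator_def)
    then have "ennreal (?q (\<lambda>t. f t + g t) t) \<le> ennreal (2 * ?q f t + 2 * ?q g t)" by (rule ennreal_leI)
    also have "\<dots> = 2 * ennreal (?q f t) + 2 * ennreal (?q g t)"
      by (simp add: ennreal_mult')
    finally show "ennreal (?q (\<lambda>t. f t + g t) t) \<le> 2 * ennreal (?q f t) + 2 * ennreal (?q g t)" .
  qed
  also have "\<dots> = 2 * nn_L2_sq T f + 2 * nn_L2_sq T g"
    unfolding nn_L2_sq_def by (subst nn_integral_add) (auto simp: nn_integral_cmult)
  also have "\<dots> = ennreal (2 * L2_sq T f + 2 * L2_sq T g)"
    using summands by (simp add: nn_L2_sq_eq ennreal_mult' L2_sq_nonneg)
  finally show "nn_L2_sq T (\<lambda>t. f t + g t) \<le> ennreal (2 * L2_sq T f + 2 * L2_sq T g)" .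
qed (simp_all add: L2_sq_nonneg)

lemma le_inverse_add_mult_power2:
  fixes x :: real
  assumes "c > 0"
  shows "x \<le> 1 / c + c * x\<^sup>2"
proof -
  have "0 \<le> (c * x - 1)\<^sup>2 + (c * x)\<^sup>2 + 1" by simp
  then have "2 * (c * x) \<le> 2 * (1 + (c * x)\<^sup>2)" by (simp add: power2_diff)
  then have "x \<le> (1 + (c * x)\<^sup>2) / c" using assms by (simp add: field_simps)
  also have "\<dots> = 1 / c + c * x\<^sup>2" using assms by (simp add: field_simps power2_eq_square)
  finally show ?thesis .
qed

lemma convergent_if_weighted_increments_summable:
  fixes v :: "nat \<Rightarrow> 'a::banach"
  assumes "summable (\<lambda>k. 2 ^ k * (norm (v (Suc k) - v k))\<^sup>2)"
  shows "convergent v"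
proof -
  have "summable (\<lambda>k. 1 / 2 ^ k :: real)"
    using summable_geometric[of "1/2 :: real"] by (simp add: power_one_over)
  then have "summable (\<lambda>k. 1 / 2 ^ k + 2 ^ k * (norm (v (Suc k) - v k))\<^sup>2)"
    using assms by (rule summable_add)
  then have "summable (\<lambda>k. norm (v (Suc k) - v k))"
    by (rule summable_comparison_test'[where N = 0]) (simp add: le_inverse_add_mult_power2)
  then have "summable (\<lambda>k. v (Suc k) - v k)" by (rule summable_norm_cancel)
  then have "convergent (\<lambda>k. v k - v 0)"
    by (simp add: summable_iff_convergent sum_lessThan_telescope[of v])
  then show ?thesis by (simp add: convergent_diff_const_right_iff)
qed

lemma fast_L2_Cauchy_convergent_AE:
  fixes u :: "nat \<Rightarrow> real \<Rightarrow> 'a::{banach, second_countable_topology}"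
  assumes cont: "\<And>k. continuous_on UNIV (u k)"
    and fast: "\<And>k. L2_sq T (\<lambda>t. u (Suc k) t - u k t) \<le> (1/4) ^ k"
  shows "AE t in lborel. t \<in> {0..T} \<longrightarrow> convergent (\<lambda>k. u k t)"
proof -
  define d where "d k t = indicator {0..T} t * (norm (u (Suc k) t - u k t))\<^sup>2" for k t
  have [measurable]: "u k \<in> borel_measurable borel" for k
    by (rule borel_measurable_continuous_onI[OF cont])
  have weighted_integral_le: "(\<integral>\<^sup>+t. ennreal (2 ^ k * d k t) \<partial>lborel) \<le> ennreal ((1/2) ^ k)" for k
  proof -
    have "square_integrable T (\<lambda>t. u (Suc k) t - u k t)"
      using cont by (intro square_integrable_continuous continuous_intros) (blast intro: continuous_on_subset)+
    then have "(\<integral>\<^sup>+t. ennreal (2 ^ k * d k t) \<partial>lborel) = ennreal (2 ^ k * L2_sq T (\<lambda>t. u (Suc k) t - u k t))"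
      by (simp add: d_def nn_L2_sq_eq[symmetric] nn_L2_sq_def ennreal_mult' nn_integral_cmult)
    also have "\<dots> \<le> ennreal (2 ^ k * (1/4) ^ k)" by (intro ennreal_leI mult_left_mono fast) simp
    also have "2 ^ k * (1/4) ^ k = (1/2 :: real) ^ k" by (simp flip: power_mult_distrib)
    finally show ?thesis .
  qed
  have "(\<integral>\<^sup>+t. (\<Sum>k. ennreal (2 ^ k * d k t)) \<partial>lborel) = (\<Sum>k. \<integral>\<^sup>+t. ennreal (2 ^ k * d k t) \<partial>lborel)"
    by (rule nn_integral_suminf) (simp add: d_def)
  also have "\<dots> \<le> (\<Sum>k. ennreal ((1/2) ^ k))" by (intro suminf_le weighted_integral_le) auto
  also have "\<dots> = ennreal (\<Sum>k. (1/2) ^ k)" by (intro suminf_ennreal2 summable_geometric) auto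
  finally have "(\<integral>\<^sup>+t. (\<Sum>k. ennreal (2 ^ k * d k t)) \<partial>lborel) \<noteq> \<infinity>" by (auto simp: top_unique)
  then have "AE t in lborel. (\<Sum>k. ennreal (2 ^ k * d k t)) \<noteq> \<infinity>"
    by (intro nn_integral_PInf_AE) (simp add: d_def)
  then show ?thesis
  proof eventually_elim
    case (elim t)
    show ?case
    proof
      assume t: "t \<in> {0..T}"
      show "convergent (\<lambda>k. u k t)"
        using elim t
        by (intro convergent_if_weighted_increments_summable summable_suminf_not_top) (auto simp: d_def)
    qed
  qed
qed

lemma nn_L2_sq_limit_le:
  fixes u :: "nat \<Rightarrow> real \<Rightarrow> 'a::{real_normed_vector, second_countable_topology}"
  assumes [measurable]: "\<And>k. u k \<in> borel_measurable borel" "g \<in> borel_measurable borel"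
    and conv: "AE t in lborel. t \<in> {0..T} \<longrightarrow> (\<lambda>k. u k t) \<longlonglongrightarrow> U t"
    and eventually_bound: "\<forall>\<^sub>F k in sequentially. nn_L2_sq T (\<lambda>t. u k t - g t) \<le> r"
  shows "nn_L2_sq T (\<lambda>t. U t - g t) \<le> r"
proof -
  have "nn_L2_sq T (\<lambda>t. U t - g t)
      = (\<integral>\<^sup>+t. liminf (\<lambda>k. ennreal (indicator {0..T} t * (norm (u k t - g t))\<^sup>2)) \<partial>lborel)"
    unfolding nn_L2_sq_def
  proof (rule nn_integral_cong_AE, use conv in eventually_elim)
    case (elim t)
    have "(\<lambda>k. ennreal (indicator {0..T} t * (norm (u k t - g t))\<^sup>2))
        \<longlonglongrightarrow> ennreal (indicator {0..T} t * (norm (U t - g t))\<^sup>2)"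
    proof (cases "t \<in> {0..T}")
      case True
      with elim have "(\<lambda>k. u k t) \<longlonglongrightarrow> U t" by blast
      then show ?thesis by (intro tendsto_ennrealI tendsto_intros)
    qed simp
    from lim_imp_Liminf[OF _ this] show ?case by simp
  qed
  also have "\<dots> \<le> liminf (\<lambda>k. nn_L2_sq T (\<lambda>t. u k t - g t))"
    unfolding nn_L2_sq_def by (rule nn_integral_liminf) measurable
  also have "\<dots> \<le> liminf (\<lambda>_. r)" using eventually_bound by (rule Liminf_mono)
  also have "\<dots> = r" by (simp add: Liminf_const)
  finally show ?thesis .
qed

definition L2_tendsto :: "real \<Rightarrow> (nat \<Rightarrow> real \<Rightarrow> 'a::real_normed_vector) \<Rightarrow> (real \<Rightarrow> 'a) \<Rightarrow> bool" where
  "L2_tendsto T u U \<longleftrightarrow> square_integrable T U \<and> (\<forall>n. square_integrable T (\<lambda>t. U t - u n t))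
    \<and> (\<lambda>n. L2_sq T (\<lambda>t. U t - u n t)) \<longlonglongrightarrow> 0"

lemma L2_tendsto_if_nn_L2_sq_tendsto:
  fixes u :: "nat \<Rightarrow> real \<Rightarrow> 'a::{real_normed_vector, second_countable_topology}"
  assumes cont: "\<And>n. continuous_on UNIV (u n)" and [measurable]: "U \<in> borel_measurable borel"
    and near: "\<And>\<epsilon>. \<epsilon> > 0 \<Longrightarrow> \<exists>N. \<forall>n\<ge>N. nn_L2_sq T (\<lambda>t. U t - u n t) \<le> ennreal \<epsilon>"
  shows "L2_tendsto T u U"
proof -
  have [measurable]: "u n \<in> borel_measurable borel" for n
    by (rule borel_measurable_continuous_onI[OF cont])
  have near': "\<exists>N. \<forall>n\<ge>N. square_integrable T (\<lambda>t. U t - u n t) \<and> L2_sq T (\<lambda>t. U t - u n t) \<le> \<epsilon>"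
    if "\<epsilon> > 0" for \<epsilon>
  proof -
    obtain N where "\<forall>n\<ge>N. nn_L2_sq T (\<lambda>t. U t - u n t) \<le> ennreal \<epsilon>" using near[OF \<open>\<epsilon> > 0\<close>] by blast
    then show ?thesis
      using square_integrable_if_nn_L2_sq_le[of "\<lambda>t. U t - u n t" T \<epsilon> for n] cont \<open>\<epsilon> > 0\<close> by auto
  qed
  then obtain N where N: "square_integrable T (\<lambda>t. U t - u N t)" using zero_less_one by blast
  have diff: "square_integrable T (\<lambda>t. U t - g t)" if g: "continuous_on UNIV g" for g
  proof -
    have [measurable]: "g \<in> borel_measurable borel" by (rule borel_measurable_continuous_onI[OF g])
    have "square_integrable T (\<lambda>t. u N t - g t)"
      using cont g by (intro square_integrable_continuous continuous_intros) (blast intro: continuous_on_subset)+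
    then have "square_integrable T (\<lambda>t. (U t - u N t) + (u N t - g t))"
      using N by (intro square_integrable_add) auto
    then show ?thesis by simp
  qed
  show ?thesis
    unfolding L2_tendsto_def
  proof (intro conjI allI)
    show "square_integrable T U" using diff[of "\<lambda>_. 0"] by simp
    show "square_integrable T (\<lambda>t. U t - u n t)" for n by (rule diff[OF cont])
    show "(\<lambda>n. L2_sq T (\<lambda>t. U t - u n t)) \<longlonglongrightarrow> 0"
    proof (rule LIMSEQ_I)
      fix \<epsilon> :: real assume "\<epsilon> > 0"
      then obtain N where "\<forall>n\<ge>N. L2_sq T (\<lambda>t. U t - u n t) \<le> \<epsilon> / 2" using near'[of "\<epsilon> / 2"] by auto
      then show "\<exists>N. \<forall>n\<ge>N. norm (L2_sq T (\<lambda>t. U t - u n t) - 0) < \<epsilon>"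
        using \<open>\<epsilon> > 0\<close> by (force simp: L2_sq_nonneg)
    qed
  qed
qed

text \<open>A subsequence with geometrically decreasing increments converges almost everywhere, and
  Fatou's lemma identifies its limit as the limit in mean square.\<close>

lemma L2_complete:
  fixes u :: "nat \<Rightarrow> real \<Rightarrow> 'a::{banach, second_countable_topology}"
  assumes cont: "\<And>n. continuous_on UNIV (u n)"
    and Cauchy: "\<And>\<epsilon>. \<epsilon> > 0 \<Longrightarrow> \<exists>N. \<forall>m\<ge>N. \<forall>n\<ge>N. L2_sq T (\<lambda>t. u m t - u n t) \<le> \<epsilon>"
  obtains U where "L2_tendsto T u U"
proof -
  have meas [measurable]: "u n \<in> borel_measurable borel" for n
    by (rule borel_measurable_continuous_onI[OF cont])
  have sq_int: "square_integrable T (\<lambda>t. u m t - u n t)" for m n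
    using cont by (intro square_integrable_continuous continuous_intros) (blast intro: continuous_on_subset)+
  have "\<exists>N. \<forall>m\<ge>N. \<forall>n\<ge>N. L2_sq T (\<lambda>t. u m t - u n t) \<le> (1/4) ^ i" for i
    by (rule Cauchy) simp
  then obtain N where N: "\<And>i m n. m \<ge> N i \<Longrightarrow> n \<ge> N i \<Longrightarrow> L2_sq T (\<lambda>t. u m t - u n t) \<le> (1/4) ^ i"
    by metis
  define s where "s k = (\<Sum>i\<le>k. N i)" for k
  have s: "N i \<le> s k" if "i \<le> k" for i k
    unfolding s_def using that by (intro member_le_sum) auto
  define U where "U t = lim (\<lambda>k. u (s k) t)" for t
  have [measurable]: "U \<in> borel_measurable borel"
    unfolding U_def by (rule borel_measurable_lim_metric) measurable
  have "AE t in lborel. t \<in> {0..T} \<longrightarrow> convergent (\<lambda>k. u (s k) t)"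
    by (intro fast_L2_Cauchy_convergent_AE cont N s) auto
  then have conv: "AE t in lborel. t \<in> {0..T} \<longrightarrow> (\<lambda>k. u (s k) t) \<longlonglongrightarrow> U t"
    by (simp add: U_def convergent_LIMSEQ_iff)
  have near: "nn_L2_sq T (\<lambda>t. U t - u n t) \<le> ennreal ((1/4) ^ i)" if "n \<ge> N i" for n i
  proof (rule nn_L2_sq_limit_le[OF meas meas conv])
    show "\<forall>\<^sub>F k in sequentially. nn_L2_sq T (\<lambda>t. u (s k) t - u n t) \<le> ennreal ((1/4) ^ i)"
      using eventually_ge_at_top[of i]
      by eventually_elim (auto simp: nn_L2_sq_eq[OF sq_int] intro!: ennreal_leI N s that)
  qed
  have "L2_tendsto T u U"
  proof (rule L2_tendsto_if_nn_L2_sq_tendsto[OF cont])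
    fix \<epsilon> :: real assume "\<epsilon> > 0"
    then obtain i where "(1/4 :: real) ^ i < \<epsilon>" using real_arch_pow_inv[of \<epsilon> "1/4"] by auto
    then have "nn_L2_sq T (\<lambda>t. U t - u n t) \<le> ennreal \<epsilon>" if "n \<ge> N i" for n
      using order_trans[OF near[OF that] ennreal_leI] by simp
    then show "\<exists>N. \<forall>n\<ge>N. nn_L2_sq T (\<lambda>t. U t - u n t) \<le> ennreal \<epsilon>" by blast
  qed measurable
  then show thesis by (rule that)
qed

lemma L2_tendsto_bounds:
  assumes U: "L2_tendsto T u U" and u: "square_integrable T (u n)"
  shows "L2_sq T U \<le> 2 * L2_sq T (u n) + 2 * L2_sq T (\<lambda>t. U t - u n t)"
    and "L2_sq T (u n) \<le> 2 * L2_sq T U + 2 * L2_sq T (\<lambda>t. U t - u n t)"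
  using L2_sq_add_le[of T "u n" "\<lambda>t. U t - u n t"] L2_sq_diff_le[of T U "\<lambda>t. U t - u n t"] u U
  by (simp_all add: L2_tendsto_def)

subsection \<open>Ingham inequalities\<close>

definition sine_kernel :: "real \<Rightarrow> complex \<Rightarrow> complex" where
  "sine_kernel T z = integral {0..T} (\<lambda>t. of_real (sin (pi / T * t)) * exp (z * of_real t))"

lemma sine_kernel_eq:
  assumes "T > 0" and nonzero: "z\<^sup>2 + (of_real (pi / T))\<^sup>2 \<noteq> 0"
  shows "sine_kernel T z = (1 + exp (z * of_real T)) * of_real (pi / T) / (z\<^sup>2 + (of_real (pi / T))\<^sup>2)"
proof -
  define p :: complex where "p = of_real (pi / T)"
  define F where "F w = exp (z * w) * (z * sin (p * w) - p * cos (p * w)) / (z\<^sup>2 + p\<^sup>2)" for w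
  have sin_p: "sin (p * of_real t) = of_real (sin (pi / T * t))" for t
    unfolding p_def of_real_mult[symmetric] by (rule sin_of_real)
  have period: "p * of_real T = of_real pi" using \<open>T > 0\<close> by (simp add: p_def)
  have "(F has_field_derivative (sin (p * w) * exp (z * w))) (at w)" for w
  proof -
    have "((\<lambda>w. exp (z * w) * (z * sin (p * w) - p * cos (p * w))) has_field_derivative
        (sin (p * w) * exp (z * w)) * (z\<^sup>2 + p\<^sup>2)) (at w)"
      by (auto intro!: derivative_eq_intros simp: algebra_simps power2_eq_square)
    from DERIV_cdivide[OF this, of "z\<^sup>2 + p\<^sup>2"] show ?thesis
      using nonzero by (simp add: F_def[abs_def] p_def)
  qed
  then have "((\<lambda>t. sin (p * of_real t) * exp (z * of_real t)) has_integral F (of_real T) - F (of_real 0)) {0..T}"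
    using \<open>T > 0\<close> by (intro fundamental_theorem_of_calculus has_vector_derivative_real_field) auto
  moreover have "F (of_real T) - F (of_real 0) = (1 + exp (z * of_real T)) * p / (z\<^sup>2 + p\<^sup>2)"
    unfolding F_def period sin_of_real cos_of_real by (simp add: algebra_simps add_divide_distrib)
  ultimately show ?thesis
    unfolding sine_kernel_def sin_p by (simp add: integral_unique p_def)
qed

lemma norm_sine_kernel_le:
  assumes T: "T > 0" and Im: "T * \<bar>Im z\<bar> > pi" and Re: "\<bar>Re z\<bar> \<le> b"
  shows "cmod (sine_kernel T z) \<le> (1 + exp (b * T)) * (pi / T) / ((Im z)\<^sup>2 - (pi / T)\<^sup>2)"
proof -
  define p where "p = pi / T"
  have p: "0 < p" "p < \<bar>Im z\<bar>" using T Im by (auto simp: p_def field_simps)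
  then have pos: "0 < (Im z)\<^sup>2 - p\<^sup>2"
    using power_strict_mono[of p "\<bar>Im z\<bar>" 2] by simp
  have "(Im z)\<^sup>2 - p\<^sup>2 = (\<bar>Im z\<bar> - p) * (\<bar>Im z\<bar> + p)"
    by (simp add: algebra_simps power2_eq_square flip: abs_mult)
  also have "\<dots> = \<bar>Im z - p\<bar> * \<bar>Im z + p\<bar>"
    using p by (cases "Im z \<ge> 0") (auto simp: abs_if algebra_simps)
  also have "\<dots> \<le> cmod (z - \<i> * of_real p) * cmod (z + \<i> * of_real p)"
    using abs_Im_le_cmod[of "z - \<i> * of_real p"] abs_Im_le_cmod[of "z + \<i> * of_real p"]
    by (intro mult_mono) auto
  also have "\<dots> = cmod (z\<^sup>2 + (of_real p)\<^sup>2)"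
    by (simp add: norm_mult[symmetric] algebra_simps power2_eq_square)
  finally have denom: "(Im z)\<^sup>2 - p\<^sup>2 \<le> cmod (z\<^sup>2 + (of_real p)\<^sup>2)" .
  have "Re z * T \<le> b * T" using Re T by (intro mult_right_mono) auto
  then have numer: "cmod (1 + exp (z * of_real T)) \<le> 1 + exp (b * T)"
    by (intro order_trans[OF norm_triangle_ineq]) simp
  have "z\<^sup>2 + (of_real p)\<^sup>2 \<noteq> 0" using denom pos by auto
  then have "cmod (sine_kernel T z) = cmod (1 + exp (z * of_real T)) * p / cmod (z\<^sup>2 + (of_real p)\<^sup>2)"
    using sine_kernel_eq[OF T, of z] T by (simp add: p_def norm_divide norm_mult)
  also have "\<dots> \<le> (1 + exp (b * T)) * p / ((Im z)\<^sup>2 - p\<^sup>2)"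
    using numer denom pos p by (intro frac_le mult_right_mono mult_nonneg_nonneg) auto
  finally show ?thesis by (simp add: p_def)
qed

lemma sine_kernel_of_real:
  "sine_kernel T (of_real x) = of_real (integral {0..T} (\<lambda>t. sin (pi / T * t) * exp (x * t)))"
proof -
  have "sine_kernel T (of_real x) = integral {0..T} (\<lambda>t. of_real (sin (pi / T * t) * exp (x * t)))"
    unfolding sine_kernel_def of_real_mult exp_of_real[symmetric] ..
  also have "\<dots> = of_real (integral {0..T} (\<lambda>t. sin (pi / T * t) * exp (x * t)))"
    by (intro integral_unique has_integral_of_real integrable_integral integrable_continuous_interval
        continuous_intros)
  finally show ?thesis .
qed

lemma sin_pi_scaled_nonneg: "T > 0 \<Longrightarrow> t \<in> {0..T} \<Longrightarrow> 0 \<le> sin (pi / T * t)"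
  by (intro sin_ge_zero) (auto simp: field_simps)

lemma integral_sine_exp_bounds:
  assumes T: "T > 0" and x: "\<bar>x\<bar> \<le> b"
  shows "exp (- b * T) * (2 * T / pi) \<le> integral {0..T} (\<lambda>t. sin (pi / T * t) * exp (x * t))"
    and "integral {0..T} (\<lambda>t. sin (pi / T * t) * exp (x * t)) \<le> exp (b * T) * (2 * T / pi)"
proof -
  have "((\<lambda>t. sin (pi / T * t)) has_integral (- cos (pi / T * T) * (T / pi)) - (- cos (pi / T * 0) * (T / pi))) {0..T}"
    using T by (intro fundamental_theorem_of_calculus)
      (auto intro!: derivative_eq_intros simp flip: has_real_derivative_iff_has_vector_derivative)
  then have "((\<lambda>t. sin (pi / T * t)) has_integral 2 * T / pi) {0..T}" using T by simp
  then have scaled: "((\<lambda>t. sin (pi / T * t) * C) has_integral C * (2 * T / pi)) {0..T}" for C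
    by (subst (2) mult.commute) (rule has_integral_mult_left)
  have integrable: "(\<lambda>t. sin (pi / T * t) * exp (x * t)) integrable_on {0..T}"
    by (intro integrable_continuous_interval continuous_intros)
  have "\<bar>x * t\<bar> \<le> b * T" if "t \<in> {0..T}" for t
    using that x by (auto simp: abs_mult intro!: mult_mono)
  then have exp: "exp (- b * T) \<le> exp (x * t)" "exp (x * t) \<le> exp (b * T)" if "t \<in> {0..T}" for t
    using that by (auto simp: abs_le_iff minus_le_iff)
  show "exp (- b * T) * (2 * T / pi) \<le> integral {0..T} (\<lambda>t. sin (pi / T * t) * exp (x * t))"
    by (rule has_integral_le[OF scaled integrable_integral[OF integrable]])
       (intro mult_left_mono exp sin_pi_scaled_nonneg T)
  show "integral {0..T} (\<lambda>t. sin (pi / T * t) * exp (x * t)) \<le> exp (b * T) * (2 * T / pi)"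
    by (rule has_integral_le[OF integrable_integral[OF integrable] scaled])
       (intro mult_left_mono exp sin_pi_scaled_nonneg T)
qed

definition sine_L2_sq :: "real \<Rightarrow> (real \<Rightarrow> complex) \<Rightarrow> real" where
  "sine_L2_sq T f = integral {0..T} (\<lambda>t. sin (pi / T * t) * (cmod (f t))\<^sup>2)"

lemma sine_L2_sq_exp_sum:
  assumes "finite J"
  shows "complex_of_real (sine_L2_sq T (exp_sum J \<mu> x))
     = (\<Sum>i\<in>J. \<Sum>j\<in>J. x i * cnj (x j) * sine_kernel T (\<mu> i + cnj (\<mu> j)))"
proof -
  have "complex_of_real ((cmod (exp_sum J \<mu> x t))\<^sup>2)
      = (\<Sum>i\<in>J. \<Sum>j\<in>J. x i * cnj (x j) * exp ((\<mu> i + cnj (\<mu> j)) * of_real t))" for t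
  proof -
    have "cnj (exp_sum J \<mu> x t) = (\<Sum>j\<in>J. cnj (x j) * exp (cnj (\<mu> j) * of_real t))"
      by (simp add: exp_sum_def exp_cnj)
    then have "complex_of_real ((cmod (exp_sum J \<mu> x t))\<^sup>2)
        = exp_sum J \<mu> x t * (\<Sum>j\<in>J. cnj (x j) * exp (cnj (\<mu> j) * of_real t))"
      by (simp only: complex_norm_square)
    also have "\<dots> = (\<Sum>i\<in>J. \<Sum>j\<in>J. x i * cnj (x j) * exp ((\<mu> i + cnj (\<mu> j)) * of_real t))"
      unfolding exp_sum_def sum_product distrib_right exp_add by (simp only: mult_ac)
    finally show ?thesis .
  qed
  then have expand: "complex_of_real (sin (pi / T * t) * (cmod (exp_sum J \<mu> x t))\<^sup>2)
      = (\<Sum>i\<in>J. \<Sum>j\<in>J. x i * cnj (x j)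
          * (of_real (sin (pi / T * t)) * exp ((\<mu> i + cnj (\<mu> j)) * of_real t)))" for t
    by (simp only: of_real_mult sum_distrib_left mult.left_commute)
  have "complex_of_real (sine_L2_sq T (exp_sum J \<mu> x))
      = integral {0..T} (\<lambda>t. complex_of_real (sin (pi / T * t) * (cmod (exp_sum J \<mu> x t))\<^sup>2))"
    unfolding sine_L2_sq_def
    by (rule sym, intro integral_unique has_integral_of_real integrable_integral
        integrable_continuous_interval continuous_intros)
  also have "\<dots> = (\<Sum>i\<in>J. \<Sum>j\<in>J. x i * cnj (x j) * sine_kernel T (\<mu> i + cnj (\<mu> j)))"
    unfolding expand sine_kernel_def
    by (intro integral_unique has_integral_sum assms has_integral_mult_right integrable_integral
        integrable_continuous_interval continuous_intros)
  finally show ?thesis .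
qed

lemma schur_test:
  fixes k :: "'i \<Rightarrow> 'i \<Rightarrow> complex" and m :: "'i \<Rightarrow> 'i \<Rightarrow> real"
  assumes "finite J" and sym: "\<And>i j. m i j = m j i"
    and bound: "\<And>i j. i \<in> J \<Longrightarrow> j \<in> J - {i} \<Longrightarrow> cmod (k i j) \<le> m i j"
    and row: "\<And>i. i \<in> J \<Longrightarrow> (\<Sum>j\<in>J - {i}. m i j) \<le> \<kappa>"
  shows "cmod (\<Sum>i\<in>J. \<Sum>j\<in>J - {i}. x i * cnj (x j) * k i j) \<le> \<kappa> * sum_sq J x"
proof -
  let ?half = "\<lambda>i j. (cmod (x i))\<^sup>2 / 2 * m i j"
  have "cmod (\<Sum>i\<in>J. \<Sum>j\<in>J - {i}. x i * cnj (x j) * k i j) \<le> (\<Sum>i\<in>J. \<Sum>j\<in>J - {i}. ?half i j + ?half j i)"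
  proof (intro sum_norm_le order_trans[OF norm_sum] sum_mono)
    fix i j assume ij: "i \<in> J" "j \<in> J - {i}"
    have "cmod (x i) * cmod (x j) \<le> ((cmod (x i))\<^sup>2 + (cmod (x j))\<^sup>2) / 2"
      using sum_squares_bound[of "cmod (x i)" "cmod (x j)"] by simp
    then have "cmod (x i * cnj (x j) * k i j) \<le> ((cmod (x i))\<^sup>2 + (cmod (x j))\<^sup>2) / 2 * m i j"
      unfolding norm_mult complex_mod_cnj using bound[OF ij] by (intro mult_mono) auto
    then show "cmod (x i * cnj (x j) * k i j) \<le> ?half i j + ?half j i"
      by (simp add: sym[of j i] add_divide_distrib distrib_right)
  qed
  also have "\<dots> = (\<Sum>i\<in>J. \<Sum>j\<in>J - {i}. ?half i j) + (\<Sum>i\<in>J. \<Sum>j\<in>J - {i}. ?half j i)"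
    by (simp only: sum.distrib)
  also have "(\<Sum>i\<in>J. \<Sum>j\<in>J - {i}. ?half j i) = (\<Sum>j\<in>J. \<Sum>i\<in>J - {j}. ?half j i)"
    using sum.swap_restrict[OF \<open>finite J\<close> \<open>finite J\<close>, of "\<lambda>i j. ?half j i" "(\<noteq>)"]
    by (simp add: set_diff_eq eq_commute)
  also have "(\<Sum>i\<in>J. \<Sum>j\<in>J - {i}. ?half i j) + (\<Sum>i\<in>J. \<Sum>j\<in>J - {i}. ?half i j)
      = (\<Sum>i\<in>J. (cmod (x i))\<^sup>2 * (\<Sum>j\<in>J - {i}. m i j))"
    by (simp add: sum.distrib[symmetric] sum_distrib_left mult.commute)
  also have "\<dots> \<le> (\<Sum>i\<in>J. (cmod (x i))\<^sup>2 * \<kappa>)"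
    using row by (intro sum_mono mult_left_mono) auto
  also have "\<dots> = \<kappa> * sum_sq J x"
    by (simp add: sum_sq_def sum_distrib_left mult.commute)
  finally show ?thesis .
qed

lemma sum_inverse_four_squares:
  "(\<Sum>k=1..n. 1 / (4 * (real k)\<^sup>2 - 1)) = (1 - 1 / (2 * real n + 1)) / 2"
proof (induction n)
  case (Suc n)
  have "4 * (real (Suc n))\<^sup>2 - 1 = (2 * real n + 1) * (2 * real n + 3)"
    by (simp add: power2_eq_square algebra_simps)
  then have "(\<Sum>k=1..Suc n. 1 / (4 * (real k)\<^sup>2 - 1))
      = (1 - 1 / (2 * real n + 1)) / 2 + 1 / ((2 * real n + 1) * (2 * real n + 3))"
    using Suc by simp
  also have "\<dots> = (1 - 1 / (2 * real (Suc n) + 1)) / 2"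
    by (simp add: divide_simps) (simp add: algebra_simps)
  finally show ?case .
qed simp

lemma sum_int_inverse_four_squares_le:
  fixes K :: "int set"
  assumes "finite K" "0 \<notin> K"
  shows "(\<Sum>k\<in>K. 1 / (4 * (real_of_int k)\<^sup>2 - 1)) \<le> 1"
proof -
  let ?f = "\<lambda>k::int. 1 / (4 * (real_of_int k)\<^sup>2 - 1)"
  have nonneg: "0 \<le> ?f k" if "k \<noteq> 0" for k
  proof -
    have "1 \<le> \<bar>real_of_int k\<bar>" using that by simp
    then have "1 \<le> \<bar>real_of_int k\<bar>\<^sup>2" by (rule one_le_power)
    then show ?thesis by simp
  qed
  obtain n where n: "(\<lambda>k. nat \<bar>k\<bar>) ` K \<subseteq> {..<n}"
    using finite_nat_bounded[OF finite_imageI[OF \<open>finite K\<close>]] by blast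
  let ?pos = "int ` {1..n}" and ?neg = "(\<lambda>k. - int k) ` {1..n}"
  have "sum ?f K \<le> sum ?f (?pos \<union> ?neg)"
  proof (rule sum_mono2)
    show "K \<subseteq> ?pos \<union> ?neg"
    proof
      fix k assume k: "k \<in> K"
      then have "nat \<bar>k\<bar> < n" "k \<noteq> 0" using n \<open>0 \<notin> K\<close> by auto
      then have "nat \<bar>k\<bar> \<in> {1..n}" by auto
      moreover have "k = int (nat \<bar>k\<bar>) \<or> k = - int (nat \<bar>k\<bar>)" by auto
      ultimately show "k \<in> ?pos \<union> ?neg" by blast
    qed
    fix k assume "k \<in> (?pos \<union> ?neg) - K"
    then have "k \<noteq> 0" by auto
    then show "0 \<le> ?f k" by (rule nonneg)
  qed simp
  also have "\<dots> = sum ?f ?pos + sum ?f ?neg" by (rule sum.union_disjoint) auto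
  also have "\<dots> = 2 * (\<Sum>k=1..n. 1 / (4 * (real k)\<^sup>2 - 1))"
    by (simp add: sum.reindex inj_on_def)
  also have "\<dots> \<le> 1" unfolding sum_inverse_four_squares by simp
  finally show ?thesis .
qed

definition gap_separated :: "real \<Rightarrow> 'i set \<Rightarrow> ('i \<Rightarrow> real) \<Rightarrow> bool" where
  "gap_separated \<gamma> J y \<longleftrightarrow> pairwise (\<lambda>i j. \<gamma> \<le> \<bar>y i - y j\<bar>) J"

lemma gap_separatedD:
  "gap_separated \<gamma> J y \<Longrightarrow> i \<in> J \<Longrightarrow> j \<in> J \<Longrightarrow> i \<noteq> j \<Longrightarrow> \<gamma> \<le> \<bar>y i - y j\<bar>"
  unfolding gap_separated_def by (rule pairwiseD)

lemma gap_separated_subset: "gap_separated \<gamma> J y \<Longrightarrow> K \<subseteq> J \<Longrightarrow> gap_separated \<gamma> K y"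
  unfolding gap_separated_def by (rule pairwise_subset)

lemma same_floor_imp_close:
  assumes "\<gamma> > 0" "\<lfloor>u / \<gamma>\<rfloor> = \<lfloor>v / \<gamma>\<rfloor>"
  shows "\<bar>u - v\<bar> < \<gamma>"
proof -
  have "\<bar>u / \<gamma> - v / \<gamma>\<bar> < 1"
    using floor_correct[of "u / \<gamma>"] floor_correct[of "v / \<gamma>"]
    unfolding assms(2) of_int_add of_int_1 by linarith
  then have "\<bar>(u - v) / \<gamma>\<bar> < 1" by (simp add: diff_divide_distrib)
  then show ?thesis using assms(1) by simp
qed

lemma gap_separated_index:
  assumes "\<gamma> > 0" and sep: "gap_separated \<gamma> J y" and i: "i \<in> J"
  obtains k :: "'i \<Rightarrow> int" where "inj_on k (J - {i})" "\<And>j. j \<in> J - {i} \<Longrightarrow> k j \<noteq> 0"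
    "\<And>j. \<gamma> * \<bar>real_of_int (k j)\<bar> \<le> \<bar>y i - y j\<bar>"
proof
  define m where "m j = \<lfloor>\<bar>y i - y j\<bar> / \<gamma>\<rfloor>" for j
  let ?k = "\<lambda>j. if y i \<le> y j then m j else - m j"
  have m_pos: "m j \<ge> 1" if "j \<in> J - {i}" for j
    using gap_separatedD[OF sep i, of j] that \<open>\<gamma> > 0\<close> by (auto simp: m_def le_floor_iff)
  show "?k j \<noteq> 0" if "j \<in> J - {i}" for j using m_pos[OF that] by simp
  show "\<gamma> * \<bar>real_of_int (?k j)\<bar> \<le> \<bar>y i - y j\<bar>" for j
  proof -
    have "0 \<le> m j" using \<open>\<gamma> > 0\<close> by (simp add: m_def)
    then have "\<bar>real_of_int (?k j)\<bar> = m j" by simp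
    also have "\<dots> \<le> \<bar>y i - y j\<bar> / \<gamma>" unfolding m_def by (rule of_int_floor_le)
    finally show ?thesis using \<open>\<gamma> > 0\<close> by (simp add: field_simps)
  qed
  show "inj_on ?k (J - {i})"
  proof (rule inj_onI)
    fix j l assume in_J: "j \<in> J - {i}" "l \<in> J - {i}" and "?k j = ?k l"
    then have side: "y i \<le> y j \<longleftrightarrow> y i \<le> y l" and "m j = m l"
      using m_pos[OF in_J(1)] m_pos[OF in_J(2)] by (auto split: if_splits)
    then have "\<bar>\<bar>y i - y j\<bar> - \<bar>y i - y l\<bar>\<bar> < \<gamma>"
      using \<open>\<gamma> > 0\<close> by (intro same_floor_imp_close) (auto simp: m_def)
    then have "\<bar>y j - y l\<bar> < \<gamma>" using side by (auto simp: abs_if split: if_splits)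
    then show "j = l" using gap_separatedD[OF sep, of j l] in_J by (cases "j = l") auto
  qed
qed

lemma sum_inverse_gap_squares_le:
  assumes p: "p > 0" and \<gamma>: "\<gamma> \<ge> 2 * p" and "finite J" and sep: "gap_separated \<gamma> J y" and "i \<in> J"
  shows "(\<Sum>j\<in>J - {i}. 1 / ((y i - y j)\<^sup>2 - p\<^sup>2)) \<le> (2 / \<gamma>)\<^sup>2"
proof -
  obtain k where k: "inj_on k (J - {i})" "\<And>j. j \<in> J - {i} \<Longrightarrow> k j \<noteq> 0"
      "\<And>j. \<gamma> * \<bar>real_of_int (k j)\<bar> \<le> \<bar>y i - y j\<bar>"
    using gap_separated_index[OF _ sep \<open>i \<in> J\<close>] p \<gamma> by auto
  have "(\<Sum>j\<in>J - {i}. 1 / ((y i - y j)\<^sup>2 - p\<^sup>2))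
      \<le> (\<Sum>j\<in>J - {i}. (2 / \<gamma>)\<^sup>2 * (1 / (4 * (real_of_int (k j))\<^sup>2 - 1)))"
  proof (rule sum_mono)
    fix j assume j: "j \<in> J - {i}"
    let ?m = "\<bar>real_of_int (k j)\<bar>"
    have "1 \<le> ?m" using k(2)[OF j] by simp
    then have m: "1 \<le> ?m\<^sup>2" by (rule one_le_power)
    have "(\<gamma> / 2)\<^sup>2 * (4 * ?m\<^sup>2 - 1) = (\<gamma> * ?m)\<^sup>2 - (\<gamma> / 2)\<^sup>2"
      by (simp add: power_divide algebra_simps)
    also have "\<dots> \<le> (y i - y j)\<^sup>2 - p\<^sup>2"
    proof (rule diff_mono)
      have "(\<gamma> * ?m)\<^sup>2 \<le> \<bar>y i - y j\<bar>\<^sup>2" using k(3) p \<gamma> by (intro power_mono) auto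
      then show "(\<gamma> * ?m)\<^sup>2 \<le> (y i - y j)\<^sup>2" by simp
      show "p\<^sup>2 \<le> (\<gamma> / 2)\<^sup>2" using p \<gamma> by (intro power_mono) auto
    qed
    finally have "1 / ((y i - y j)\<^sup>2 - p\<^sup>2) \<le> 1 / ((\<gamma> / 2)\<^sup>2 * (4 * ?m\<^sup>2 - 1))"
      using m p \<gamma> by (intro frac_le mult_pos_pos) auto
    then show "1 / ((y i - y j)\<^sup>2 - p\<^sup>2) \<le> (2 / \<gamma>)\<^sup>2 * (1 / (4 * (real_of_int (k j))\<^sup>2 - 1))"
      by (simp add: power_divide)
  qed
  also have "\<dots> = (2 / \<gamma>)\<^sup>2 * (\<Sum>l\<in>k ` (J - {i}). 1 / (4 * (real_of_int l)\<^sup>2 - 1))"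
    using k(1) by (simp add: sum.reindex sum_distrib_left)
  also have "\<dots> \<le> (2 / \<gamma>)\<^sup>2 * 1"
    using k(2) \<open>finite J\<close> by (intro mult_left_mono sum_int_inverse_four_squares_le) force+
  finally show ?thesis by simp
qed

lemma critical_time_pos: "\<gamma> > 0 \<Longrightarrow> 2 * pi / \<gamma> < T \<Longrightarrow> 0 < T"
  by (rule order.strict_trans[of _ "2 * pi / \<gamma>"]) simp_all

lemma sine_L2_sq_minus_diagonal:
  assumes "finite J"
  shows "complex_of_real (sine_L2_sq T (exp_sum J \<mu> x)
      - (\<Sum>i\<in>J. (cmod (x i))\<^sup>2 * integral {0..T} (\<lambda>t. sin (pi / T * t) * exp (2 * Re (\<mu> i) * t))))
    = (\<Sum>i\<in>J. \<Sum>j\<in>J - {i}. x i * cnj (x j) * sine_kernel T (\<mu> i + cnj (\<mu> j)))"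
proof -
  let ?k = "\<lambda>i j. sine_kernel T (\<mu> i + cnj (\<mu> j))"
  let ?diag = "\<lambda>i. integral {0..T} (\<lambda>t. sin (pi / T * t) * exp (2 * Re (\<mu> i) * t))"
  have diag: "?k i i = of_real (?diag i)" for i
    using sine_kernel_of_real[of T "2 * Re (\<mu> i)"] complex_add_cnj[of "\<mu> i"] by simp
  have "(\<Sum>j\<in>J. x i * cnj (x j) * ?k i j)
      = of_real ((cmod (x i))\<^sup>2 * ?diag i) + (\<Sum>j\<in>J - {i}. x i * cnj (x j) * ?k i j)" if "i \<in> J" for i
    by (subst sum.remove[OF \<open>finite J\<close> that]) (simp add: diag complex_norm_square del: of_real_power)
  then have "complex_of_real (sine_L2_sq T (exp_sum J \<mu> x))
      = (\<Sum>i\<in>J. of_real ((cmod (x i))\<^sup>2 * ?diag i) + (\<Sum>j\<in>J - {i}. x i * cnj (x j) * ?k i j))"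
    unfolding sine_L2_sq_exp_sum[OF \<open>finite J\<close>] by (intro sum.cong refl)
  then show ?thesis
    unfolding sum.distrib of_real_diff of_real_sum by (simp only: add_diff_cancel_left')
qed

lemma sine_L2_sq_near_diagonal:
  assumes "finite J" and T: "T > 0" and \<gamma>: "\<gamma> > 0" "T * \<gamma> > 2 * pi"
    and sep: "gap_separated \<gamma> J (\<lambda>i. Im (\<mu> i))" and Re: "\<And>i. i \<in> J \<Longrightarrow> \<bar>Re (\<mu> i)\<bar> \<le> b"
  shows "\<bar>sine_L2_sq T (exp_sum J \<mu> x)
      - (\<Sum>i\<in>J. (cmod (x i))\<^sup>2 * integral {0..T} (\<lambda>t. sin (pi / T * t) * exp (2 * Re (\<mu> i) * t)))\<bar>
    \<le> (1 + exp (2 * b * T)) / 2 * (2 * pi / (T * \<gamma>))\<^sup>2 * (2 * T / pi) * sum_sq J x"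
proof -
  let ?k = "\<lambda>i j. sine_kernel T (\<mu> i + cnj (\<mu> j))"
  let ?diag = "\<lambda>i. integral {0..T} (\<lambda>t. sin (pi / T * t) * exp (2 * Re (\<mu> i) * t))"
  define C where "C = (1 + exp (2 * b * T)) * (pi / T)"
  define m where "m i j = C * (1 / ((Im (\<mu> i) - Im (\<mu> j))\<^sup>2 - (pi / T)\<^sup>2))" for i j
  have C: "C \<ge> 0" using T by (simp add: C_def)
  have p: "pi / T > 0" "2 * (pi / T) \<le> \<gamma>" using T \<gamma> by (auto simp: field_simps)
  have off_diag: "cmod (?k i j) \<le> m i j" if ij: "i \<in> J" "j \<in> J - {i}" for i j
  proof -
    have "\<gamma> \<le> \<bar>Im (\<mu> i) - Im (\<mu> j)\<bar>"
      using ij by (intro gap_separatedD[OF sep]) auto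
    then have "T * \<gamma> \<le> T * \<bar>Im (\<mu> i) - Im (\<mu> j)\<bar>" using T by simp
    then have "pi < T * \<bar>Im (\<mu> i) - Im (\<mu> j)\<bar>" using \<gamma> pi_gt_zero by linarith
    then have "pi < T * \<bar>Im (\<mu> i + cnj (\<mu> j))\<bar>" by simp
    moreover have "\<bar>Re (\<mu> i + cnj (\<mu> j))\<bar> \<le> 2 * b" using Re[of i] Re[of j] ij by auto
    ultimately show ?thesis using norm_sine_kernel_le[OF T, of "\<mu> i + cnj (\<mu> j)" "2 * b"]
      by (simp add: m_def C_def)
  qed
  have row: "(\<Sum>j\<in>J - {i}. m i j) \<le> C * (2 / \<gamma>)\<^sup>2" if "i \<in> J" for i
    unfolding m_def sum_distrib_left[symmetric]
    by (intro mult_left_mono C sum_inverse_gap_squares_le[OF p \<open>finite J\<close> sep that])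
  have "\<bar>sine_L2_sq T (exp_sum J \<mu> x) - (\<Sum>i\<in>J. (cmod (x i))\<^sup>2 * ?diag i)\<bar>
      = cmod (\<Sum>i\<in>J. \<Sum>j\<in>J - {i}. x i * cnj (x j) * ?k i j)"
    by (simp only: norm_of_real flip: sine_L2_sq_minus_diagonal[OF \<open>finite J\<close>])
  also have "\<dots> \<le> C * (2 / \<gamma>)\<^sup>2 * sum_sq J x"
    by (rule schur_test[OF \<open>finite J\<close> _ off_diag row]) (simp_all add: m_def power2_commute)
  also have "C * (2 / \<gamma>)\<^sup>2 = (1 + exp (2 * b * T)) / 2 * (2 * pi / (T * \<gamma>))\<^sup>2 * (2 * T / pi)"
    using T \<gamma> by (simp add: C_def power2_eq_square) (simp only: mult_ac)
  finally show ?thesis .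
qed

lemma sine_L2_sq_exp_sum_bounds:
  assumes "finite J" and T: "T > 0" and \<gamma>: "\<gamma> > 0" "T * \<gamma> > 2 * pi"
    and "gap_separated \<gamma> J (\<lambda>i. Im (\<mu> i))" and Re: "\<And>i. i \<in> J \<Longrightarrow> \<bar>Re (\<mu> i)\<bar> \<le> b"
  defines "\<theta> \<equiv> (1 + exp (2 * b * T)) / 2 * (2 * pi / (T * \<gamma>))\<^sup>2"
  shows "(exp (- (2 * b) * T) - \<theta>) * (2 * T / pi) * sum_sq J x \<le> sine_L2_sq T (exp_sum J \<mu> x)"
    and "sine_L2_sq T (exp_sum J \<mu> x) \<le> (exp (2 * b * T) + \<theta>) * (2 * T / pi) * sum_sq J x"
proof -
  define diag where
    "diag = (\<Sum>i\<in>J. (cmod (x i))\<^sup>2 * integral {0..T} (\<lambda>t. sin (pi / T * t) * exp (2 * Re (\<mu> i) * t)))"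
  have twice_Re: "\<bar>2 * Re (\<mu> i)\<bar> \<le> 2 * b" if "i \<in> J" for i using Re[OF that] by simp
  have "exp (- (2 * b) * T) * (2 * T / pi) * sum_sq J x \<le> diag"
       "diag \<le> exp (2 * b * T) * (2 * T / pi) * sum_sq J x"
    unfolding diag_def sum_sq_def sum_distrib_left mult.commute[of _ "(cmod (x _))\<^sup>2"]
    by (intro sum_mono mult_left_mono integral_sine_exp_bounds[OF T twice_Re]; simp)+
  moreover have "\<bar>sine_L2_sq T (exp_sum J \<mu> x) - diag\<bar> \<le> \<theta> * (2 * T / pi) * sum_sq J x"
    unfolding diag_def \<theta>_def using sine_L2_sq_near_diagonal[OF assms(1-6)] .
  ultimately show "(exp (- (2 * b) * T) - \<theta>) * (2 * T / pi) * sum_sq J x \<le> sine_L2_sq T (exp_sum J \<mu> x)"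
    and "sine_L2_sq T (exp_sum J \<mu> x) \<le> (exp (2 * b * T) + \<theta>) * (2 * T / pi) * sum_sq J x"
    unfolding left_diff_distrib distrib_right by linarith+
qed

lemma sine_L2_sq_le_L2_sq:
  assumes "continuous_on {0..T} f"
  shows "sine_L2_sq T f \<le> L2_sq T f"
  unfolding sine_L2_sq_def L2_sq_def
proof (intro integral_le integrable_continuous_interval continuous_intros assms)
  fix t show "sin (pi / T * t) * (cmod (f t))\<^sup>2 \<le> (cmod (f t))\<^sup>2"
    using mult_right_mono[of "sin (pi / T * t)" 1 "(cmod (f t))\<^sup>2"] by simp
qed

text \<open>For real frequencies (\<open>b = 0\<close>) the lower constant is a positive multiple of
  \<open>1 - (2\<pi>/(T\<gamma>))\<^sup>2\<close>, so by continuity it stays positive for small \<open>b\<close>.\<close>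

lemma ingham_lower:
  assumes \<gamma>: "\<gamma> > 0" and T: "T > 2 * pi / \<gamma>"
  obtains b \<delta> where "b > 0" "\<delta> > 0"
    "\<And>J \<mu> x. finite J \<Longrightarrow> gap_separated \<gamma> J (\<lambda>i. Im (\<mu> i)) \<Longrightarrow> (\<And>i. i \<in> J \<Longrightarrow> \<bar>Re (\<mu> i)\<bar> \<le> b)
      \<Longrightarrow> \<delta> * sum_sq J x \<le> L2_sq T (exp_sum J \<mu> x)"
proof -
  have T\<gamma>: "T * \<gamma> > 2 * pi" using T \<gamma> by (simp add: field_simps)
  have "T > 0" using \<gamma> T by (rule critical_time_pos)
  define \<theta> where "\<theta> = (2 * pi / (T * \<gamma>))\<^sup>2"
  have "\<bar>2 * pi / (T * \<gamma>)\<bar> < 1" using T\<gamma> \<gamma> \<open>T > 0\<close> by simp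
  then have "\<theta> < 1" unfolding \<theta>_def by (simp only: abs_square_less_1)
  have "((\<lambda>b. exp (- (2 * b) * T) - (1 + exp (2 * b * T)) / 2 * \<theta>)
      \<longlongrightarrow> exp (- (2 * 0) * T) - (1 + exp (2 * 0 * T)) / 2 * \<theta>) (at_right 0)"
    by (intro tendsto_intros) auto
  then have "\<forall>\<^sub>F b in at_right 0. 0 < exp (- (2 * b) * T) - (1 + exp (2 * b * T)) / 2 * \<theta>"
    using \<open>\<theta> < 1\<close> by (intro order_tendstoD) auto
  then have "\<forall>\<^sub>F b in at_right 0. 0 < b \<and> 0 < exp (- (2 * b) * T) - (1 + exp (2 * b * T)) / 2 * \<theta>"
    using eventually_at_right_less by (rule eventually_conj[rotated])
  then obtain b where b: "b > 0" "0 < exp (- (2 * b) * T) - (1 + exp (2 * b * T)) / 2 * \<theta>"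
    using eventually_happens'[OF trivial_limit_at_right_real] by blast
  define \<delta> where "\<delta> = (exp (- (2 * b) * T) - (1 + exp (2 * b * T)) / 2 * \<theta>) * (2 * T / pi)"
  show thesis
  proof
    show "b > 0" by (rule b)
    show "\<delta> > 0" unfolding \<delta>_def using b \<open>T > 0\<close> by (intro mult_pos_pos) auto
    fix J :: "'a set" and \<mu> x
    assume "finite J" "gap_separated \<gamma> J (\<lambda>i. Im (\<mu> i))" "\<And>i. i \<in> J \<Longrightarrow> \<bar>Re (\<mu> i)\<bar> \<le> b"
    then have "\<delta> * sum_sq J x \<le> sine_L2_sq T (exp_sum J \<mu> x)"
      unfolding \<delta>_def \<theta>_def using \<open>T > 0\<close> \<gamma> T\<gamma> by (intro sine_L2_sq_exp_sum_bounds(1))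
    also have "\<dots> \<le> L2_sq T (exp_sum J \<mu> x)"
      by (intro sine_L2_sq_le_L2_sq continuous_intros)
    finally show "\<delta> * sum_sq J x \<le> L2_sq T (exp_sum J \<mu> x)" .
  qed
qed

lemma sin_ge_half:
  assumes "pi / 3 \<le> x" "x \<le> 2 * pi / 3"
  shows "1 / 2 \<le> sin x"
proof -
  have "cos (pi / 3) \<le> cos \<bar>x - pi / 2\<bar>"
    using assms by (intro cos_monotone_0_pi_le) (auto simp: abs_if field_simps)
  then show ?thesis by (simp add: cos_60 cos_diff)
qed

lemma L2_sq_shift_le_sine_L2_sq:
  assumes s: "s > 0" "T \<le> s" and f: "continuous_on UNIV f"
  shows "L2_sq T (\<lambda>t. f (t + s)) \<le> 2 * sine_L2_sq (3 * s) f"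
proof -
  have [continuous_intros]: "continuous_on S f" for S using f by (rule continuous_on_subset) simp
  let ?g = "\<lambda>t. (cmod (f t))\<^sup>2" and ?w = "\<lambda>t. sin (pi / (3 * s) * t)"
  have "L2_sq T (\<lambda>t. f (t + s)) = integral {s..T + s} ?g"
    using integral_shift_Icc_real[of 0 T ?g s] by (simp add: L2_sq_def comp_def add.commute)
  also have "\<dots> \<le> integral {s..T + s} (\<lambda>t. 2 * (?w t * ?g t))"
  proof (intro integral_le integrable_continuous_interval continuous_intros)
    fix t assume "t \<in> {s..T + s}"
    then have "1 / 2 \<le> ?w t" using s by (intro sin_ge_half) (auto simp: field_simps)
    then have "1 / 2 * ?g t \<le> ?w t * ?g t" by (rule mult_right_mono) simp
    then show "?g t \<le> 2 * (?w t * ?g t)" by simp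
  qed
  also have "\<dots> \<le> integral {0..3 * s} (\<lambda>t. 2 * (?w t * ?g t))"
    using s sin_pi_scaled_nonneg[of "3 * s"]
    by (intro integral_subset_le integrable_continuous_interval continuous_intros) auto
  also have "\<dots> = 2 * sine_L2_sq (3 * s) f" by (simp add: sine_L2_sq_def)
  finally show ?thesis .
qed

lemma ingham_upper:
  assumes \<gamma>: "\<gamma> > 0"
  obtains B where "B > 0"
    "\<And>J \<mu> x. finite J \<Longrightarrow> gap_separated \<gamma> J (\<lambda>i. Im (\<mu> i)) \<Longrightarrow> (\<And>i. i \<in> J \<Longrightarrow> \<bar>Re (\<mu> i)\<bar> \<le> b)
      \<Longrightarrow> L2_sq T (exp_sum J \<mu> x) \<le> B * sum_sq J x"
proof -
  define s where "s = max T (2 * pi / \<gamma>)"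
  have "0 < 2 * pi / \<gamma>" using \<gamma> by simp
  moreover have "2 * pi / \<gamma> \<le> s" "T \<le> s" by (auto simp: s_def)
  ultimately have s: "s > 0" "T \<le> s" "s * \<gamma> \<ge> 2 * pi"
    using \<gamma> by (linarith, simp, simp add: field_simps)
  then have L: "3 * s > 0" "3 * s * \<gamma> > 2 * pi" using pi_gt_zero by (auto, linarith)
  define \<kappa> where "\<kappa> = (exp (2 * b * (3 * s)) + (1 + exp (2 * b * (3 * s))) / 2 * (2 * pi / (3 * s * \<gamma>))\<^sup>2) * (2 * (3 * s) / pi)"
  have "\<kappa> > 0"
    unfolding \<kappa>_def using s by (intro mult_pos_pos add_pos_nonneg mult_nonneg_nonneg) auto
  show thesis
  proof
    show "2 * \<kappa> * (exp (b * s))\<^sup>2 > 0" using \<open>\<kappa> > 0\<close> by simp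
    fix J :: "'a set" and \<mu> x
    assume J: "finite J" "gap_separated \<gamma> J (\<lambda>i. Im (\<mu> i))" and Re: "\<And>i. i \<in> J \<Longrightarrow> \<bar>Re (\<mu> i)\<bar> \<le> b"
    define y where "y i = exp (- (\<mu> i * of_real s)) * x i" for i
    have "exp_sum J \<mu> x t = exp_sum J \<mu> y (t + s)" for t
      unfolding exp_sum_shift by (rule arg_cong[of _ _ "\<lambda>x. exp_sum J \<mu> x t"]) (simp add: y_def exp_minus field_simps)
    then have "exp_sum J \<mu> x = (\<lambda>t. exp_sum J \<mu> y (t + s))" by blast
    then have "L2_sq T (exp_sum J \<mu> x) \<le> 2 * sine_L2_sq (3 * s) (exp_sum J \<mu> y)"
      by (simp only:) (intro L2_sq_shift_le_sine_L2_sq s continuous_on_exp_sum)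
    also have "\<dots> \<le> 2 * (\<kappa> * sum_sq J y)"
      unfolding \<kappa>_def by (intro mult_left_mono sine_L2_sq_exp_sum_bounds(2) J L \<gamma> Re) auto
    also have "\<dots> \<le> 2 * (\<kappa> * ((exp (b * s))\<^sup>2 * sum_sq J x))"
    proof (intro mult_left_mono)
      have "- (Re (\<mu> i) * s) \<le> b * s" if "i \<in> J" for i
        using mult_right_mono[of "- Re (\<mu> i)" b s] Re[OF that] s by auto
      then show "sum_sq J y \<le> (exp (b * s))\<^sup>2 * sum_sq J x"
        unfolding y_def by (intro sum_sq_mult_le) simp
    qed (use \<open>\<kappa> > 0\<close> in auto)
    finally show "L2_sq T (exp_sum J \<mu> x) \<le> 2 * \<kappa> * (exp (b * s))\<^sup>2 * sum_sq J x"
      by (simp add: mult.assoc)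
  qed
qed

subsection \<open>Families with an asymptotic gap\<close>

definition cofinite_on :: "'i set \<Rightarrow> 'i filter" where
  "cofinite_on A = inf cofinite (principal A)"

lemma eventually_cofinite_on: "eventually P (cofinite_on A) \<longleftrightarrow> finite {i \<in> A. \<not> P i}"
  unfolding cofinite_on_def eventually_inf_principal eventually_cofinite
  by (rule arg_cong[of _ _ finite]) auto

definition asymptotic_gap :: "real \<Rightarrow> 'i set \<Rightarrow> ('i \<Rightarrow> real) \<Rightarrow> bool" where
  "asymptotic_gap \<gamma> A y \<longleftrightarrow> (\<forall>\<gamma>'<\<gamma>. \<exists>F. finite F \<and> gap_separated \<gamma>' (A - F) y)"

lemma exp_sum_shift_exponents:
  "exp_sum J (\<lambda>i. \<mu> i - z) x t = exp (- z * of_real t) * exp_sum J \<mu> x t"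
  unfolding exp_sum_def sum_distrib_left
  by (intro sum.cong) (auto simp: left_diff_distrib exp_diff exp_minus divide_inverse)

lemma L2_sq_exp_sum_shift_exponents_le:
  "L2_sq T (exp_sum J (\<lambda>i. \<mu> i - of_real \<beta>) x) \<le> (exp (\<bar>\<beta>\<bar> * T))\<^sup>2 * L2_sq T (exp_sum J \<mu> x)"
proof -
  have "L2_sq T (exp_sum J (\<lambda>i. \<mu> i - of_real \<beta>) x)
      \<le> L2_sq T (\<lambda>t. of_real (exp (\<bar>\<beta>\<bar> * T)) * exp_sum J \<mu> x t)"
  proof (intro L2_sq_mono square_integrable_continuous continuous_intros)
    fix t assume t: "t \<in> {0..T}"
    have "- (\<beta> * t) \<le> \<bar>\<beta>\<bar> * t" using t mult_right_mono[of "- \<beta>" "\<bar>\<beta>\<bar>" t] by auto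
    also have "\<dots> \<le> \<bar>\<beta>\<bar> * T" using t by (intro mult_left_mono) auto
    finally show "cmod (exp_sum J (\<lambda>i. \<mu> i - of_real \<beta>) x t) \<le> cmod (of_real (exp (\<bar>\<beta>\<bar> * T)) * exp_sum J \<mu> x t)"
      by (simp add: exp_sum_shift_exponents norm_mult mult_right_mono)
  qed
  also have "\<dots> = (exp (\<bar>\<beta>\<bar> * T))\<^sup>2 * L2_sq T (exp_sum J \<mu> x)" by (simp add: L2_sq_scale)
  finally show ?thesis .
qed

lemma asymptotic_gap_lower:
  assumes gap: "asymptotic_gap \<gamma> A (\<lambda>i. Im (\<mu> i))" and Re: "((\<lambda>i. Re (\<mu> i)) \<longlongrightarrow> \<beta>) (cofinite_on A)"
    and \<gamma>: "\<gamma> > 0" and T: "T > 2 * pi / \<gamma>"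
  obtains F \<delta> where "finite F" "\<delta> > 0"
    "\<And>J x. finite J \<Longrightarrow> J \<subseteq> A - F \<Longrightarrow> \<delta> * sum_sq J x \<le> L2_sq T (exp_sum J \<mu> x)"
proof -
  have "T > 0" using \<gamma> T by (rule critical_time_pos)
  then have "2 * pi / T < \<gamma>" using T \<gamma> by (simp add: field_simps)
  then obtain \<gamma>' where \<gamma>': "2 * pi / T < \<gamma>'" "\<gamma>' < \<gamma>" using dense by blast
  have "\<gamma>' > 0" using \<open>T > 0\<close> \<gamma>'(1) by (rule critical_time_pos)
  then have "T > 2 * pi / \<gamma>'" using \<gamma>'(1) \<open>T > 0\<close> by (simp add: field_simps)
  with \<open>\<gamma>' > 0\<close>
  obtain b \<delta> where "b > 0" "\<delta> > 0" and ingham: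
    "\<And>J \<mu> x. finite (J :: 'a set) \<Longrightarrow> gap_separated \<gamma>' J (\<lambda>i. Im (\<mu> i)) \<Longrightarrow> (\<And>i. i \<in> J \<Longrightarrow> \<bar>Re (\<mu> i)\<bar> \<le> b)
      \<Longrightarrow> \<delta> * sum_sq J x \<le> L2_sq T (exp_sum J \<mu> x)"
    by (rule ingham_lower) blast
  obtain F\<^sub>1 where separated: "finite F\<^sub>1" "gap_separated \<gamma>' (A - F\<^sub>1) (\<lambda>i. Im (\<mu> i))"
    using gap \<gamma>'(2) unfolding asymptotic_gap_def by blast
  define F\<^sub>2 where "F\<^sub>2 = {i \<in> A. \<not> \<bar>Re (\<mu> i) - \<beta>\<bar> < b}"
  have finite_far: "finite F\<^sub>2"
    using tendstoD[OF Re \<open>b > 0\<close>] by (simp add: eventually_cofinite_on dist_real_def F\<^sub>2_def)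
  define K where "K = exp (\<bar>\<beta>\<bar> * T)"
  show thesis
  proof
    show "finite (F\<^sub>1 \<union> F\<^sub>2)" using separated finite_far by simp
    show "\<delta> / K\<^sup>2 > 0" using \<open>\<delta> > 0\<close> by (simp add: K_def)
    fix J x assume J: "finite J" "J \<subseteq> A - (F\<^sub>1 \<union> F\<^sub>2)"
    let ?\<nu> = "\<lambda>i. \<mu> i - of_real \<beta>"
    have "gap_separated \<gamma>' J (\<lambda>i. Im (?\<nu> i))"
      using gap_separated_subset[OF separated(2)] J by (simp add: Diff_Un le_infI1)
    then have "\<delta> * sum_sq J x \<le> L2_sq T (exp_sum J ?\<nu> x)"
      using J by (intro ingham) (auto simp: F\<^sub>2_def)
    also have "\<dots> \<le> K\<^sup>2 * L2_sq T (exp_sum J \<mu> x)"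
      unfolding K_def by (rule L2_sq_exp_sum_shift_exponents_le)
    finally show "\<delta> / K\<^sup>2 * sum_sq J x \<le> L2_sq T (exp_sum J \<mu> x)"
      by (simp add: K_def field_simps)
  qed
qed

definition bessel_family :: "real \<Rightarrow> 'i set \<Rightarrow> ('i \<Rightarrow> complex) \<Rightarrow> bool" where
  "bessel_family T A \<mu> \<longleftrightarrow>
    (\<exists>B>0. \<forall>J x. finite J \<longrightarrow> J \<subseteq> A \<longrightarrow> L2_sq T (exp_sum J \<mu> x) \<le> B * sum_sq J x)"

lemma bessel_family_finite:
  assumes "finite F" "T \<ge> 0"
  shows "bessel_family T F \<mu>"
proof -
  define \<rho> where "\<rho> = (\<Sum>i\<in>F. \<bar>Re (\<mu> i)\<bar>)"
  define B where "B = T * exp (2 * \<rho> * T) * real (card F)"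
  have "L2_sq T (exp_sum J \<mu> x) \<le> (B + 1) * sum_sq J x" if J: "J \<subseteq> F" for J x
  proof -
    have "\<bar>Re (\<mu> i)\<bar> \<le> \<rho>" if "i \<in> J" for i
      unfolding \<rho>_def using that J assms(1) by (intro member_le_sum) auto
    then have "L2_sq T (exp_sum J \<mu> x) \<le> T * exp (2 * \<rho> * T) * (\<Sum>i\<in>J. cmod (x i))\<^sup>2"
      using assms(2) by (rule L2_sq_exp_sum_le_sum_norm)
    also have "\<dots> \<le> T * exp (2 * \<rho> * T) * (sum_sq J x * real (card F))"
    proof (rule mult_left_mono)
      have "(\<Sum>i\<in>J. cmod (x i))\<^sup>2 \<le> sum_sq J x * real (card J)"
        unfolding sum_sq_def by (rule sum_squared_le_sum_of_squares)
      also have "\<dots> \<le> sum_sq J x * real (card F)"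
        using J assms(1) by (intro mult_left_mono sum_sq_nonneg) (simp add: card_mono)
      finally show "(\<Sum>i\<in>J. cmod (x i))\<^sup>2 \<le> sum_sq J x * real (card F)" .
    qed (use assms(2) in simp)
    also have "\<dots> = B * sum_sq J x" by (simp add: B_def mult_ac)
    also have "\<dots> \<le> (B + 1) * sum_sq J x"
      using sum_sq_nonneg[of J x] by (simp add: distrib_right)
    finally show ?thesis .
  qed
  moreover have "B + 1 > 0" using assms(2) by (simp add: B_def add_nonneg_pos)
  ultimately show ?thesis unfolding bessel_family_def by blast
qed

lemma bessel_family_Un:
  assumes "bessel_family T A \<mu>" "bessel_family T B \<mu>"
  shows "bessel_family T (A \<union> B) \<mu>"
proof -
  obtain K L where pos: "K > 0" "L > 0"
    and bessel_A: "\<And>J x. finite J \<Longrightarrow> J \<subseteq> A \<Longrightarrow> L2_sq T (exp_sum J \<mu> x) \<le> K * sum_sq J x"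
    and bessel_B: "\<And>J x. finite J \<Longrightarrow> J \<subseteq> B \<Longrightarrow> L2_sq T (exp_sum J \<mu> x) \<le> L * sum_sq J x"
    using assms unfolding bessel_family_def by metis
  have "L2_sq T (exp_sum J \<mu> x) \<le> 2 * (K + L) * sum_sq J x" if J: "finite J" "J \<subseteq> A \<union> B" for J x
  proof -
    have "exp_sum J \<mu> x = (\<lambda>t. exp_sum (J \<inter> A) \<mu> x t + exp_sum (J - A) \<mu> x t)"
      using exp_sum_Un_disjoint[of "J \<inter> A" "J - A" \<mu> x] J by (auto simp: Int_Diff_Un)
    then have "L2_sq T (exp_sum J \<mu> x) \<le> 2 * L2_sq T (exp_sum (J \<inter> A) \<mu> x) + 2 * L2_sq T (exp_sum (J - A) \<mu> x)"
      using L2_sq_add_le[OF square_integrable_exp_sum square_integrable_exp_sum, of T "J \<inter> A" \<mu> x "J - A" \<mu> x]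
        square_integrable_exp_sum[of T J \<mu> x] by simp
    also have "\<dots> \<le> 2 * (K * sum_sq (J \<inter> A) x) + 2 * (L * sum_sq (J - A) x)"
      using J by (intro add_mono mult_left_mono bessel_A bessel_B) auto
    also have "\<dots> \<le> 2 * (K * sum_sq J x) + 2 * (L * sum_sq J x)"
      using J pos by (intro add_mono mult_left_mono sum_sq_mono) auto
    finally show ?thesis by (simp add: algebra_simps)
  qed
  moreover have "2 * (K + L) > 0" using pos by simp
  ultimately show ?thesis unfolding bessel_family_def by blast
qed

lemma bessel_family_subset: "bessel_family T B \<mu> \<Longrightarrow> A \<subseteq> B \<Longrightarrow> bessel_family T A \<mu>"
  unfolding bessel_family_def by (meson subset_trans)

lemma bessel_family_asymptotic_gap:
  assumes gap: "asymptotic_gap \<gamma> A (\<lambda>i. Im (\<mu> i))" and Re: "((\<lambda>i. Re (\<mu> i)) \<longlongrightarrow> \<beta>) (cofinite_on A)"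
    and \<gamma>: "\<gamma> > 0" and T: "T \<ge> 0"
  shows "bessel_family T A \<mu>"
proof -
  obtain \<gamma>' where \<gamma>': "0 < \<gamma>'" "\<gamma>' < \<gamma>" using dense \<gamma> by blast
  obtain F\<^sub>1 where separated: "finite F\<^sub>1" "gap_separated \<gamma>' (A - F\<^sub>1) (\<lambda>i. Im (\<mu> i))"
    using gap \<gamma>'(2) unfolding asymptotic_gap_def by blast
  define F\<^sub>2 where "F\<^sub>2 = {i \<in> A. \<not> \<bar>Re (\<mu> i) - \<beta>\<bar> < 1}"
  have finite_far: "finite F\<^sub>2"
    using tendstoD[OF Re, of 1] by (simp add: eventually_cofinite_on dist_real_def F\<^sub>2_def)
  obtain B where B: "B > 0"
    "\<And>J \<mu> x. finite (J :: 'a set) \<Longrightarrow> gap_separated \<gamma>' J (\<lambda>i. Im (\<mu> i)) \<Longrightarrow> (\<And>i. i \<in> J \<Longrightarrow> \<bar>Re (\<mu> i)\<bar> \<le> \<bar>\<beta>\<bar> + 1)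
      \<Longrightarrow> L2_sq T (exp_sum J \<mu> x) \<le> B * sum_sq J x"
    using ingham_upper[OF \<gamma>'(1)] by blast
  have "bessel_family T (A - (F\<^sub>1 \<union> F\<^sub>2)) \<mu>"
    unfolding bessel_family_def
  proof (intro exI[of _ B] conjI allI impI B)
    fix J assume J: "J \<subseteq> A - (F\<^sub>1 \<union> F\<^sub>2)"
    show "gap_separated \<gamma>' J (\<lambda>i. Im (\<mu> i))"
      by (rule gap_separated_subset[OF separated(2)]) (use J in auto)
    show "\<bar>Re (\<mu> i)\<bar> \<le> \<bar>\<beta>\<bar> + 1" if "i \<in> J" for i
      using J that by (auto simp: F\<^sub>2_def)
  qed
  then have "bessel_family T (A - (F\<^sub>1 \<union> F\<^sub>2) \<union> (F\<^sub>1 \<union> F\<^sub>2)) \<mu>"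
    using separated(1) finite_far T by (intro bessel_family_Un) (auto intro: bessel_family_finite)
  then show ?thesis by (rule bessel_family_subset) auto
qed

lemma asymptotic_gap_finite_bounded:
  assumes gap: "asymptotic_gap \<gamma> A (\<lambda>i. Im (\<mu> i))" and \<gamma>: "\<gamma> > 0"
  shows "finite {i \<in> A. cmod (\<mu> i) \<le> \<Lambda>}"
proof -
  obtain \<gamma>' where \<gamma>': "0 < \<gamma>'" "\<gamma>' < \<gamma>" using dense \<gamma> by blast
  obtain F where F: "finite F" "gap_separated \<gamma>' (A - F) (\<lambda>i. Im (\<mu> i))"
    using gap \<gamma>'(2) unfolding asymptotic_gap_def by blast
  let ?X = "{i \<in> A - F. cmod (\<mu> i) \<le> \<Lambda>}" and ?f = "\<lambda>i. \<lfloor>Im (\<mu> i) / \<gamma>'\<rfloor>"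
  have "inj_on ?f ?X"
  proof (rule inj_onI)
    fix i j assume "i \<in> ?X" "j \<in> ?X" and "?f i = ?f j"
    then show "i = j"
      using gap_separatedD[OF F(2), of i j] same_floor_imp_close[OF \<gamma>'(1), of "Im (\<mu> i)" "Im (\<mu> j)"] by force
  qed
  moreover have "?f ` ?X \<subseteq> {\<lfloor>- \<Lambda> / \<gamma>'\<rfloor>..\<lfloor>\<Lambda> / \<gamma>'\<rfloor>}"
  proof (clarsimp, intro conjI floor_mono)
    fix i assume "cmod (\<mu> i) \<le> \<Lambda>"
    then have "\<bar>Im (\<mu> i)\<bar> \<le> \<Lambda>" using abs_Im_le_cmod order_trans by blast
    then have "- \<Lambda> \<le> Im (\<mu> i)" "Im (\<mu> i) \<le> \<Lambda>" by auto
    then show "- (\<Lambda> / \<gamma>') \<le> Im (\<mu> i) / \<gamma>'" "Im (\<mu> i) / \<gamma>' \<le> \<Lambda> / \<gamma>'"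
      using \<gamma>'(1) by (simp_all add: field_simps)
  qed
  ultimately have "finite ?X" using finite_subset finite_imageD by blast
  then have "finite (F \<union> ?X)" using F(1) by simp
  then show ?thesis by (rule finite_subset[rotated]) auto
qed

lemma exp_sum_has_vector_derivative:
  "(exp_sum J \<mu> x has_vector_derivative exp_sum J \<mu> (\<lambda>i. \<mu> i * x i) t) (at t)"
proof -
  have "((\<lambda>w. \<Sum>i\<in>J. x i * exp (\<mu> i * w)) has_field_derivative exp_sum J \<mu> (\<lambda>i. \<mu> i * x i) t) (at (of_real t))"
    unfolding exp_sum_def by (rule DERIV_sum) (auto intro!: derivative_eq_intros)
  then show ?thesis
    unfolding exp_sum_def[abs_def] by (rule has_vector_derivative_real_field)
qed

lemma exp_sum_eq_0D:
  assumes "finite J" "inj_on \<mu> J" "T > 0" "\<And>t. t \<in> {0<..<T} \<Longrightarrow> exp_sum J \<mu> x t = 0" "i \<in> J"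
  shows "x i = 0"
  using assms
proof (induction J arbitrary: x i rule: finite_induct)
  case (insert j J)
  have "exp_sum J \<mu> (\<lambda>i. (\<mu> i - \<mu> j) * x i) t = 0" if t: "t \<in> {0<..<T}" for t
  proof -
    have "((\<lambda>_. 0) has_vector_derivative exp_sum (insert j J) \<mu> (\<lambda>i. \<mu> i * x i) t) (at t)"
      by (rule has_vector_derivative_transform_within_open[OF exp_sum_has_vector_derivative, where S = "{0<..<T}"])
         (use t insert.prems(3) in auto)
    then have "exp_sum (insert j J) \<mu> (\<lambda>i. \<mu> i * x i) t = 0"
      using vector_derivative_unique_at has_vector_derivative_const by blast
    then have "exp_sum (insert j J) \<mu> (\<lambda>i. \<mu> i * x i - \<mu> j * x i) t = 0"
      using insert.prems(3)[OF t] by (simp add: exp_sum_diff exp_sum_scale)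
    then show ?thesis using insert.hyps by (simp add: exp_sum_def left_diff_distrib)
  qed
  then have "(\<mu> i - \<mu> j) * x i = 0" if "i \<in> J" for i
    using insert.IH[of "\<lambda>i. (\<mu> i - \<mu> j) * x i"] insert.prems(1,2) that by simp
  moreover have "\<mu> i \<noteq> \<mu> j" if "i \<in> J" for i
    using insert.prems(1) insert.hyps(2) that by (auto simp: inj_on_def)
  ultimately have J: "x i = 0" if "i \<in> J" for i using that by auto
  then have "exp_sum (insert j J) \<mu> x (T / 2) = x j * exp (\<mu> j * of_real (T / 2))"
    using insert.hyps by (simp add: exp_sum_def)
  then have "x j = 0" using insert.prems(3)[of "T / 2"] \<open>T > 0\<close> by simp
  with J insert.prems(4) show ?case by auto
qed simp

lemma tendsto_cofinite_on_bounded: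
  fixes f :: "'i \<Rightarrow> 'a::real_normed_vector"
  assumes "(f \<longlongrightarrow> l) (cofinite_on A)"
  obtains C where "\<And>i. i \<in> A \<Longrightarrow> norm (f i) \<le> C"
proof
  let ?F = "{i \<in> A. \<not> dist (f i) l < 1}"
  have F: "finite ?F" using tendstoD[OF assms, of 1] by (simp add: eventually_cofinite_on)
  fix i assume "i \<in> A"
  show "norm (f i) \<le> norm l + 1 + (\<Sum>i\<in>?F. norm (f i))"
  proof (cases "i \<in> ?F")
    case True
    then show ?thesis using member_le_sum[OF True _ F, of "\<lambda>i. norm (f i)"] by (simp add: add_increasing)
  next
    case False
    then have "norm (f i - l) < 1" using \<open>i \<in> A\<close> by (simp add: dist_norm)
    then have "norm (f i) \<le> norm l + 1" using norm_triangle_ineq2[of "f i" l] by linarith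
    then show ?thesis by (simp add: add_increasing2 sum_nonneg)
  qed
qed

lemma L2_sq_exp_sum_part_le:
  assumes "finite H" "finite L" "finite R" and "H \<inter> (L \<union> R) = {}" "L \<inter> R = {}"
  shows "L2_sq T (exp_sum H \<mu> x) \<le> 2 * L2_sq T (exp_sum (H \<union> (L \<union> R)) \<mu> x)
    + 2 * (2 * L2_sq T (exp_sum L \<mu> x) + 2 * L2_sq T (exp_sum R \<mu> x))"
proof -
  have "exp_sum H \<mu> x = (\<lambda>t. exp_sum (H \<union> (L \<union> R)) \<mu> x t - (exp_sum L \<mu> x t + exp_sum R \<mu> x t))"
    using assms by (simp add: fun_eq_iff exp_sum_Un_disjoint)
  then have "L2_sq T (exp_sum H \<mu> x) \<le> 2 * L2_sq T (exp_sum (H \<union> (L \<union> R)) \<mu> x)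
      + 2 * L2_sq T (\<lambda>t. exp_sum L \<mu> x t + exp_sum R \<mu> x t)"
    by (simp only:) (intro L2_sq_diff_le square_integrable_continuous continuous_intros)
  also have "\<dots> \<le> 2 * L2_sq T (exp_sum (H \<union> (L \<union> R)) \<mu> x)
      + 2 * (2 * L2_sq T (exp_sum L \<mu> x) + 2 * L2_sq T (exp_sum R \<mu> x))"
    by (intro add_left_mono mult_left_mono L2_sq_add_le square_integrable_continuous continuous_intros) simp
  finally show ?thesis .
qed

subsection \<open>Coupled families observed through two channels\<close>

locale mode_system =
  fixes \<mu> p q :: "'i \<Rightarrow> complex" and A B S :: "'i set" and \<gamma> \<alpha> \<beta> \<rho> :: real
  assumes gap: "asymptotic_gap \<gamma> A (\<lambda>i. Im (\<mu> i))" "asymptotic_gap \<gamma> B (\<lambda>i. Im (\<mu> i))"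
    and Re_tendsto: "((\<lambda>i. Re (\<mu> i)) \<longlongrightarrow> \<alpha>) (cofinite_on A)" "((\<lambda>i. Re (\<mu> i)) \<longlongrightarrow> \<beta>) (cofinite_on B)"
    and \<gamma>_pos: "\<gamma> > 0"
    and disjoint: "A \<inter> B = {}" "(A \<union> B) \<inter> S = {}"
    and p_eq_1: "\<And>i. i \<in> A \<union> S \<Longrightarrow> p i = 1" and p_tendsto: "(p \<longlongrightarrow> 0) (cofinite_on B)"
    and q_eq_1: "\<And>i. i \<in> B \<Longrightarrow> q i = 1" and q_eq_0: "\<And>i. i \<in> S \<Longrightarrow> q i = 0"
    and q_tendsto: "(q \<longlongrightarrow> 0) (cofinite_on A)"
    and \<rho>_nonneg: "\<rho> \<ge> 0" and residual_le: "\<And>i. i \<in> S \<Longrightarrow> cmod (\<mu> i) \<le> \<rho>"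
begin

definition observed :: "real \<Rightarrow> 'i set \<Rightarrow> ('i \<Rightarrow> complex) \<Rightarrow> real" where
  "observed T J x = L2_sq T (exp_sum J \<mu> (\<lambda>i. p i * x i)) + L2_sq T (exp_sum J \<mu> (\<lambda>i. q i * x i))"

definition modal_energy :: "'i set \<Rightarrow> ('i \<Rightarrow> complex) \<Rightarrow> real" where
  "modal_energy J x = sum_sq (J \<inter> (A \<union> B)) x"

definition residual_mass :: "'i set \<Rightarrow> ('i \<Rightarrow> complex) \<Rightarrow> real" where
  "residual_mass J x = (\<Sum>i\<in>J \<inter> S. cmod (x i))"

lemma observed_nonneg: "observed T J x \<ge> 0"
  by (simp add: observed_def L2_sq_nonneg)

lemma residual_mass_nonneg: "residual_mass J x \<ge> 0"
  by (simp add: residual_mass_def sum_nonneg)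

lemma bessel_family_main:
  assumes "T \<ge> 0"
  shows "bessel_family T (A \<union> B) \<mu>"
  using gap Re_tendsto \<gamma>_pos assms by (intro bessel_family_Un bessel_family_asymptotic_gap)

lemma weights_bounded:
  obtains C where "\<And>i. i \<in> A \<union> B \<Longrightarrow> cmod (p i) \<le> C" "\<And>i. i \<in> A \<union> B \<Longrightarrow> cmod (q i) \<le> C"
proof -
  obtain C\<^sub>p C\<^sub>q where C: "\<And>i. i \<in> B \<Longrightarrow> cmod (p i) \<le> C\<^sub>p" "\<And>i. i \<in> A \<Longrightarrow> cmod (q i) \<le> C\<^sub>q"
    using tendsto_cofinite_on_bounded[OF p_tendsto] tendsto_cofinite_on_bounded[OF q_tendsto] by metis
  show thesis
  proof
    fix i assume "i \<in> A \<union> B"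
    then show "cmod (p i) \<le> max 1 (max C\<^sub>p C\<^sub>q)" "cmod (q i) \<le> max 1 (max C\<^sub>p C\<^sub>q)"
      using C[of i] p_eq_1[of i] q_eq_1[of i] by (auto simp: le_max_iff_disj)
  qed
qed

lemma weights_le_1: "i \<in> S \<Longrightarrow> cmod (p i) \<le> 1" "i \<in> S \<Longrightarrow> cmod (q i) \<le> 1"
  by (simp_all add: p_eq_1 q_eq_0)

lemma L2_sq_residual_le:
  assumes T: "T \<ge> 0" and w: "\<And>i. i \<in> S \<Longrightarrow> cmod (w i) \<le> 1"
  shows "L2_sq T (exp_sum (J \<inter> S) \<mu> (\<lambda>i. w i * x i)) \<le> T * exp (2 * \<rho> * T) * (residual_mass J x)\<^sup>2"
proof -
  have "\<bar>Re (\<mu> i)\<bar> \<le> \<rho>" if "i \<in> J \<inter> S" for i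
    using abs_Re_le_cmod residual_le that by (blast intro: order_trans)
  then have "L2_sq T (exp_sum (J \<inter> S) \<mu> (\<lambda>i. w i * x i))
      \<le> T * exp (2 * \<rho> * T) * (\<Sum>i\<in>J \<inter> S. cmod (w i * x i))\<^sup>2"
    using T by (rule L2_sq_exp_sum_le_sum_norm)
  also have "\<dots> \<le> T * exp (2 * \<rho> * T) * (residual_mass J x)\<^sup>2"
    unfolding residual_mass_def norm_mult using w T
    by (intro mult_left_mono power_mono sum_mono sum_nonneg) (auto intro: mult_left_le_one_le)
  finally show ?thesis .
qed

lemma channel_upper:
  assumes T: "T \<ge> 0"
    and bessel: "\<And>J x. finite J \<Longrightarrow> J \<subseteq> A \<union> B \<Longrightarrow> L2_sq T (exp_sum J \<mu> x) \<le> K * sum_sq J x" and K: "K \<ge> 0"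
    and w: "\<And>i. i \<in> A \<union> B \<Longrightarrow> cmod (w i) \<le> C" "\<And>i. i \<in> S \<Longrightarrow> cmod (w i) \<le> 1"
    and J: "finite J" "J \<subseteq> A \<union> B \<union> S"
  shows "L2_sq T (exp_sum J \<mu> (\<lambda>i. w i * x i))
    \<le> 2 * (K * C\<^sup>2) * modal_energy J x + 2 * (T * exp (2 * \<rho> * T)) * (residual_mass J x)\<^sup>2"
proof -
  let ?y = "\<lambda>i. w i * x i" and ?M = "J \<inter> (A \<union> B)"
  have "J = ?M \<union> (J \<inter> S)" using J(2) by blast
  then have "exp_sum J \<mu> ?y t = exp_sum ?M \<mu> ?y t + exp_sum (J \<inter> S) \<mu> ?y t" for t
    using exp_sum_Un_disjoint[of ?M "J \<inter> S"] J(1) disjoint by (simp add: Int_assoc inf_left_commute)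
  then have "exp_sum J \<mu> ?y = (\<lambda>t. exp_sum ?M \<mu> ?y t + exp_sum (J \<inter> S) \<mu> ?y t)" by blast
  then have "L2_sq T (exp_sum J \<mu> ?y) \<le> 2 * L2_sq T (exp_sum ?M \<mu> ?y) + 2 * L2_sq T (exp_sum (J \<inter> S) \<mu> ?y)"
    by (simp only:) (intro L2_sq_add_le square_integrable_continuous continuous_intros)
  also have "\<dots> \<le> 2 * (K * (C\<^sup>2 * modal_energy J x)) + 2 * (T * exp (2 * \<rho> * T) * (residual_mass J x)\<^sup>2)"
  proof (intro add_mono mult_left_mono L2_sq_residual_le T w)
    have "L2_sq T (exp_sum ?M \<mu> ?y) \<le> K * sum_sq ?M ?y" using J by (intro bessel) auto
    also have "\<dots> \<le> K * (C\<^sup>2 * modal_energy J x)"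
      unfolding modal_energy_def using w K by (intro mult_left_mono sum_sq_mult_le) auto
    finally show "L2_sq T (exp_sum ?M \<mu> ?y) \<le> K * (C\<^sup>2 * modal_energy J x)" .
  qed auto
  finally show ?thesis by (simp add: mult.assoc)
qed

lemma observed_upper:
  assumes T: "T \<ge> 0"
  obtains K where "K > 0" "\<And>J x. finite J \<Longrightarrow> J \<subseteq> A \<union> B \<union> S
    \<Longrightarrow> observed T J x \<le> K * (modal_energy J x + (residual_mass J x)\<^sup>2)"
proof -
  obtain K where K: "K > 0" "\<And>J x. finite J \<Longrightarrow> J \<subseteq> A \<union> B \<Longrightarrow> L2_sq T (exp_sum J \<mu> x) \<le> K * sum_sq J x"
    using bessel_family_main[OF T] unfolding bessel_family_def by blast
  obtain C where C: "\<And>i. i \<in> A \<union> B \<Longrightarrow> cmod (p i) \<le> C" "\<And>i. i \<in> A \<union> B \<Longrightarrow> cmod (q i) \<le> C"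
    using weights_bounded by blast
  define K' where "K' = 4 * (K * C\<^sup>2) + 4 * (T * exp (2 * \<rho> * T)) + 1"
  show thesis
  proof
    show "K' > 0" using K(1) T by (simp add: K'_def add_nonneg_pos)
    fix J x assume J: "finite J" "J \<subseteq> A \<union> B \<union> S"
    have energy_nonneg: "0 \<le> modal_energy J x" by (simp add: modal_energy_def sum_sq_nonneg)
    have "observed T J x \<le> 4 * (K * C\<^sup>2) * modal_energy J x + 4 * (T * exp (2 * \<rho> * T)) * (residual_mass J x)\<^sup>2"
      unfolding observed_def using channel_upper[where w = p and x = x, OF T K(2) _ C(1) weights_le_1(1) J]
        channel_upper[where w = q and x = x, OF T K(2) _ C(2) weights_le_1(2) J] K(1) by simp
    also have "\<dots> \<le> K' * modal_energy J x + K' * (residual_mass J x)\<^sup>2"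
      using K(1) T energy_nonneg by (intro add_mono mult_right_mono) (auto simp: K'_def)
    finally show "observed T J x \<le> K' * (modal_energy J x + (residual_mass J x)\<^sup>2)"
      by (simp add: distrib_left)
  qed
qed

lemma channel_lower:
  assumes T: "T \<ge> 0" and K: "K \<ge> 0"
    and bessel: "\<And>J x. finite J \<Longrightarrow> J \<subseteq> A \<union> B \<Longrightarrow> L2_sq T (exp_sum J \<mu> x) \<le> K * sum_sq J x"
    and lower: "\<And>J x. finite J \<Longrightarrow> J \<subseteq> H \<Longrightarrow> \<delta> * sum_sq J x \<le> L2_sq T (exp_sum J \<mu> x)"
    and partition: "A \<union> B = H \<union> (G \<union> F)" "H \<inter> (G \<union> F) = {}" "G \<inter> F = {}"
    and w: "\<And>i. i \<in> H \<Longrightarrow> w i = 1" "\<And>i. i \<in> G \<Longrightarrow> cmod (w i) \<le> \<epsilon>" "\<And>i. i \<in> F \<Longrightarrow> cmod (w i) \<le> C"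
      "\<And>i. i \<in> S \<Longrightarrow> cmod (w i) \<le> 1"
    and J: "finite J" "J \<subseteq> A \<union> B \<union> S"
  shows "\<delta> * sum_sq (J \<inter> H) x \<le> 2 * L2_sq T (exp_sum J \<mu> (\<lambda>i. w i * x i))
    + 4 * (K * (\<epsilon>\<^sup>2 * sum_sq (J \<inter> G) x + C\<^sup>2 * sum_sq (J \<inter> F) x))
    + 4 * (T * exp (2 * \<rho> * T) * (residual_mass J x)\<^sup>2)"
proof -
  let ?y = "\<lambda>i. w i * x i" and ?L = "J \<inter> (G \<union> F)"
  have J_eq: "J = (J \<inter> H) \<union> (?L \<union> (J \<inter> S))" using J(2) partition(1) by blast
  have "\<delta> * sum_sq (J \<inter> H) x \<le> L2_sq T (exp_sum (J \<inter> H) \<mu> x)" using J by (intro lower) auto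
  also have "exp_sum (J \<inter> H) \<mu> x = exp_sum (J \<inter> H) \<mu> ?y" by (rule exp_sum_cong) (simp add: w(1))
  also have "L2_sq T (exp_sum (J \<inter> H) \<mu> ?y) \<le> 2 * L2_sq T (exp_sum J \<mu> ?y)
      + 2 * (2 * L2_sq T (exp_sum ?L \<mu> ?y) + 2 * L2_sq T (exp_sum (J \<inter> S) \<mu> ?y))"
    using L2_sq_exp_sum_part_le[of "J \<inter> H" ?L "J \<inter> S" T \<mu> ?y] J(1) partition disjoint(2) J_eq by auto
  also have "\<dots> \<le> 2 * L2_sq T (exp_sum J \<mu> ?y)
      + 2 * (2 * (K * (\<epsilon>\<^sup>2 * sum_sq (J \<inter> G) x + C\<^sup>2 * sum_sq (J \<inter> F) x))
        + 2 * (T * exp (2 * \<rho> * T) * (residual_mass J x)\<^sup>2))"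
  proof (intro add_left_mono add_mono mult_left_mono L2_sq_residual_le T w)
    have "L2_sq T (exp_sum ?L \<mu> ?y) \<le> K * sum_sq ?L ?y" using J partition(1) by (intro bessel) auto
    also have "\<dots> \<le> K * (\<epsilon>\<^sup>2 * sum_sq (J \<inter> G) x + C\<^sup>2 * sum_sq (J \<inter> F) x)"
    proof (rule mult_left_mono[OF _ K])
      have "sum_sq ?L ?y = sum_sq (J \<inter> G) ?y + sum_sq (J \<inter> F) ?y"
        using J(1) partition(3) by (subst sum_sq_Un_disjoint[symmetric]) (auto simp: Int_Un_distrib)
      also have "\<dots> \<le> \<epsilon>\<^sup>2 * sum_sq (J \<inter> G) x + C\<^sup>2 * sum_sq (J \<inter> F) x"
        using w by (intro add_mono sum_sq_mult_le) auto
      finally show "sum_sq ?L ?y \<le> \<epsilon>\<^sup>2 * sum_sq (J \<inter> G) x + C\<^sup>2 * sum_sq (J \<inter> F) x" .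
    qed
    finally show "L2_sq T (exp_sum ?L \<mu> ?y) \<le> K * (\<epsilon>\<^sup>2 * sum_sq (J \<inter> G) x + C\<^sup>2 * sum_sq (J \<inter> F) x)" .
  qed auto
  finally show ?thesis by simp
qed

lemma decoupling_set:
  assumes T: "T > 2 * pi / \<gamma>" and \<epsilon>: "\<And>\<delta>::real. \<delta> > 0 \<Longrightarrow> \<epsilon> \<delta> > 0"
  obtains F \<delta> where "finite F" "F \<subseteq> A \<union> B" "\<delta> > 0"
    "\<And>J x. finite J \<Longrightarrow> J \<subseteq> A - F \<Longrightarrow> \<delta> * sum_sq J x \<le> L2_sq T (exp_sum J \<mu> x)"
    "\<And>J x. finite J \<Longrightarrow> J \<subseteq> B - F \<Longrightarrow> \<delta> * sum_sq J x \<le> L2_sq T (exp_sum J \<mu> x)"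
    "\<And>i. i \<in> B - F \<Longrightarrow> cmod (p i) \<le> \<epsilon> \<delta>" "\<And>i. i \<in> A - F \<Longrightarrow> cmod (q i) \<le> \<epsilon> \<delta>"
proof -
  obtain F\<^sub>1 \<delta>\<^sub>1 where lower_A: "finite F\<^sub>1" "\<delta>\<^sub>1 > 0"
    "\<And>J x. finite J \<Longrightarrow> J \<subseteq> A - F\<^sub>1 \<Longrightarrow> \<delta>\<^sub>1 * sum_sq J x \<le> L2_sq T (exp_sum J \<mu> x)"
    using asymptotic_gap_lower[OF gap(1) Re_tendsto(1) \<gamma>_pos T] by blast
  obtain F\<^sub>2 \<delta>\<^sub>2 where lower_B: "finite F\<^sub>2" "\<delta>\<^sub>2 > 0"
    "\<And>J x. finite J \<Longrightarrow> J \<subseteq> B - F\<^sub>2 \<Longrightarrow> \<delta>\<^sub>2 * sum_sq J x \<le> L2_sq T (exp_sum J \<mu> x)"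
    using asymptotic_gap_lower[OF gap(2) Re_tendsto(2) \<gamma>_pos T] by blast
  define \<delta> where "\<delta> = min \<delta>\<^sub>1 \<delta>\<^sub>2"
  have \<delta>: "\<delta> > 0" "\<And>J x. \<delta> * sum_sq J x \<le> \<delta>\<^sub>1 * sum_sq J x" "\<And>J x. \<delta> * sum_sq J x \<le> \<delta>\<^sub>2 * sum_sq J x"
    using lower_A(2) lower_B(2) by (auto simp: \<delta>_def intro!: mult_right_mono sum_sq_nonneg)
  define F\<^sub>3 where "F\<^sub>3 = {i \<in> B. \<not> cmod (p i) < \<epsilon> \<delta>} \<union> {i \<in> A. \<not> cmod (q i) < \<epsilon> \<delta>}"
  have finite_large_weights: "finite F\<^sub>3"
    using tendstoD[OF p_tendsto \<epsilon>[OF \<delta>(1)]] tendstoD[OF q_tendsto \<epsilon>[OF \<delta>(1)]]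
    by (simp add: eventually_cofinite_on F\<^sub>3_def)
  show thesis
  proof (rule that[of "(F\<^sub>1 \<union> F\<^sub>2 \<union> F\<^sub>3) \<inter> (A \<union> B)" \<delta>])
    show "\<delta> * sum_sq J x \<le> L2_sq T (exp_sum J \<mu> x)"
      if "finite J" "J \<subseteq> A - (F\<^sub>1 \<union> F\<^sub>2 \<union> F\<^sub>3) \<inter> (A \<union> B)" for J x
      using that by (intro order_trans[OF \<delta>(2) lower_A(3)]) auto
    show "\<delta> * sum_sq J x \<le> L2_sq T (exp_sum J \<mu> x)"
      if "finite J" "J \<subseteq> B - (F\<^sub>1 \<union> F\<^sub>2 \<union> F\<^sub>3) \<inter> (A \<union> B)" for J x
      using that by (intro order_trans[OF \<delta>(3) lower_B(3)]) auto
  qed (use lower_A lower_B \<delta> finite_large_weights in \<open>auto simp: F\<^sub>3_def\<close>)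
qed

lemma modal_energy_split:
  assumes "finite J" "F \<subseteq> A \<union> B"
  shows "modal_energy J x = sum_sq (J \<inter> (A - F)) x + sum_sq (J \<inter> (B - F)) x + sum_sq (J \<inter> F) x"
proof -
  have "J \<inter> (A \<union> B) = (J \<inter> (A - F)) \<union> ((J \<inter> (B - F)) \<union> (J \<inter> F))" using assms(2) by blast
  then show ?thesis
    unfolding modal_energy_def using assms(1) disjoint(1)
    by (simp only:) (subst sum_sq_Un_disjoint; auto simp: sum_sq_Un_disjoint)+
qed

text \<open>The cross terms \<open>\<epsilon>\<^sup>2\<close> of each channel are absorbed by the main term of the other one.\<close>

lemma coupled_channels_lower:
  assumes T: "T \<ge> 0" and K: "K \<ge> 0"
    and bessel: "\<And>J x. finite J \<Longrightarrow> J \<subseteq> A \<union> B \<Longrightarrow> L2_sq T (exp_sum J \<mu> x) \<le> K * sum_sq J x"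
    and lower: "\<And>J x. finite J \<Longrightarrow> J \<subseteq> A - F \<Longrightarrow> \<delta> * sum_sq J x \<le> L2_sq T (exp_sum J \<mu> x)"
      "\<And>J x. finite J \<Longrightarrow> J \<subseteq> B - F \<Longrightarrow> \<delta> * sum_sq J x \<le> L2_sq T (exp_sum J \<mu> x)"
    and F: "F \<subseteq> A \<union> B" and C: "\<And>i. i \<in> F \<Longrightarrow> cmod (p i) \<le> C" "\<And>i. i \<in> F \<Longrightarrow> cmod (q i) \<le> C"
    and small: "\<And>i. i \<in> B - F \<Longrightarrow> cmod (p i) \<le> \<epsilon>" "\<And>i. i \<in> A - F \<Longrightarrow> cmod (q i) \<le> \<epsilon>"
    and \<epsilon>: "8 * (K * \<epsilon>\<^sup>2) = \<delta>"
    and J: "finite J" "J \<subseteq> A \<union> B \<union> S"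
  shows "\<delta> / 2 * (sum_sq (J \<inter> (A - F)) x + sum_sq (J \<inter> (B - F)) x) \<le> 2 * observed T J x
    + 8 * (K * C\<^sup>2) * sum_sq (J \<inter> F) x + 8 * (T * exp (2 * \<rho> * T)) * (residual_mass J x)\<^sup>2"
proof -
  define a b f r where "a = sum_sq (J \<inter> (A - F)) x" and "b = sum_sq (J \<inter> (B - F)) x"
    and "f = sum_sq (J \<inter> F) x" and "r = (residual_mass J x)\<^sup>2"
  have partition: "A \<union> B = (A - F) \<union> ((B - F) \<union> F)" "A \<union> B = (B - F) \<union> ((A - F) \<union> F)"
    using F by blast+
  have cross: "4 * (K * (\<epsilon>\<^sup>2 * y)) = \<delta> / 2 * y" for y using \<epsilon> by (simp add: field_simps)
  have "\<delta> * a \<le> 2 * L2_sq T (exp_sum J \<mu> (\<lambda>i. p i * x i)) + 4 * (K * (\<epsilon>\<^sup>2 * b + C\<^sup>2 * f)) + 4 * (T * exp (2 * \<rho> * T) * r)"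
    unfolding a_def b_def f_def r_def
    by (rule channel_lower[OF T K bessel lower(1) partition(1)])
       (use small C disjoint weights_le_1 p_eq_1 J in auto)
  moreover have "\<delta> * b \<le> 2 * L2_sq T (exp_sum J \<mu> (\<lambda>i. q i * x i)) + 4 * (K * (\<epsilon>\<^sup>2 * a + C\<^sup>2 * f)) + 4 * (T * exp (2 * \<rho> * T) * r)"
    unfolding a_def b_def f_def r_def
    by (rule channel_lower[OF T K bessel lower(2) partition(2)])
       (use small C disjoint weights_le_1 q_eq_1 J in auto)
  ultimately show ?thesis
    unfolding distrib_left cross observed_def a_def[symmetric] b_def[symmetric] f_def[symmetric] r_def[symmetric]
    by (simp add: mult.assoc)
qed

lemma observed_lower_mod_finite:
  assumes T: "T > 2 * pi / \<gamma>"
  obtains F K where "finite F" "F \<subseteq> A \<union> B" "K > 0" "\<And>J x. finite J \<Longrightarrow> J \<subseteq> A \<union> B \<union> S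
    \<Longrightarrow> modal_energy J x \<le> K * (observed T J x + sum_sq (J \<inter> F) x + (residual_mass J x)\<^sup>2)"
proof -
  have T_nonneg: "T \<ge> 0" using critical_time_pos[OF \<gamma>_pos T] by simp
  obtain K where K: "K > 0" "\<And>J x. finite J \<Longrightarrow> J \<subseteq> A \<union> B \<Longrightarrow> L2_sq T (exp_sum J \<mu> x) \<le> K * sum_sq J x"
    using bessel_family_main[OF T_nonneg] unfolding bessel_family_def by blast
  obtain C where C: "\<And>i. i \<in> A \<union> B \<Longrightarrow> cmod (p i) \<le> C" "\<And>i. i \<in> A \<union> B \<Longrightarrow> cmod (q i) \<le> C"
    using weights_bounded by blast
  obtain F \<delta> where F: "finite F" "F \<subseteq> A \<union> B" and \<delta>: "\<delta> > 0"
    and lower: "\<And>J x. finite J \<Longrightarrow> J \<subseteq> A - F \<Longrightarrow> \<delta> * sum_sq J x \<le> L2_sq T (exp_sum J \<mu> x)"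
      "\<And>J x. finite J \<Longrightarrow> J \<subseteq> B - F \<Longrightarrow> \<delta> * sum_sq J x \<le> L2_sq T (exp_sum J \<mu> x)"
    and small: "\<And>i. i \<in> B - F \<Longrightarrow> cmod (p i) \<le> sqrt (\<delta> / (8 * K))" "\<And>i. i \<in> A - F \<Longrightarrow> cmod (q i) \<le> sqrt (\<delta> / (8 * K))"
    by (rule decoupling_set[OF T, of "\<lambda>\<delta>. sqrt (\<delta> / (8 * K))"]) (use K(1) in auto)
  define L where "L = T * exp (2 * \<rho> * T)"
  define K' where "K' = 2 / \<delta> * (2 + 8 * (K * C\<^sup>2) + 8 * L) + 1"
  have L: "L \<ge> 0" using T_nonneg by (simp add: L_def)
  have "0 \<le> 2 / \<delta> * (2 + 8 * (K * C\<^sup>2) + 8 * L)"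
    using K(1) L \<delta> by (intro mult_nonneg_nonneg add_nonneg_nonneg) auto
  then have "K' > 0" by (simp add: K'_def)
  show thesis
  proof (rule that[OF F \<open>K' > 0\<close>])
    fix J x assume J: "finite J" "J \<subseteq> A \<union> B \<union> S"
    define e f r where "e = sum_sq (J \<inter> (A - F)) x + sum_sq (J \<inter> (B - F)) x"
      and "f = sum_sq (J \<inter> F) x" and "r = (residual_mass J x)\<^sup>2"
    have nonneg: "0 \<le> f" "0 \<le> r" "0 \<le> observed T J x"
      by (auto simp: f_def r_def sum_sq_nonneg observed_nonneg)
    have "\<delta> / 2 * e \<le> 2 * observed T J x + 8 * (K * C\<^sup>2) * f + 8 * L * r"
      unfolding e_def f_def r_def L_def
      by (rule coupled_channels_lower[OF T_nonneg _ K(2) lower F(2) _ _ small _ J]) (use K(1) \<delta> C F(2) in auto)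
    also have "\<dots> \<le> (2 + 8 * (K * C\<^sup>2) + 8 * L) * (observed T J x + f + r)"
      unfolding distrib_right distrib_left using K(1) L nonneg by (simp add: add_increasing2 add_increasing)
    finally have "e \<le> 2 / \<delta> * (2 + 8 * (K * C\<^sup>2) + 8 * L) * (observed T J x + f + r)"
      using \<delta> by (simp add: field_simps)
    moreover have "modal_energy J x = e + f"
      unfolding e_def f_def by (rule modal_energy_split[OF J(1) F(2)])
    ultimately show "modal_energy J x \<le> K' * (observed T J x + sum_sq (J \<inter> F) x + (residual_mass J x)\<^sup>2)"
      using nonneg unfolding K'_def f_def[symmetric] r_def[symmetric] distrib_right by simp
  qed
qed

end

subsection \<open>Difference quotients and high frequencies\<close>

definition expm1_quotient :: "real \<Rightarrow> complex \<Rightarrow> complex" where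
  "expm1_quotient h z = (exp (z * of_real h) - 1) / of_real h"

lemma tendsto_expm1_quotient: "((\<lambda>h. expm1_quotient h z) \<longlongrightarrow> z) (at_right 0)"
proof -
  have "((\<lambda>w. exp (z * w)) has_field_derivative z) (at 0)"
    by (auto intro!: derivative_eq_intros)
  then have "((\<lambda>w. (exp (z * w) - 1) / w) \<longlongrightarrow> z) (at 0)"
    by (simp add: has_field_derivative_iff)
  moreover have "filterlim complex_of_real (at 0) (at_right 0)"
    unfolding filterlim_at
    by (intro conjI tendsto_eq_intros eventually_at_right_less[THEN eventually_mono]) auto
  ultimately show ?thesis
    unfolding expm1_quotient_def by (rule filterlim_compose)
qed

lemma norm_expm1_quotient_le:
  assumes h: "0 < h" "h \<le> 1" and z: "cmod z \<le> \<rho>"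
  shows "cmod (expm1_quotient h z) \<le> \<rho> * exp \<rho>"
proof -
  let ?w = "z * of_real h"
  have w: "cmod ?w \<le> \<rho> * h" using h z by (simp add: norm_mult)
  also have "\<dots> \<le> \<rho> * 1" using h order_trans[OF norm_ge_zero z] by (intro mult_left_mono) auto
  finally have "\<bar>Re ?w\<bar> \<le> \<rho>" using abs_Re_le_cmod[of ?w] by linarith
  have "cmod (exp ?w - 1) \<le> exp \<bar>Re ?w\<bar> * cmod ?w" using Taylor_exp[of ?w 0] by simp
  also have "\<dots> \<le> exp \<rho> * (\<rho> * h)" using w \<open>\<bar>Re ?w\<bar> \<le> \<rho>\<close> by (intro mult_mono) auto
  finally show ?thesis using h by (simp add: expm1_quotient_def norm_divide field_simps)
qed

lemma exp_sum_expm1_quotient: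
  assumes "h \<noteq> 0"
  shows "exp_sum J \<mu> (\<lambda>i. expm1_quotient h (\<mu> i) * x i) t
    = of_real (1 / h) * (exp_sum J \<mu> x (t + h) - exp_sum J \<mu> x t)"
  unfolding exp_sum_def sum_subtractf[symmetric] sum_distrib_left using assms
  by (intro sum.cong refl) (simp add: expm1_quotient_def field_simps exp_add)

lemma L2_sq_exp_sum_expm1_quotient_le:
  assumes "h > 0"
  shows "L2_sq T (exp_sum J \<mu> (\<lambda>i. expm1_quotient h (\<mu> i) * x i)) \<le> 4 / h\<^sup>2 * L2_sq (T + h) (exp_sum J \<mu> x)"
proof -
  let ?f = "exp_sum J \<mu> x"
  have shift [continuous_intros]: "continuous_on R (\<lambda>t. ?f (t + h))" for R
    unfolding exp_sum_shift by (intro continuous_intros)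
  have "L2_sq T (\<lambda>t. ?f (t + h) - ?f t) \<le> 2 * L2_sq T (\<lambda>t. ?f (t + h)) + 2 * L2_sq T ?f"
    by (intro L2_sq_diff_le square_integrable_continuous continuous_intros)
  also have "\<dots> \<le> 2 * L2_sq (T + h) ?f + 2 * L2_sq (T + h) ?f"
    using assms by (intro add_mono mult_left_mono L2_sq_shift_le L2_sq_interval_mono continuous_intros) auto
  finally have "(1 / h)\<^sup>2 * L2_sq T (\<lambda>t. ?f (t + h) - ?f t) \<le> (1 / h)\<^sup>2 * (4 * L2_sq (T + h) ?f)"
    by (intro mult_left_mono) auto
  moreover have "exp_sum J \<mu> (\<lambda>i. expm1_quotient h (\<mu> i) * x i) = (\<lambda>t. of_real (1 / h) * (?f (t + h) - ?f t))"
    using assms by (intro ext exp_sum_expm1_quotient) simp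
  ultimately show ?thesis by (simp only: L2_sq_scale norm_of_real power2_abs) (simp add: power_divide)
qed

lemma geometric_growth_eq_0:
  fixes y u v Z :: real
  assumes growth: "\<And>j. y * u ^ j \<le> Z * v ^ j" and "0 < v" "v < u" "y \<ge> 0"
  shows "y = 0"
proof (rule ccontr)
  assume "y \<noteq> 0"
  then have "y > 0" using \<open>y \<ge> 0\<close> by simp
  have "1 < u / v" using \<open>0 < v\<close> \<open>v < u\<close> by simp
  then obtain j where "Z / y < (u / v) ^ j" using real_arch_pow by blast
  then have "Z * v ^ j < y * u ^ j"
    using \<open>y > 0\<close> \<open>0 < v\<close> by (simp add: field_simps)
  then show False using growth[of j] by simp
qed

context mode_system
begin

lemma observed_cong: "(\<And>i. i \<in> J \<Longrightarrow> x i = y i) \<Longrightarrow> observed T J x = observed T J y"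
  unfolding observed_def by (intro arg_cong2[of _ _ _ _ "(+)"] arg_cong[of _ _ "L2_sq T"] exp_sum_cong) auto

lemma observed_mono_neutral:
  assumes "finite K" "J \<subseteq> K" "\<And>i. i \<in> K - J \<Longrightarrow> x i = 0"
  shows "observed T K x = observed T J x"
  using exp_sum_mono_neutral[OF assms(1,2), of "\<lambda>i. p i * x i"]
    exp_sum_mono_neutral[OF assms(1,2), of "\<lambda>i. q i * x i"] assms(3)
  by (simp add: observed_def)

lemma observed_interval_mono: "T' \<le> T \<Longrightarrow> observed T' J x \<le> observed T J x"
  unfolding observed_def by (intro add_mono L2_sq_interval_mono continuous_intros)

lemma sum_sq_le_modal_energy:
  assumes "finite J" "\<And>i. i \<notin> J \<Longrightarrow> x i = 0" and G: "finite G" "G \<subseteq> A \<union> B"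
  shows "sum_sq G x \<le> modal_energy J x"
proof -
  have "sum_sq G x = sum_sq (G \<inter> J) x"
    unfolding sum_sq_def using assms by (intro sum.mono_neutral_right) auto
  also have "\<dots> \<le> modal_energy J x"
    unfolding modal_energy_def using assms(1) G(2) by (intro sum_sq_mono) auto
  finally show ?thesis .
qed

lemma observed_scale: "observed T J (\<lambda>i. c * x i) = (cmod c)\<^sup>2 * observed T J x"
proof -
  have "exp_sum J \<mu> (\<lambda>i. v i * (c * x i)) = (\<lambda>t. c * exp_sum J \<mu> (\<lambda>i. v i * x i) t)" for v
    by (simp add: exp_sum_scale[symmetric] mult.left_commute fun_eq_iff)
  then show ?thesis by (simp add: observed_def L2_sq_scale distrib_left)
qed

lemma observed_diff_le: "observed T J (\<lambda>i. x i - y i) \<le> 2 * observed T J x + 2 * observed T J y"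
proof -
  have "L2_sq T (exp_sum J \<mu> (\<lambda>i. v i * (x i - y i)))
      \<le> 2 * L2_sq T (exp_sum J \<mu> (\<lambda>i. v i * x i)) + 2 * L2_sq T (exp_sum J \<mu> (\<lambda>i. v i * y i))" for v
    unfolding right_diff_distrib exp_sum_diff
    by (intro L2_sq_diff_le square_integrable_continuous continuous_intros)
  from add_mono[OF this[of p] this[of q]] show ?thesis by (simp add: observed_def)
qed

lemma observed_expm1_quotient_le:
  assumes "h > 0"
  shows "observed T J (\<lambda>i. expm1_quotient h (\<mu> i) * x i) \<le> 4 / h\<^sup>2 * observed (T + h) J x"
proof -
  have "L2_sq T (exp_sum J \<mu> (\<lambda>i. w i * (expm1_quotient h (\<mu> i) * x i)))
      \<le> 4 / h\<^sup>2 * L2_sq (T + h) (exp_sum J \<mu> (\<lambda>i. w i * x i))" for w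
    using L2_sq_exp_sum_expm1_quotient_le[OF assms, of T J \<mu> "\<lambda>i. w i * x i"] by (simp add: mult.left_commute)
  then show ?thesis unfolding observed_def distrib_left by (intro add_mono)
qed

lemma observed_expm1_quotient_power_le:
  assumes h: "h > 0"
  shows "observed T J (\<lambda>i. expm1_quotient h (\<mu> i) ^ j * x i) \<le> (4 / h\<^sup>2) ^ j * observed (T + real j * h) J x"
proof (induction j arbitrary: T)
  case (Suc j)
  have "observed T J (\<lambda>i. expm1_quotient h (\<mu> i) ^ Suc j * x i)
      \<le> 4 / h\<^sup>2 * observed (T + h) J (\<lambda>i. expm1_quotient h (\<mu> i) ^ j * x i)"
    using observed_expm1_quotient_le[OF h, of T J "\<lambda>i. expm1_quotient h (\<mu> i) ^ j * x i"]
    by (simp add: mult.assoc)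
  also have "\<dots> \<le> 4 / h\<^sup>2 * ((4 / h\<^sup>2) ^ j * observed (T + h + real j * h) J x)"
    using Suc.IH by (intro mult_left_mono) auto
  also have "T + h + real j * h = T + real (Suc j) * h" by (simp add: algebra_simps)
  finally show ?case by simp
qed simp

lemma residual_mass_expm1_quotient_power_le:
  assumes "0 < h" "h \<le> 1"
  shows "residual_mass J (\<lambda>i. expm1_quotient h (\<mu> i) ^ j * x i) \<le> (\<rho> * exp \<rho>) ^ j * residual_mass J x"
  unfolding residual_mass_def sum_distrib_left norm_mult norm_power
  using norm_expm1_quotient_le[OF assms residual_le] by (intro sum_mono mult_right_mono power_mono) auto

end

locale vanishing_observation = mode_system +
  fixes T W :: real and J :: "nat \<Rightarrow> 'a set" and x :: "nat \<Rightarrow> 'a \<Rightarrow> complex" and a :: "'a \<Rightarrow> complex"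
  assumes T: "T > 2 * pi / \<gamma>"
    and finite_J: "finite (J k)" and J_subset: "J k \<subseteq> A \<union> B \<union> S"
    and support: "i \<notin> J k \<Longrightarrow> x k i = 0"
    and x_tendsto: "(\<lambda>k. x k i) \<longlonglongrightarrow> a i"
    and observed_tendsto: "(\<lambda>k. observed T (J k) (x k)) \<longlonglongrightarrow> 0"
    and residual_mass_le: "residual_mass (J k) (x k) \<le> W"
begin

lemma expm1_quotient_power_le:
  assumes h: "0 < h" "h \<le> 1" "T' + real j * h \<le> T"
    and F: "finite F" "F \<subseteq> A \<union> B" and K: "K > 0"
    and lower: "\<And>J x. finite J \<Longrightarrow> J \<subseteq> A \<union> B \<union> S
      \<Longrightarrow> modal_energy J x \<le> K * (observed T' J x + sum_sq (J \<inter> F) x + (residual_mass J x)\<^sup>2)"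
    and i: "i \<in> A \<union> B"
  defines "y \<equiv> \<lambda>k i. expm1_quotient h (\<mu> i) ^ j * x k i"
  shows "(cmod (y k i))\<^sup>2
    \<le> K * ((4 / h\<^sup>2) ^ j * observed T (J k) (x k) + sum_sq F (y k) + ((\<rho> * exp \<rho>) ^ j * W)\<^sup>2)"
proof -
  have "sum_sq {i} (y k) \<le> modal_energy (J k) (y k)"
    using i finite_J by (intro sum_sq_le_modal_energy) (auto simp: y_def support)
  then have "(cmod (y k i))\<^sup>2 \<le> modal_energy (J k) (y k)" by (simp add: sum_sq_def)
  also have "\<dots> \<le> K * (observed T' (J k) (y k) + sum_sq (J k \<inter> F) (y k) + (residual_mass (J k) (y k))\<^sup>2)"
    using finite_J J_subset by (rule lower)
  also have "\<dots> \<le> K * ((4 / h\<^sup>2) ^ j * observed T (J k) (x k) + sum_sq F (y k) + ((\<rho> * exp \<rho>) ^ j * W)\<^sup>2)"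
  proof (intro mult_left_mono add_mono)
    have "observed T' (J k) (y k) \<le> (4 / h\<^sup>2) ^ j * observed (T' + real j * h) (J k) (x k)"
      unfolding y_def by (rule observed_expm1_quotient_power_le[OF h(1)])
    also have "\<dots> \<le> (4 / h\<^sup>2) ^ j * observed T (J k) (x k)"
      using h(3) by (intro mult_left_mono observed_interval_mono) auto
    finally show "observed T' (J k) (y k) \<le> (4 / h\<^sup>2) ^ j * observed T (J k) (x k)" .
    show "sum_sq (J k \<inter> F) (y k) \<le> sum_sq F (y k)" using F by (intro sum_sq_mono) auto
    have "residual_mass (J k) (y k) \<le> (\<rho> * exp \<rho>) ^ j * residual_mass (J k) (x k)"
      unfolding y_def by (rule residual_mass_expm1_quotient_power_le[OF h(1,2)])
    also have "\<dots> \<le> (\<rho> * exp \<rho>) ^ j * W"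
      using \<rho>_nonneg by (intro mult_left_mono residual_mass_le) auto
    finally show "(residual_mass (J k) (y k))\<^sup>2 \<le> ((\<rho> * exp \<rho>) ^ j * W)\<^sup>2"
      by (intro power_mono residual_mass_nonneg)
  qed (use K in auto)
  finally show ?thesis .
qed

lemma expm1_quotient_power_limit_le:
  assumes h: "0 < h" "h \<le> 1" "T' + real j * h \<le> T"
    and F: "finite F" "F \<subseteq> A \<union> B" and K: "K > 0"
    and lower: "\<And>J x. finite J \<Longrightarrow> J \<subseteq> A \<union> B \<union> S
      \<Longrightarrow> modal_energy J x \<le> K * (observed T' J x + sum_sq (J \<inter> F) x + (residual_mass J x)\<^sup>2)"
    and i: "i \<in> A \<union> B"
  defines "m \<equiv> \<lambda>i. expm1_quotient h (\<mu> i) ^ j"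
  shows "(cmod (m i * a i))\<^sup>2 \<le> K * (sum_sq F (\<lambda>i. m i * a i) + ((\<rho> * exp \<rho>) ^ j * W)\<^sup>2)"
proof (rule LIMSEQ_le)
  let ?R = "((\<rho> * exp \<rho>) ^ j * W)\<^sup>2"
  let ?bound = "\<lambda>k. K * ((4 / h\<^sup>2) ^ j * observed T (J k) (x k) + sum_sq F (\<lambda>i. m i * x k i) + ?R)"
  show "(\<lambda>k. (cmod (m i * x k i))\<^sup>2) \<longlonglongrightarrow> (cmod (m i * a i))\<^sup>2" by (intro tendsto_intros x_tendsto)
  have "?bound \<longlonglongrightarrow> K * ((4 / h\<^sup>2) ^ j * 0 + sum_sq F (\<lambda>i. m i * a i) + ?R)"
    unfolding sum_sq_def by (intro tendsto_intros observed_tendsto x_tendsto)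
  then show "?bound \<longlonglongrightarrow> K * (sum_sq F (\<lambda>i. m i * a i) + ?R)" by simp
  have "(cmod (m i * x k i))\<^sup>2 \<le> ?bound k" for k
    unfolding m_def by (rule expm1_quotient_power_le[OF h F K lower i])
  then show "\<exists>N. \<forall>k\<ge>N. (cmod (m i * x k i))\<^sup>2 \<le> ?bound k" by blast
qed

lemma exponent_power_limit_le:
  obtains F K where "finite F" "F \<subseteq> A \<union> B" "K > 0"
    "\<And>i j. i \<in> A \<union> B \<Longrightarrow>
      (cmod (\<mu> i ^ j * a i))\<^sup>2 \<le> K * (sum_sq F (\<lambda>i. \<mu> i ^ j * a i) + ((\<rho> * exp \<rho>) ^ j * W)\<^sup>2)"
proof -
  obtain T' where T': "2 * pi / \<gamma> < T'" "T' < T" using T dense by blast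
  obtain F K where F: "finite F" "F \<subseteq> A \<union> B" and K: "K > 0"
    and lower: "\<And>J x. finite J \<Longrightarrow> J \<subseteq> A \<union> B \<union> S
      \<Longrightarrow> modal_energy J x \<le> K * (observed T' J x + sum_sq (J \<inter> F) x + (residual_mass J x)\<^sup>2)"
    using observed_lower_mod_finite[OF T'(1)] by blast
  show thesis
  proof (rule that[OF F K])
    fix i j assume i: "i \<in> A \<union> B"
    show "(cmod (\<mu> i ^ j * a i))\<^sup>2 \<le> K * (sum_sq F (\<lambda>i. \<mu> i ^ j * a i) + ((\<rho> * exp \<rho>) ^ j * W)\<^sup>2)"
    proof (rule tendsto_le[where F = "at_right (0::real)"])
      let ?m = "\<lambda>h i. expm1_quotient h (\<mu> i) ^ j"
      show "((\<lambda>h. K * (sum_sq F (\<lambda>i. ?m h i * a i) + ((\<rho> * exp \<rho>) ^ j * W)\<^sup>2)) \<longlongrightarrow>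
          K * (sum_sq F (\<lambda>i. \<mu> i ^ j * a i) + ((\<rho> * exp \<rho>) ^ j * W)\<^sup>2)) (at_right 0)"
        unfolding sum_sq_def by (intro tendsto_intros tendsto_expm1_quotient)
      show "((\<lambda>h. (cmod (?m h i * a i))\<^sup>2) \<longlongrightarrow> (cmod (\<mu> i ^ j * a i))\<^sup>2) (at_right 0)"
        by (intro tendsto_intros tendsto_expm1_quotient)
      have "((\<lambda>h. T' + real j * h) \<longlongrightarrow> T' + real j * 0) (at_right 0)" by (intro tendsto_intros)
      then have "\<forall>\<^sub>F h in at_right 0. T' + real j * h < T" using T'(2) by (intro order_tendstoD) auto
      moreover have "\<forall>\<^sub>F h in at_right 0. h < (1::real)"
        by (rule order_tendstoD(2)[OF tendsto_ident_at]) simp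
      ultimately show "\<forall>\<^sub>F h in at_right 0. (cmod (?m h i * a i))\<^sup>2
          \<le> K * (sum_sq F (\<lambda>i. ?m h i * a i) + ((\<rho> * exp \<rho>) ^ j * W)\<^sup>2)"
        using eventually_at_right_less
      proof eventually_elim
        case (elim h)
        then show ?case by (intro expm1_quotient_power_limit_le[OF _ _ _ F K lower i]) auto
      qed
    qed simp
  qed
qed

text \<open>Multiplying by \<open>\<mu>\<^sub>i\<^sup>j\<close> amplifies a high mode faster than the finitely many modes in \<open>F\<close> and the
  residual modes can compensate, so a high mode cannot survive in the limit.\<close>

lemma limit_bounded_frequency:
  obtains \<Lambda> where "\<And>i. i \<in> A \<union> B \<Longrightarrow> \<Lambda> < cmod (\<mu> i) \<Longrightarrow> a i = 0"
proof -
  obtain F K where F: "finite F" "F \<subseteq> A \<union> B" and K: "K > 0"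
    and power_le: "\<And>i j. i \<in> A \<union> B \<Longrightarrow>
      (cmod (\<mu> i ^ j * a i))\<^sup>2 \<le> K * (sum_sq F (\<lambda>i. \<mu> i ^ j * a i) + ((\<rho> * exp \<rho>) ^ j * W)\<^sup>2)"
    by (rule exponent_power_limit_le) blast
  define \<Lambda> where "\<Lambda> = 1 + \<rho> * exp \<rho> + (\<Sum>i\<in>F. cmod (\<mu> i))"
  have \<Lambda>: "1 \<le> \<Lambda>" "\<rho> * exp \<rho> \<le> \<Lambda>" "\<And>i. i \<in> F \<Longrightarrow> cmod (\<mu> i) \<le> \<Lambda>"
  proof -
    show "1 \<le> \<Lambda>" "\<rho> * exp \<rho> \<le> \<Lambda>" using \<rho>_nonneg by (auto simp: \<Lambda>_def sum_nonneg)
    fix i assume "i \<in> F"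
    then have "cmod (\<mu> i) \<le> (\<Sum>i\<in>F. cmod (\<mu> i))" using F(1) by (intro member_le_sum) auto
    then show "cmod (\<mu> i) \<le> \<Lambda>" using \<rho>_nonneg by (simp add: \<Lambda>_def add_increasing)
  qed
  have growth: "(cmod (a i))\<^sup>2 * ((cmod (\<mu> i))\<^sup>2) ^ j \<le> K * (sum_sq F a + W\<^sup>2) * (\<Lambda>\<^sup>2) ^ j"
    if i: "i \<in> A \<union> B" for i j
  proof -
    have "(cmod (\<mu> i ^ j * a i))\<^sup>2 \<le> K * (sum_sq F (\<lambda>i. \<mu> i ^ j * a i) + ((\<rho> * exp \<rho>) ^ j * W)\<^sup>2)"
      by (rule power_le[OF i])
    also have "\<dots> \<le> K * ((\<Lambda> ^ j)\<^sup>2 * sum_sq F a + (\<Lambda> ^ j)\<^sup>2 * W\<^sup>2)"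
    proof (intro mult_left_mono add_mono)
      show "sum_sq F (\<lambda>i. \<mu> i ^ j * a i) \<le> (\<Lambda> ^ j)\<^sup>2 * sum_sq F a"
        using \<Lambda>(3) by (intro sum_sq_mult_le) (simp add: norm_power power_mono)
      show "((\<rho> * exp \<rho>) ^ j * W)\<^sup>2 \<le> (\<Lambda> ^ j)\<^sup>2 * W\<^sup>2"
        unfolding power_mult_distrib[of _ W] using \<Lambda>(2) \<rho>_nonneg by (intro mult_right_mono power_mono) auto
    qed (use K in simp)
    finally show ?thesis
      by (simp add: norm_mult norm_power power_mult_distrib power_commutes distrib_left mult_ac
          flip: power_mult)
  qed
  show thesis
  proof
    fix i assume i: "i \<in> A \<union> B" and large: "\<Lambda> < cmod (\<mu> i)"
    have "(cmod (a i))\<^sup>2 = 0"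
      by (rule geometric_growth_eq_0[OF growth[OF i]]) (use \<Lambda>(1) large in \<open>auto intro: power_strict_mono\<close>)
    then show "a i = 0" by simp
  qed
qed

end

subsection \<open>Compactness and uniqueness\<close>

lemma summable_on_small_tail:
  fixes f :: "'i \<Rightarrow> real"
  assumes f: "f summable_on S" "\<And>i. i \<in> S \<Longrightarrow> f i \<ge> 0" and "\<epsilon> > 0"
  obtains F where "finite F" "F \<subseteq> S" "\<And>G. finite G \<Longrightarrow> G \<subseteq> S - F \<Longrightarrow> sum f G \<le> \<epsilon>"
proof -
  obtain F where F: "finite F" "F \<subseteq> S" "dist (sum f F) (infsum f S) \<le> \<epsilon>"
    using infsum_finite_approximation[OF f(1) \<open>\<epsilon> > 0\<close>] by blast
  have "sum f G \<le> \<epsilon>" if G: "finite G" "G \<subseteq> S - F" for G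
  proof -
    have "sum f F + sum f G = sum f (F \<union> G)"
      using F(1) G by (intro sum.union_disjoint[symmetric]) auto
    also have "\<dots> \<le> infsum f S"
      using f F G by (intro finite_sum_le_infsum) auto
    finally show ?thesis using F(3) by (simp add: dist_real_def abs_le_iff)
  qed
  with F(1,2) show thesis by (rule that)
qed

lemma finite_disjoint_family_meets:
  assumes "disjoint_family_on D S" "finite P"
  shows "finite {s \<in> S. D s \<inter> P \<noteq> {}}"
proof -
  have "finite {s \<in> S. i \<in> D s}" for i
  proof (rule finite_subset)
    show "{s \<in> S. i \<in> D s} \<subseteq> {THE s. s \<in> S \<and> i \<in> D s}"
      using assms(1) by (auto simp: disjoint_family_on_def intro!: the_equality[symmetric])
  qed simp
  then have "finite (\<Union>i\<in>P. {s \<in> S. i \<in> D s})" using assms(2) by blast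
  then show ?thesis by (rule finite_subset[rotated]) auto
qed

locale dominated_mode_system = mode_system +
  fixes D :: "'a \<Rightarrow> 'a set" and w :: "'a \<Rightarrow> real"
  assumes D: "\<And>s. s \<in> S \<Longrightarrow> finite (D s)" "\<And>s. s \<in> S \<Longrightarrow> D s \<subseteq> A \<union> B" "disjoint_family_on D S"
    and w_nonneg: "\<And>s. w s \<ge> 0" and w_summable: "(\<lambda>s. (w s)\<^sup>2) summable_on S"
    and inj: "inj_on \<mu> (A \<union> B \<union> S)" and countable_modes: "countable (A \<union> B \<union> S)"
begin

definition dominated :: "('a \<Rightarrow> complex) \<Rightarrow> bool" where
  "dominated x \<longleftrightarrow> (\<forall>s\<in>S. cmod (x s) \<le> w s * sqrt (sum_sq (D s) x))"

lemma dominated_sum_le: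
  assumes "dominated x" and G: "finite G" "G \<subseteq> S"
  shows "(\<Sum>s\<in>G. cmod (x s))\<^sup>2 \<le> (\<Sum>s\<in>G. (w s)\<^sup>2) * sum_sq (\<Union>s\<in>G. D s) x"
proof -
  have "(\<Sum>s\<in>G. cmod (x s))\<^sup>2 \<le> (\<Sum>s\<in>G. w s * sqrt (sum_sq (D s) x))\<^sup>2"
    using assms by (intro power_mono sum_mono sum_nonneg) (auto simp: dominated_def)
  also have "\<dots> \<le> (\<Sum>s\<in>G. (w s)\<^sup>2) * (\<Sum>s\<in>G. (sqrt (sum_sq (D s) x))\<^sup>2)"
    by (rule Cauchy_Schwarz_ineq_sum)
  also have "(\<Sum>s\<in>G. (sqrt (sum_sq (D s) x))\<^sup>2) = (\<Sum>s\<in>G. sum_sq (D s) x)"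
    by (simp add: sum_sq_nonneg)
  also have "\<dots> = sum_sq (\<Union>s\<in>G. D s) x"
    unfolding sum_sq_def using G D
    by (intro sum.UNION_disjoint[symmetric]) (auto simp: disjoint_family_on_def subset_eq)
  finally show ?thesis .
qed

lemma residual_mass_power2_le:
  assumes "dominated x" "finite J" and closed: "\<And>s. s \<in> J \<inter> S \<Longrightarrow> D s \<subseteq> J"
  shows "(residual_mass J x)\<^sup>2 \<le> infsum (\<lambda>s. (w s)\<^sup>2) S * modal_energy J x"
proof -
  have "(residual_mass J x)\<^sup>2 \<le> (\<Sum>s\<in>J \<inter> S. (w s)\<^sup>2) * sum_sq (\<Union>s\<in>J \<inter> S. D s) x"
    unfolding residual_mass_def using assms by (intro dominated_sum_le) auto
  also have "\<dots> \<le> infsum (\<lambda>s. (w s)\<^sup>2) S * modal_energy J x"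
    unfolding modal_energy_def using assms(2) w_summable D(2) closed
    by (intro mult_mono finite_sum_le_infsum sum_sq_mono sum_sq_nonneg infsum_nonneg) auto
  finally show ?thesis .
qed

lemma finite_mode_support:
  assumes "dominated x" and fin: "finite {i \<in> A \<union> B. x i \<noteq> 0}"
  shows "finite {i \<in> A \<union> B \<union> S. x i \<noteq> 0}"
proof -
  let ?P = "{i \<in> A \<union> B. x i \<noteq> 0}"
  have "D s \<inter> ?P \<noteq> {}" if s: "s \<in> S" "x s \<noteq> 0" for s
  proof
    assume "D s \<inter> ?P = {}"
    then have "sum_sq (D s) x = 0" unfolding sum_sq_def using D(2)[OF s(1)] by (intro sum.neutral) auto
    then have "cmod (x s) \<le> 0" using assms(1) s(1) by (auto simp: dominated_def)
    then show False using s(2) by simp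
  qed
  then have "{i \<in> A \<union> B \<union> S. x i \<noteq> 0} \<subseteq> ?P \<union> {s \<in> S. D s \<inter> ?P \<noteq> {}}" by blast
  moreover have "finite (?P \<union> {s \<in> S. D s \<inter> ?P \<noteq> {}})"
    using fin finite_disjoint_family_meets[OF D(3) fin] by simp
  ultimately show ?thesis by (rule finite_subset)
qed

lemma unique_continuation:
  assumes J: "finite J" "J \<subseteq> A \<union> B \<union> S" and T: "T > 0" and obs: "observed T J x = 0" and i: "i \<in> J"
  shows "x i = 0"
proof -
  have "L2_sq T (exp_sum J \<mu> (\<lambda>i. p i * x i)) = 0" "L2_sq T (exp_sum J \<mu> (\<lambda>i. q i * x i)) = 0"
    using obs by (simp_all add: observed_def L2_sq_nonneg add_nonneg_eq_0_iff)
  then have "exp_sum J \<mu> (\<lambda>i. p i * x i) t = 0" "exp_sum J \<mu> (\<lambda>i. q i * x i) t = 0" if "t \<in> {0<..<T}" for t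
    using that L2_sq_eq_0D[OF _ continuous_on_exp_sum T, of J \<mu> _ t] by simp_all
  then have "p i * x i = 0" "q i * x i = 0"
    using exp_sum_eq_0D[OF J(1) inj_on_subset[OF inj J(2)] T _ i, of "\<lambda>i. p i * x i"]
      exp_sum_eq_0D[OF J(1) inj_on_subset[OF inj J(2)] T _ i, of "\<lambda>i. q i * x i"] by blast+
  then show ?thesis using i J(2) p_eq_1[of i] q_eq_1[of i] by auto
qed

end

locale dominated_vanishing_observation = vanishing_observation + dominated_mode_system +
  assumes dominated: "dominated (x k)" and modal_energy_le: "modal_energy (J k) (x k) \<le> 1"
begin

lemma sum_sq_le_1:
  assumes "finite G" "G \<subseteq> A \<union> B"
  shows "sum_sq G (x k) \<le> 1"
  using sum_sq_le_modal_energy[OF finite_J support assms] modal_energy_le by (rule order_trans)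

lemma sum_sq_limit_le_1:
  assumes "finite G" "G \<subseteq> A \<union> B"
  shows "sum_sq G a \<le> 1"
proof (rule LIMSEQ_le_const2)
  show "(\<lambda>k. sum_sq G (x k)) \<longlonglongrightarrow> sum_sq G a"
    unfolding sum_sq_def by (intro tendsto_intros x_tendsto)
qed (use sum_sq_le_1[OF assms] in blast)

lemma dominated_limit: "dominated a"
  unfolding dominated_def
proof
  fix s assume "s \<in> S"
  show "cmod (a s) \<le> w s * sqrt (sum_sq (D s) a)"
  proof (rule LIMSEQ_le)
    show "(\<lambda>k. cmod (x k s)) \<longlonglongrightarrow> cmod (a s)" by (intro tendsto_intros x_tendsto)
    show "(\<lambda>k. w s * sqrt (sum_sq (D s) (x k))) \<longlonglongrightarrow> w s * sqrt (sum_sq (D s) a)"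
      unfolding sum_sq_def by (intro tendsto_intros x_tendsto)
  qed (use dominated \<open>s \<in> S\<close> in \<open>auto simp: dominated_def\<close>)
qed

lemma limit_eq_0_outside:
  assumes "i \<notin> A \<union> B \<union> S"
  shows "a i = 0"
proof -
  have "x k i = 0" for k using assms support J_subset by blast
  then show "a i = 0" using x_tendsto[of i] by (simp add: LIMSEQ_const_iff)
qed

lemma finite_limit_support: "finite {i. a i \<noteq> 0}"
proof -
  obtain \<Lambda> where \<Lambda>: "\<And>i. i \<in> A \<union> B \<Longrightarrow> \<Lambda> < cmod (\<mu> i) \<Longrightarrow> a i = 0"
    using limit_bounded_frequency by blast
  have "finite ({i \<in> A. cmod (\<mu> i) \<le> \<Lambda>} \<union> {i \<in> B. cmod (\<mu> i) \<le> \<Lambda>})"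
    using gap \<gamma>_pos by (simp add: asymptotic_gap_finite_bounded)
  then have "finite {i \<in> A \<union> B. a i \<noteq> 0}"
    by (rule finite_subset[rotated]) (use \<Lambda> in force)
  then have "finite {i \<in> A \<union> B \<union> S. a i \<noteq> 0}"
    by (rule finite_mode_support[OF dominated_limit])
  then show ?thesis
    by (rule finite_subset[rotated]) (use limit_eq_0_outside in blast)
qed

lemma residual_convergence:
  assumes "\<epsilon> > 0"
  shows "\<forall>\<^sub>F k in sequentially. \<forall>G. finite G \<longrightarrow> G \<subseteq> S \<longrightarrow> (\<Sum>s\<in>G. cmod (x k s - a s)) \<le> \<epsilon>"
proof -
  obtain F where F: "finite F" "F \<subseteq> S"
    and tail: "\<And>G. finite G \<Longrightarrow> G \<subseteq> S - F \<Longrightarrow> (\<Sum>s\<in>G. (w s)\<^sup>2) \<le> (\<epsilon> / 4)\<^sup>2"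
    using summable_on_small_tail[OF w_summable, of "(\<epsilon> / 4)\<^sup>2"] assms by auto
  have small: "(\<Sum>s\<in>G. cmod (y s)) \<le> \<epsilon> / 4"
    if "dominated y" and energy: "\<And>G. finite G \<Longrightarrow> G \<subseteq> A \<union> B \<Longrightarrow> sum_sq G y \<le> 1"
      and G: "finite G" "G \<subseteq> S - F" for y G
  proof -
    have "(\<Sum>s\<in>G. cmod (y s))\<^sup>2 \<le> (\<Sum>s\<in>G. (w s)\<^sup>2) * sum_sq (\<Union>s\<in>G. D s) y"
      using G by (intro dominated_sum_le \<open>dominated y\<close>) auto
    also have "\<dots> \<le> (\<epsilon> / 4)\<^sup>2 * 1"
      using G D(1,2) by (intro mult_mono tail energy sum_sq_nonneg) auto
    finally have "(\<Sum>s\<in>G. cmod (y s))\<^sup>2 \<le> (\<epsilon> / 4)\<^sup>2" by simp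
    then show ?thesis by (rule power2_le_imp_le) (use assms in simp)
  qed
  have "(\<lambda>k. \<Sum>s\<in>F. cmod (x k s - a s)) \<longlonglongrightarrow> (\<Sum>s\<in>F. cmod (a s - a s))"
    by (intro tendsto_intros x_tendsto)
  then have "\<forall>\<^sub>F k in sequentially. (\<Sum>s\<in>F. cmod (x k s - a s)) < \<epsilon> / 2"
    using assms by (intro order_tendstoD) auto
  then show ?thesis
  proof eventually_elim
    case (elim k)
    show ?case
    proof (intro allI impI)
      fix G assume G: "finite G" "G \<subseteq> S"
      have "(\<Sum>s\<in>G. cmod (x k s - a s)) \<le> (\<Sum>s\<in>F \<union> (G - F). cmod (x k s - a s))"
        using F G by (intro sum_mono2) auto
      also have "\<dots> = (\<Sum>s\<in>F. cmod (x k s - a s)) + (\<Sum>s\<in>G - F. cmod (x k s - a s))"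
        using F G by (intro sum.union_disjoint) auto
      also have "(\<Sum>s\<in>G - F. cmod (x k s - a s)) \<le> (\<Sum>s\<in>G - F. cmod (x k s)) + (\<Sum>s\<in>G - F. cmod (a s))"
        unfolding sum.distrib[symmetric] by (intro sum_mono norm_triangle_ineq4)
      also have "(\<Sum>s\<in>G - F. cmod (x k s)) + (\<Sum>s\<in>G - F. cmod (a s)) \<le> \<epsilon> / 4 + \<epsilon> / 4"
        using G by (intro add_mono small dominated dominated_limit sum_sq_le_1 sum_sq_limit_le_1) auto
      finally show "(\<Sum>s\<in>G. cmod (x k s - a s)) \<le> \<epsilon>" using elim by simp
    qed
  qed
qed

definition near_limit :: "'a set \<Rightarrow> real \<Rightarrow> nat \<Rightarrow> bool" where
  "near_limit F \<eta> k \<longleftrightarrow> observed T (J k) (x k) \<le> \<eta> \<and> sum_sq F (\<lambda>i. x k i - a i) \<le> \<eta>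
    \<and> (\<forall>G. finite G \<longrightarrow> G \<subseteq> S \<longrightarrow> (\<Sum>s\<in>G. cmod (x k s - a s)) \<le> sqrt \<eta>)"

lemma eventually_near_limit:
  assumes "\<eta> > 0"
  shows "\<forall>\<^sub>F k in sequentially. near_limit F \<eta> k"
proof -
  have "(\<lambda>k. sum_sq F (\<lambda>i. x k i - a i)) \<longlonglongrightarrow> sum_sq F (\<lambda>i. a i - a i)"
    unfolding sum_sq_def by (intro tendsto_intros x_tendsto)
  then have "\<forall>\<^sub>F k in sequentially. sum_sq F (\<lambda>i. x k i - a i) < \<eta>"
    using assms by (intro order_tendstoD) (auto simp: sum_sq_def)
  moreover have "\<forall>\<^sub>F k in sequentially. observed T (J k) (x k) < \<eta>"
    using observed_tendsto assms by (rule order_tendstoD)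
  moreover have "\<forall>\<^sub>F k in sequentially. \<forall>G. finite G \<longrightarrow> G \<subseteq> S \<longrightarrow> (\<Sum>s\<in>G. cmod (x k s - a s)) \<le> sqrt \<eta>"
    using assms by (intro residual_convergence) simp
  ultimately show ?thesis
    by eventually_elim (simp add: near_limit_def)
qed

lemma sum_sq_near_limit_diff_le:
  assumes F: "finite F" and K: "K > 0"
    and lower: "\<And>J x. finite J \<Longrightarrow> J \<subseteq> A \<union> B \<union> S
      \<Longrightarrow> modal_energy J x \<le> K * (observed T J x + sum_sq (J \<inter> F) x + (residual_mass J x)\<^sup>2)"
    and k: "near_limit F \<eta> k" and l: "near_limit F \<eta> l" and \<eta>: "\<eta> \<ge> 0"
    and G: "finite G" "G \<subseteq> A \<union> B"
  shows "sum_sq G (\<lambda>i. x k i - x l i) \<le> 12 * K * \<eta>"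
proof -
  let ?J = "J k \<union> J l \<union> G" and ?y = "\<lambda>i. x k i - x l i"
  have J: "finite ?J" "?J \<subseteq> A \<union> B \<union> S" using finite_J J_subset G by blast+
  have "sum_sq G ?y \<le> modal_energy ?J ?y"
    unfolding modal_energy_def using J(1) G(2) by (intro sum_sq_mono) auto
  also have "\<dots> \<le> K * (observed T ?J ?y + sum_sq (?J \<inter> F) ?y + (residual_mass ?J ?y)\<^sup>2)"
    by (rule lower[OF J])
  also have "\<dots> \<le> K * (4 * \<eta> + 4 * \<eta> + 4 * \<eta>)"
  proof (intro mult_left_mono add_mono)
    have "observed T ?J (x k) = observed T (J k) (x k)" "observed T ?J (x l) = observed T (J l) (x l)"
      using J(1) by (auto intro!: observed_mono_neutral support)
    then show "observed T ?J ?y \<le> 4 * \<eta>"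
      using observed_diff_le[of T ?J "x k" "x l"] k l by (simp add: near_limit_def)
    have "sum_sq (?J \<inter> F) ?y \<le> sum_sq F (\<lambda>i. (x k i - a i) - (x l i - a i))"
      using sum_sq_mono[OF F, of "?J \<inter> F" ?y] by simp
    also have "\<dots> \<le> 2 * sum_sq F (\<lambda>i. x k i - a i) + 2 * sum_sq F (\<lambda>i. x l i - a i)"
      by (rule sum_sq_diff_le)
    finally show "sum_sq (?J \<inter> F) ?y \<le> 4 * \<eta>" using k l by (simp add: near_limit_def)
    have "cmod (?y s) \<le> cmod (x k s - a s) + cmod (x l s - a s)" for s
      using norm_triangle_ineq4[of "x k s - a s" "x l s - a s"] by simp
    then have "residual_mass ?J ?y \<le> (\<Sum>s\<in>?J \<inter> S. cmod (x k s - a s)) + (\<Sum>s\<in>?J \<inter> S. cmod (x l s - a s))"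
      unfolding residual_mass_def sum.distrib[symmetric] by (intro sum_mono)
    also have "\<dots> \<le> sqrt \<eta> + sqrt \<eta>"
      using k l J(1) by (intro add_mono) (simp_all add: near_limit_def)
    finally have "(residual_mass ?J ?y)\<^sup>2 \<le> (2 * sqrt \<eta>)\<^sup>2"
      by (intro power_mono residual_mass_nonneg) simp
    then show "(residual_mass ?J ?y)\<^sup>2 \<le> 4 * \<eta>" using \<eta> by (simp add: power_mult_distrib)
  qed (use K in simp)
  finally show ?thesis by simp
qed

lemma modal_convergence:
  assumes "\<epsilon> > 0"
  shows "\<forall>\<^sub>F k in sequentially. \<forall>G. finite G \<longrightarrow> G \<subseteq> A \<union> B \<longrightarrow> sum_sq G (\<lambda>i. x k i - a i) \<le> \<epsilon>"
proof -
  obtain F K where F: "finite F" and K: "K > 0"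
    and lower: "\<And>J x. finite J \<Longrightarrow> J \<subseteq> A \<union> B \<union> S
      \<Longrightarrow> modal_energy J x \<le> K * (observed T J x + sum_sq (J \<inter> F) x + (residual_mass J x)\<^sup>2)"
    by (rule observed_lower_mod_finite[OF T]) blast
  define \<eta> where "\<eta> = \<epsilon> / (12 * K)"
  have \<eta>: "\<eta> > 0" "12 * K * \<eta> = \<epsilon>" using assms K by (auto simp: \<eta>_def)
  obtain N where N: "\<And>k. k \<ge> N \<Longrightarrow> near_limit F \<eta> k"
    using eventually_near_limit[OF \<eta>(1)] by (auto simp: eventually_sequentially)
  have "sum_sq G (\<lambda>i. x k i - a i) \<le> \<epsilon>" if k: "k \<ge> N" and G: "finite G" "G \<subseteq> A \<union> B" for k G
  proof (rule LIMSEQ_le_const2)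
    show "(\<lambda>l. sum_sq G (\<lambda>i. x k i - x l i)) \<longlonglongrightarrow> sum_sq G (\<lambda>i. x k i - a i)"
      unfolding sum_sq_def by (intro tendsto_intros x_tendsto)
    have "sum_sq G (\<lambda>i. x k i - x l i) \<le> 12 * K * \<eta>" if "l \<ge> N" for l
      using \<eta>(1) by (intro sum_sq_near_limit_diff_le[OF F K lower N[OF k] N[OF that] _ G]) auto
    then show "\<exists>M. \<forall>l\<ge>M. sum_sq G (\<lambda>i. x k i - x l i) \<le> \<epsilon>" unfolding \<eta>(2) by blast
  qed
  then show ?thesis by (auto simp: eventually_sequentially)
qed

lemma observed_limit_eq_0: "observed T {i. a i \<noteq> 0} a = 0"
proof -
  let ?P = "{i. a i \<noteq> 0}"
  have "T \<ge> 0" using critical_time_pos[OF \<gamma>_pos T] by simp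
  then obtain K where K: "K > 0" and upper: "\<And>J x. finite J \<Longrightarrow> J \<subseteq> A \<union> B \<union> S
      \<Longrightarrow> observed T J x \<le> K * (modal_energy J x + (residual_mass J x)\<^sup>2)"
    using observed_upper by blast
  have "observed T ?P a \<le> 0 + \<epsilon>" if "\<epsilon> > 0" for \<epsilon>
  proof -
    define \<eta> where "\<eta> = \<epsilon> / (2 + 4 * K)"
    have \<eta>: "\<eta> > 0" "(2 + 4 * K) * \<eta> = \<epsilon>" using that K by (auto simp: \<eta>_def)
    have "\<forall>\<^sub>F k in sequentially. observed T ?P a \<le> \<epsilon>"
      using eventually_near_limit[OF \<eta>(1), of "{}"] modal_convergence[OF \<eta>(1)]
    proof eventually_elim
      case (elim k)
      let ?J = "?P \<union> J k" and ?y = "\<lambda>i. x k i - a i"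
      have J: "finite ?J" "?J \<subseteq> A \<union> B \<union> S"
        using finite_limit_support finite_J J_subset limit_eq_0_outside by blast+
      have "observed T ?P a = observed T ?J (\<lambda>i. x k i - ?y i)"
        using J(1) by (subst observed_mono_neutral[of ?J ?P]) auto
      also have "\<dots> \<le> 2 * observed T ?J (x k) + 2 * observed T ?J ?y" by (rule observed_diff_le)
      also have "observed T ?J (x k) = observed T (J k) (x k)"
        using J(1) by (intro observed_mono_neutral) (auto simp: support)
      also have "2 * \<dots> + 2 * observed T ?J ?y \<le> 2 * \<eta> + 2 * (K * (\<eta> + \<eta>))"
      proof (intro add_mono mult_left_mono order_trans[OF upper[OF J]])
        show "modal_energy ?J ?y \<le> \<eta>" unfolding modal_energy_def using elim(2) J(1) by simp
        have "residual_mass ?J ?y \<le> sqrt \<eta>"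
          unfolding residual_mass_def using elim(1) J(1) by (simp add: near_limit_def)
        then have "(residual_mass ?J ?y)\<^sup>2 \<le> (sqrt \<eta>)\<^sup>2" by (intro power_mono residual_mass_nonneg)
        then show "(residual_mass ?J ?y)\<^sup>2 \<le> \<eta>" using \<eta>(1) by simp
      qed (use elim(1) K in \<open>auto simp: near_limit_def\<close>)
      also have "\<dots> = (2 + 4 * K) * \<eta>" by (simp add: algebra_simps)
      finally show ?case using \<eta>(2) by simp
    qed
    then show ?thesis using eventually_happens'[OF sequentially_bot] by simp
  qed
  then have "observed T ?P a \<le> 0" by (rule field_le_epsilon)
  then show ?thesis using observed_nonneg by (rule antisym)
qed

lemma modal_energy_eventually_small:
  assumes "\<epsilon> > 0"
  shows "\<forall>\<^sub>F k in sequentially. modal_energy (J k) (x k) \<le> \<epsilon>"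
proof -
  have "a i = 0" for i
  proof (rule ccontr)
    assume "a i \<noteq> 0"
    moreover have "{i. a i \<noteq> 0} \<subseteq> A \<union> B \<union> S" using limit_eq_0_outside by blast
    ultimately show False
      using unique_continuation[OF finite_limit_support _ critical_time_pos[OF \<gamma>_pos T] observed_limit_eq_0]
      by blast
  qed
  then show ?thesis
    using modal_convergence[OF assms] by (auto elim!: eventually_mono simp: modal_energy_def finite_J)
qed

end

context dominated_mode_system
begin

lemma dominated_scale: "dominated x \<Longrightarrow> dominated (\<lambda>i. c * x i)"
  unfolding dominated_def
  by (auto simp: norm_mult sum_sq_scale real_sqrt_mult mult.left_commute intro: mult_left_mono)

lemma normalise_modal_energy:
  assumes x: "dominated x" "\<And>i. i \<notin> J \<Longrightarrow> x i = 0" and obs: "observed T J x < \<epsilon> * modal_energy J x" and "\<epsilon> > 0"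
  obtains y where "dominated y" "\<And>i. i \<notin> J \<Longrightarrow> y i = 0" "modal_energy J y = 1" "observed T J y < \<epsilon>"
proof
  let ?E = "modal_energy J x"
  have "0 < \<epsilon> * ?E" using observed_nonneg obs by (rule order.strict_trans1)
  then have energy_pos: "?E > 0" using \<open>\<epsilon> > 0\<close> by (simp add: zero_less_mult_iff)
  define c where "c = complex_of_real (1 / sqrt ?E)"
  have norm_c: "(cmod c)\<^sup>2 = 1 / ?E" using energy_pos by (simp add: c_def power_divide del: of_real_divide)
  show "dominated (\<lambda>i. c * x i)" using x(1) by (rule dominated_scale)
  show "modal_energy J (\<lambda>i. c * x i) = 1"
    using energy_pos by (simp add: modal_energy_def sum_sq_scale norm_c)
  show "observed T J (\<lambda>i. c * x i) < \<epsilon>" using obs energy_pos by (simp add: observed_scale norm_c field_simps)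
qed (simp add: x(2))

lemma dominated_coeff_le:
  assumes "dominated x" and energy: "\<And>G. finite G \<Longrightarrow> G \<subseteq> A \<union> B \<Longrightarrow> sum_sq G x \<le> 1" and i: "i \<in> A \<union> B \<union> S"
  shows "cmod (x i) \<le> 1 + sqrt (infsum (\<lambda>s. (w s)\<^sup>2) S)"
proof (cases "i \<in> S")
  case True
  have "(w i)\<^sup>2 \<le> infsum (\<lambda>s. (w s)\<^sup>2) S"
    using finite_sum_le_infsum[OF w_summable, of "{i}"] True by simp
  then have w: "w i \<le> sqrt (infsum (\<lambda>s. (w s)\<^sup>2) S)" by (rule real_le_rsqrt)
  have "cmod (x i) \<le> w i * sqrt (sum_sq (D i) x)" using \<open>dominated x\<close> True by (simp add: dominated_def)
  also have "\<dots> \<le> w i * 1" using energy D(1,2)[OF True] w_nonneg by (intro mult_left_mono) auto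
  finally show ?thesis using w by simp
next
  case False
  then have "(cmod (x i))\<^sup>2 \<le> 1" using energy[of "{i}"] i by (simp add: sum_sq_def)
  then have "cmod (x i) \<le> 1" by (simp add: power_le_one_iff)
  moreover have "0 \<le> infsum (\<lambda>s. (w s)\<^sup>2) S" by (intro infsum_nonneg) simp
  ultimately show ?thesis by (simp add: add_increasing2)
qed

lemma observed_not_tendsto_0:
  fixes J :: "nat \<Rightarrow> 'a set" and x :: "nat \<Rightarrow> 'a \<Rightarrow> complex"
  assumes T: "T > 2 * pi / \<gamma>"
    and J: "\<And>k. finite (J k)" "\<And>k. J k \<subseteq> A \<union> B \<union> S" and supp: "\<And>k i. i \<notin> J k \<Longrightarrow> x k i = 0"
    and dom: "\<And>k. dominated (x k)" and energy: "\<And>k. modal_energy (J k) (x k) = 1"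
  shows "\<not> (\<lambda>k. observed T (J k) (x k)) \<longlonglongrightarrow> 0"
proof
  assume obs: "(\<lambda>k. observed T (J k) (x k)) \<longlonglongrightarrow> 0"
  let ?w = "sqrt (infsum (\<lambda>s. (w s)\<^sup>2) S)"
  have energy_le: "sum_sq G (x k) \<le> 1" if "finite G" "G \<subseteq> A \<union> B" for G k
    using sum_sq_le_modal_energy[of "J k" "x k" G] J(1) supp energy that by simp
  have "norm (x k i) \<le> 1 + ?w" if "i \<in> A \<union> B \<union> S" for k i
    by (rule dominated_coeff_le[OF dom energy_le that])
  then obtain f where f: "strict_mono (f :: nat \<Rightarrow> nat)"
    and conv: "\<And>i. i \<in> A \<union> B \<union> S \<Longrightarrow> \<exists>l. (\<lambda>k. x (f k) i) \<longlonglongrightarrow> l"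
    by (rule function_convergent_subsequence[OF countable_modes, of x]) (assumption, rule that)
  have "\<exists>l. (\<lambda>k. x (f k) i) \<longlonglongrightarrow> l" for i
  proof (cases "i \<in> A \<union> B \<union> S")
    case False
    then have "x (f k) i = 0" for k using J(2) supp by blast
    then show ?thesis by auto
  qed (rule conv)
  then obtain a where a: "\<And>i. (\<lambda>k. x (f k) i) \<longlonglongrightarrow> a i" by metis
  interpret dominated_vanishing_observation \<mu> p q A B S \<gamma> \<alpha> \<beta> \<rho> T ?w "\<lambda>k. J (f k)" "\<lambda>k. x (f k)" a D w
  proof unfold_locales
    show "(\<lambda>k. observed T (J (f k)) (x (f k))) \<longlonglongrightarrow> 0"
      using LIMSEQ_subseq_LIMSEQ[OF obs f] by (simp add: o_def)
    show "residual_mass (J (f k)) (x (f k)) \<le> ?w" for k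
    proof (rule real_le_rsqrt)
      have "(residual_mass (J (f k)) (x (f k)))\<^sup>2
          \<le> (\<Sum>s\<in>J (f k) \<inter> S. (w s)\<^sup>2) * sum_sq (\<Union>s\<in>J (f k) \<inter> S. D s) (x (f k))"
        unfolding residual_mass_def using J(1) by (intro dominated_sum_le dom) auto
      also have "\<dots> \<le> infsum (\<lambda>s. (w s)\<^sup>2) S * 1"
        using J(1) D(1,2) w_summable
        by (intro mult_mono finite_sum_le_infsum energy_le sum_sq_nonneg infsum_nonneg) auto
      finally show "(residual_mass (J (f k)) (x (f k)))\<^sup>2 \<le> infsum (\<lambda>s. (w s)\<^sup>2) S" by simp
    qed
  qed (use T J supp a dom energy in auto)
  have "\<forall>\<^sub>F k in sequentially. modal_energy (J (f k)) (x (f k)) \<le> 1 / 2"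
    by (rule modal_energy_eventually_small) simp
  then show False by (simp add: energy)
qed

lemma observed_lower:
  assumes T: "T > 2 * pi / \<gamma>"
  shows "\<exists>\<delta>>0. \<forall>J x. finite J \<longrightarrow> J \<subseteq> A \<union> B \<union> S \<longrightarrow> (\<forall>i. i \<notin> J \<longrightarrow> x i = 0) \<longrightarrow> dominated x
    \<longrightarrow> \<delta> * modal_energy J x \<le> observed T J x"
proof (rule ccontr)
  assume "\<not> ?thesis"
  then have small_observation: "\<exists>J x. finite J \<and> J \<subseteq> A \<union> B \<union> S \<and> (\<forall>i. i \<notin> J \<longrightarrow> x i = 0) \<and> dominated x
      \<and> observed T J x < \<delta> * modal_energy J x" if "\<delta> > 0" for \<delta>
    using that by (auto simp: not_le)
  let ?bad = "\<lambda>k J x. finite J \<and> J \<subseteq> A \<union> B \<union> S \<and> (\<forall>i. i \<notin> J \<longrightarrow> x i = 0) \<and> dominated x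
    \<and> modal_energy J x = 1 \<and> observed T J x < inverse (real (Suc k))"
  have "\<exists>J x. ?bad k J x" for k
  proof -
    have pos: "inverse (real (Suc k)) > 0" by simp
    obtain J x where J: "finite J" "J \<subseteq> A \<union> B \<union> S" and x: "\<forall>i. i \<notin> J \<longrightarrow> x i = 0" "dominated x"
      and small: "observed T J x < inverse (real (Suc k)) * modal_energy J x"
      using small_observation[OF pos] by blast
    obtain y where "dominated y" "\<And>i. i \<notin> J \<Longrightarrow> y i = 0" "modal_energy J y = 1"
        "observed T J y < inverse (real (Suc k))"
      using normalise_modal_energy[OF x(2) x(1)[rule_format] small pos] by blast
    with J show ?thesis by blast
  qed
  then obtain J x where bad: "\<And>k. ?bad k (J k) (x k)" by metis
  have "(\<lambda>k. observed T (J k) (x k)) \<longlonglongrightarrow> 0"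
  proof (rule tendsto_sandwich[OF _ _ tendsto_const LIMSEQ_inverse_real_of_nat])
    show "\<forall>\<^sub>F k in sequentially. 0 \<le> observed T (J k) (x k)" by (simp add: observed_nonneg)
    show "\<forall>\<^sub>F k in sequentially. observed T (J k) (x k) \<le> inverse (real (Suc k))"
      using bad by (intro always_eventually allI less_imp_le) blast
  qed
  moreover have "\<not> (\<lambda>k. observed T (J k) (x k)) \<longlonglongrightarrow> 0"
    using bad by (intro observed_not_tendsto_0[OF T]) auto
  ultimately show False by blast
qed

definition block_closed :: "'a set \<Rightarrow> bool" where
  "block_closed J \<longleftrightarrow> finite J \<and> J \<subseteq> A \<union> B \<union> S \<and> (\<forall>s\<in>J \<inter> S. D s \<subseteq> J)"

lemma modal_energy_cong: "(\<And>i. i \<in> J \<Longrightarrow> x i = y i) \<Longrightarrow> modal_energy J x = modal_energy J y"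
  unfolding modal_energy_def sum_sq_def by (intro sum.cong) auto

lemma dominated_restrict:
  assumes "dominated x" "block_closed J"
  shows "dominated (\<lambda>i. if i \<in> J then x i else 0)"
  unfolding dominated_def
proof
  fix s assume s: "s \<in> S"
  show "cmod (if s \<in> J then x s else 0) \<le> w s * sqrt (sum_sq (D s) (\<lambda>i. if i \<in> J then x i else 0))"
  proof (cases "s \<in> J")
    case True
    then have "sum_sq (D s) (\<lambda>i. if i \<in> J then x i else 0) = sum_sq (D s) x"
      using assms(2) s unfolding block_closed_def sum_sq_def by (intro sum.cong) auto
    then show ?thesis using assms(1) s True by (simp add: dominated_def)
  qed (simp add: w_nonneg sum_sq_nonneg)
qed

lemma observed_bounds:
  assumes T: "T > 2 * pi / \<gamma>"
  obtains \<delta> K where "\<delta> > 0" "K > 0"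
    "\<And>J x. block_closed J \<Longrightarrow> dominated x \<Longrightarrow> \<delta> * modal_energy J x \<le> observed T J x"
    "\<And>J x. block_closed J \<Longrightarrow> dominated x \<Longrightarrow> observed T J x \<le> K * modal_energy J x"
proof -
  obtain \<delta> where \<delta>: "\<delta> > 0" and lower: "\<And>J x. finite J \<Longrightarrow> J \<subseteq> A \<union> B \<union> S \<Longrightarrow> \<forall>i. i \<notin> J \<longrightarrow> x i = 0
      \<Longrightarrow> dominated x \<Longrightarrow> \<delta> * modal_energy J x \<le> observed T J x"
    using observed_lower[OF T] by blast
  have "T \<ge> 0" using critical_time_pos[OF \<gamma>_pos T] by simp
  then obtain K where K: "K > 0" and upper: "\<And>J x. finite J \<Longrightarrow> J \<subseteq> A \<union> B \<union> S
      \<Longrightarrow> observed T J x \<le> K * (modal_energy J x + (residual_mass J x)\<^sup>2)"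
    using observed_upper by blast
  define W where "W = infsum (\<lambda>s. (w s)\<^sup>2) S"
  have "W \<ge> 0" unfolding W_def by (intro infsum_nonneg) simp
  show thesis
  proof
    show "\<delta> > 0" "K * (1 + W) > 0" using \<delta> K \<open>W \<ge> 0\<close> by auto
    fix J x assume J: "block_closed J" and x: "dominated x"
    let ?y = "\<lambda>i. if i \<in> J then x i else 0"
    have "\<delta> * modal_energy J ?y \<le> observed T J ?y"
      using J dominated_restrict[OF x J] by (intro lower) (auto simp: block_closed_def)
    then show "\<delta> * modal_energy J x \<le> observed T J x"
      using observed_cong[of J ?y x] modal_energy_cong[of J ?y x] by simp
    have "observed T J x \<le> K * (modal_energy J x + (residual_mass J x)\<^sup>2)"
      using J by (intro upper) (auto simp: block_closed_def)
    also have "\<dots> \<le> K * (modal_energy J x + W * modal_energy J x)"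
      unfolding W_def using K J
      by (intro mult_left_mono add_left_mono residual_mass_power2_le[OF x]) (auto simp: block_closed_def)
    finally show "observed T J x \<le> K * (1 + W) * modal_energy J x" by (simp add: algebra_simps)
  qed
qed

lemma observed_Diff:
  assumes "finite J" "I \<subseteq> J"
  shows "observed T (J - I) x
    = L2_sq T (\<lambda>t. exp_sum J \<mu> (\<lambda>i. p i * x i) t - exp_sum I \<mu> (\<lambda>i. p i * x i) t)
      + L2_sq T (\<lambda>t. exp_sum J \<mu> (\<lambda>i. q i * x i) t - exp_sum I \<mu> (\<lambda>i. q i * x i) t)"
proof -
  have "exp_sum (J - I) \<mu> y = (\<lambda>t. exp_sum J \<mu> y t - exp_sum I \<mu> y t)" for y
    using assms by (auto simp: exp_sum_def sum_diff)
  then show ?thesis by (simp add: observed_def)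
qed

lemma modal_energy_Diff:
  assumes "finite J" "I \<subseteq> J"
  shows "modal_energy (J - I) x = modal_energy J x - modal_energy I x"
proof -
  have "J \<inter> (A \<union> B) - I \<inter> (A \<union> B) = (J - I) \<inter> (A \<union> B)" by blast
  then show ?thesis
    unfolding modal_energy_def sum_sq_def using assms
      sum_diff[of "J \<inter> (A \<union> B)" "I \<inter> (A \<union> B)" "\<lambda>i. (cmod (x i))\<^sup>2"] by auto
qed

definition exhausting :: "(nat \<Rightarrow> 'a set) \<Rightarrow> bool" where
  "exhausting J \<longleftrightarrow> mono J \<and> (\<forall>n. block_closed (J n)) \<and> (\<forall>m n. m \<le> n \<longrightarrow> block_closed (J n - J m))"

lemma partial_sums_L2_Cauchy:
  assumes T: "T > 2 * pi / \<gamma>" and J: "exhausting J" and x: "dominated x"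
    and energy: "(\<lambda>n. modal_energy (J n) x) \<longlonglongrightarrow> E" and v: "v = p \<or> v = q" and "\<epsilon> > 0"
  shows "\<exists>N. \<forall>m\<ge>N. \<forall>n\<ge>N.
    L2_sq T (\<lambda>t. exp_sum (J m) \<mu> (\<lambda>i. v i * x i) t - exp_sum (J n) \<mu> (\<lambda>i. v i * x i) t) \<le> \<epsilon>"
proof -
  let ?L = "\<lambda>m n. L2_sq T (\<lambda>t. exp_sum (J m) \<mu> (\<lambda>i. v i * x i) t - exp_sum (J n) \<mu> (\<lambda>i. v i * x i) t)"
  obtain K where K: "K > 0"
    and upper: "\<And>J x. block_closed J \<Longrightarrow> dominated x \<Longrightarrow> observed T J x \<le> K * modal_energy J x"
    by (rule observed_bounds[OF T]) blast
  obtain N where N: "\<And>m n. m \<ge> N \<Longrightarrow> n \<ge> N \<Longrightarrow> \<bar>modal_energy (J m) x - modal_energy (J n) x\<bar> < \<epsilon> / K"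
    using CauchyD[OF LIMSEQ_imp_Cauchy[OF energy], of "\<epsilon> / K"] K \<open>\<epsilon> > 0\<close> by auto
  have ordered: "?L m n \<le> \<epsilon>" if order: "n \<ge> N" "n \<le> m" for m n
  proof -
    have nested: "finite (J m)" "J n \<subseteq> J m" "block_closed (J m - J n)"
      using J order(2) by (auto simp: exhausting_def block_closed_def dest: monoD)
    have "?L m n \<le> observed T (J m - J n) x"
      using v L2_sq_nonneg by (auto simp: observed_Diff[OF nested(1,2)])
    also have "\<dots> \<le> K * modal_energy (J m - J n) x" by (rule upper[OF nested(3) x])
    also have "\<dots> \<le> \<epsilon>"
      using N[of m n] order K by (simp add: modal_energy_Diff[OF nested(1,2)] field_simps abs_less_iff)
    finally show ?thesis .
  qed
  have "?L m n \<le> \<epsilon>" if "m \<ge> N" "n \<ge> N" for m n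
    using ordered[of n m] ordered[of m n] that L2_sq_minus_commute[of T "exp_sum (J m) \<mu> (\<lambda>i. v i * x i)"]
    by (cases "n \<le> m") auto
  then show ?thesis by blast
qed

lemma observed_bounds_limit:
  assumes U: "L2_tendsto T (\<lambda>n. exp_sum (J n) \<mu> (\<lambda>i. p i * x i)) U\<^sub>1"
      "L2_tendsto T (\<lambda>n. exp_sum (J n) \<mu> (\<lambda>i. q i * x i)) U\<^sub>2"
    and energy: "(\<lambda>n. modal_energy (J n) x) \<longlonglongrightarrow> E"
    and lower: "\<And>n. \<delta> * modal_energy (J n) x \<le> observed T (J n) x"
    and upper: "\<And>n. observed T (J n) x \<le> K * modal_energy (J n) x"
  shows "\<delta> / 2 * E \<le> L2_sq T U\<^sub>1 + L2_sq T U\<^sub>2" "L2_sq T U\<^sub>1 + L2_sq T U\<^sub>2 \<le> 2 * K * E"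
proof -
  define err where "err n = L2_sq T (\<lambda>t. U\<^sub>1 t - exp_sum (J n) \<mu> (\<lambda>i. p i * x i) t)
    + L2_sq T (\<lambda>t. U\<^sub>2 t - exp_sum (J n) \<mu> (\<lambda>i. q i * x i) t)" for n
  define I where "I = L2_sq T U\<^sub>1 + L2_sq T U\<^sub>2"
  have err: "err \<longlonglongrightarrow> 0"
    using tendsto_add[of _ 0 _ _ 0] U unfolding err_def L2_tendsto_def by fastforce
  have compare: "I \<le> 2 * observed T (J n) x + 2 * err n" "observed T (J n) x \<le> 2 * I + 2 * err n" for n
    using L2_tendsto_bounds[OF U(1) square_integrable_exp_sum, of n] L2_tendsto_bounds[OF U(2) square_integrable_exp_sum, of n]
    by (simp_all add: I_def err_def observed_def)
  have "\<delta> * E \<le> 2 * I + 2 * 0"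
  proof (rule LIMSEQ_le)
    show "(\<lambda>n. \<delta> * modal_energy (J n) x) \<longlonglongrightarrow> \<delta> * E" by (intro tendsto_intros energy)
    show "(\<lambda>n. 2 * I + 2 * err n) \<longlonglongrightarrow> 2 * I + 2 * 0" by (intro tendsto_intros err)
  qed (use order_trans[OF lower compare(2)] in blast)
  moreover have "I \<le> 2 * (K * E) + 2 * 0"
  proof (rule LIMSEQ_le_const)
    show "(\<lambda>n. 2 * (K * modal_energy (J n) x) + 2 * err n) \<longlonglongrightarrow> 2 * (K * E) + 2 * 0"
      by (intro tendsto_intros energy err)
    have "I \<le> 2 * (K * modal_energy (J n) x) + 2 * err n" for n
      using compare(1)[of n] upper[of n] by linarith
    then show "\<exists>M. \<forall>n\<ge>M. I \<le> 2 * (K * modal_energy (J n) x) + 2 * err n" by blast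
  qed
  ultimately show "\<delta> / 2 * E \<le> L2_sq T U\<^sub>1 + L2_sq T U\<^sub>2" "L2_sq T U\<^sub>1 + L2_sq T U\<^sub>2 \<le> 2 * K * E"
    by (simp_all add: I_def)
qed

lemma observability:
  assumes T: "T > 2 * pi / \<gamma>"
  obtains \<delta> K where "\<delta> > 0" "K > 0"
    "\<And>J x E. exhausting J \<Longrightarrow> dominated x \<Longrightarrow> (\<lambda>n. modal_energy (J n) x) \<longlonglongrightarrow> E
      \<Longrightarrow> \<exists>U\<^sub>1 U\<^sub>2. L2_tendsto T (\<lambda>n. exp_sum (J n) \<mu> (\<lambda>i. p i * x i)) U\<^sub>1
        \<and> L2_tendsto T (\<lambda>n. exp_sum (J n) \<mu> (\<lambda>i. q i * x i)) U\<^sub>2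
        \<and> \<delta> * E \<le> L2_sq T U\<^sub>1 + L2_sq T U\<^sub>2 \<and> L2_sq T U\<^sub>1 + L2_sq T U\<^sub>2 \<le> K * E"
proof -
  obtain \<delta> K where \<delta>: "\<delta> > 0" and K: "K > 0"
    and lower: "\<And>J x. block_closed J \<Longrightarrow> dominated x \<Longrightarrow> \<delta> * modal_energy J x \<le> observed T J x"
    and upper: "\<And>J x. block_closed J \<Longrightarrow> dominated x \<Longrightarrow> observed T J x \<le> K * modal_energy J x"
    by (rule observed_bounds[OF T]) blast
  show thesis
  proof (rule that[of "\<delta> / 2" "2 * K"])
    fix J x E
    assume J: "exhausting J" and x: "dominated x" and energy: "(\<lambda>n. modal_energy (J n) x) \<longlonglongrightarrow> E"
    let ?u = "\<lambda>v n. exp_sum (J n) \<mu> (\<lambda>i. v i * x i)"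
    have closed: "block_closed (J n)" for n using J by (simp add: exhausting_def)
    obtain U\<^sub>1 where lim1: "L2_tendsto T (?u p) U\<^sub>1"
      using L2_complete[of "?u p" T] continuous_on_exp_sum partial_sums_L2_Cauchy[OF T J x energy, of p] by blast
    obtain U\<^sub>2 where lim2: "L2_tendsto T (?u q) U\<^sub>2"
      using L2_complete[of "?u q" T] continuous_on_exp_sum partial_sums_L2_Cauchy[OF T J x energy, of q] by blast
    show "\<exists>U\<^sub>1 U\<^sub>2. L2_tendsto T (?u p) U\<^sub>1 \<and> L2_tendsto T (?u q) U\<^sub>2
        \<and> \<delta> / 2 * E \<le> L2_sq T U\<^sub>1 + L2_sq T U\<^sub>2 \<and> L2_sq T U\<^sub>1 + L2_sq T U\<^sub>2 \<le> 2 * K * E"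
      using lim1 lim2 observed_bounds_limit[OF lim1 lim2 energy lower[OF closed x] upper[OF closed x]] by blast
  qed (use \<delta> K in auto)
qed

end

subsection \<open>Mirrored frequency sequences\<close>

lemma increments_ge:
  fixes y :: "nat \<Rightarrow> real"
  assumes "\<forall>n\<ge>N. c \<le> y (Suc n) - y n" and "N \<le> m" "m \<le> n"
  shows "c * (real n - real m) \<le> y n - y m"
  using \<open>m \<le> n\<close>
proof (induction n rule: dec_induct)
  case (step k)
  then have "c \<le> y (Suc k) - y k" using assms(1,2) by simp
  with step.IH show ?case by (simp add: algebra_simps)
qed simp

lemma filterlim_at_top_if_increments_ge:
  fixes y :: "nat \<Rightarrow> real"
  assumes "c > 0" and step: "\<forall>n\<ge>N. c \<le> y (Suc n) - y n"
  shows "filterlim y at_top sequentially"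
proof (rule filterlim_at_top_mono)
  show "filterlim (\<lambda>n. y N - c * real N + c * real n) at_top sequentially"
    using \<open>c > 0\<close> by (intro filterlim_tendsto_add_at_top[OF tendsto_const]
        filterlim_tendsto_pos_mult_at_top[OF tendsto_const] filterlim_real_sequentially)
  show "\<forall>\<^sub>F n in sequentially. y N - c * real N + c * real n \<le> y n"
    using eventually_ge_at_top[of N]
  proof eventually_elim
    case (elim n)
    show ?case using increments_ge[OF step order_refl elim] by (simp add: right_diff_distrib)
  qed
qed

lemma eventually_gap_imp_separated:
  fixes y :: "nat \<Rightarrow> real"
  assumes gap: "\<forall>c<\<gamma>. \<forall>\<^sub>F n in sequentially. c < y (Suc n) - y n" and "\<gamma> > 0" "\<gamma>' < \<gamma>"
  obtains N where "\<forall>n\<ge>N. 0 < y n \<and> \<gamma>' \<le> y n"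
    "\<forall>n\<ge>N. \<forall>m\<ge>N. n \<noteq> m \<longrightarrow> \<gamma>' \<le> \<bar>y n - y m\<bar>"
proof -
  define c where "c = max \<gamma>' (\<gamma> / 2)"
  have c_bounds: "0 < c" "c < \<gamma>" "\<gamma>' \<le> c" using \<open>\<gamma>' < \<gamma>\<close> \<open>\<gamma> > 0\<close> by (auto simp: c_def)
  obtain N where N: "\<forall>n\<ge>N. c \<le> y (Suc n) - y n"
    using gap[rule_format, OF c_bounds(2)] by (auto simp: eventually_sequentially intro: less_imp_le)
  obtain N' where N': "\<And>n. n \<ge> N' \<Longrightarrow> c \<le> y n"
    using filterlim_at_top_if_increments_ge[OF c_bounds(1) N] by (auto simp: filterlim_at_top eventually_sequentially)
  have separated: "\<gamma>' \<le> \<bar>y n - y m\<bar>" if far: "n \<ge> N" "m \<ge> N" "n \<noteq> m" for n m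
  proof -
    have "c * 1 \<le> c * \<bar>real n - real m\<bar>" using far(3) c_bounds(1) by (intro mult_left_mono) auto
    moreover have "c * \<bar>real n - real m\<bar> \<le> \<bar>y n - y m\<bar>"
      using increments_ge[OF N far(1), of m] increments_ge[OF N far(2), of n]
      by (cases "n \<le> m") (auto simp: abs_minus_commute)
    ultimately show ?thesis using c_bounds(3) by simp
  qed
  show thesis
  proof (rule that[of "max N N'"])
    show "\<forall>n\<ge>max N N'. 0 < y n \<and> \<gamma>' \<le> y n"
    proof (intro allI impI)
      fix n assume "n \<ge> max N N'"
      then have "c \<le> y n" by (intro N') simp
      then show "0 < y n \<and> \<gamma>' \<le> y n" using c_bounds by simp
    qed
    show "\<forall>n\<ge>max N N'. \<forall>m\<ge>max N N'. n \<noteq> m \<longrightarrow> \<gamma>' \<le> \<bar>y n - y m\<bar>" using separated by simp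
  qed
qed

lemma asymptotic_gap_mirrored:
  fixes y :: "nat \<Rightarrow> real" and f :: "bool \<Rightarrow> nat \<Rightarrow> 'i"
  assumes gap: "\<forall>c<\<gamma>. \<forall>\<^sub>F n in sequentially. c < y (Suc n) - y n" and "\<gamma> > 0"
    and v: "\<And>s n. v (f s n) = (if s then - y n else y n)"
  shows "asymptotic_gap \<gamma> {f s n |s n. n \<ge> 1} v"
  unfolding asymptotic_gap_def
proof (intro allI impI)
  fix \<gamma>' assume "\<gamma>' < \<gamma>"
  obtain N where N: "\<forall>n\<ge>N. 0 < y n \<and> \<gamma>' \<le> y n"
    "\<forall>n\<ge>N. \<forall>m\<ge>N. n \<noteq> m \<longrightarrow> \<gamma>' \<le> \<bar>y n - y m\<bar>"
    by (rule eventually_gap_imp_separated[OF gap \<open>\<gamma> > 0\<close> \<open>\<gamma>' < \<gamma>\<close>]) (rule that)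
  let ?F = "(\<lambda>(s, n). f s n) ` (UNIV \<times> {..<N})"
  have outside: "n \<ge> N" if "f s n \<notin> ?F" for s n
  proof (rule ccontr)
    assume "\<not> n \<ge> N"
    then have "f s n \<in> ?F" by (intro image_eqI[of _ _ "(s, n)"]) auto
    with that show False by contradiction
  qed
  have "gap_separated \<gamma>' ({f s n |s n. n \<ge> 1} - ?F) v"
    unfolding gap_separated_def
  proof (rule pairwiseI)
    fix i j assume ij: "i \<in> {f s n |s n. n \<ge> 1} - ?F" "j \<in> {f s n |s n. n \<ge> 1} - ?F" "i \<noteq> j"
    then obtain s n s' m where eq: "i = f s n" "j = f s' m" by blast
    have large: "n \<ge> N" "m \<ge> N"
      using outside[of s n] outside[of s' m] ij(1,2) by (simp_all add: eq)
    show "\<gamma>' \<le> \<bar>v i - v j\<bar>"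
    proof (cases "s = s'")
      case True
      then have "n \<noteq> m" using ij(3) eq by auto
      then show ?thesis using N(2) large True by (simp add: eq v abs_minus_commute)
    next
      case False
      then show ?thesis using N(1)[rule_format, OF large(1)] N(1)[rule_format, OF large(2)]
        by (cases s; cases s') (simp_all add: eq v)
    qed
  qed
  then show "\<exists>F. finite F \<and> gap_separated \<gamma>' ({f s n |s n. n \<ge> 1} - F) v"
    by (intro exI[of _ ?F] conjI) simp_all
qed

lemma asymptotic_gap_insert:
  assumes "asymptotic_gap \<gamma> A y"
  shows "asymptotic_gap \<gamma> (insert i A) y"
  unfolding asymptotic_gap_def
proof (intro allI impI)
  fix \<gamma>' assume "\<gamma>' < \<gamma>"
  then obtain F where "finite F" "gap_separated \<gamma>' (A - F) y"
    using assms unfolding asymptotic_gap_def by blast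
  then have "finite (insert i F)" "gap_separated \<gamma>' (insert i A - insert i F) y"
    by (auto elim: gap_separated_subset)
  then show "\<exists>F. finite F \<and> gap_separated \<gamma>' (insert i A - F) y" by blast
qed

lemma tendsto_cofinite_on_indexed:
  assumes g: "g \<longlonglongrightarrow> l" and fibres: "\<And>n. finite {i \<in> A. k i = n}"
    and f: "finite {i \<in> A. f i \<noteq> g (k i)}"
  shows "(f \<longlongrightarrow> l) (cofinite_on A)"
proof -
  have "filterlim k sequentially (cofinite_on A)"
    unfolding filterlim_at_top eventually_cofinite_on
  proof
    fix N
    have "{i \<in> A. \<not> N \<le> k i} = (\<Union>n<N. {i \<in> A. k i = n})" by auto
    then show "finite {i \<in> A. \<not> N \<le> k i}" using fibres by simp
  qed
  then have "((\<lambda>i. g (k i)) \<longlongrightarrow> l) (cofinite_on A)" by (rule filterlim_compose[OF g])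
  then show ?thesis
    by (rule Lim_transform_eventually) (use f in \<open>simp add: eventually_cofinite_on eq_commute\<close>)
qed

subsection \<open>The oscillator system\<close>

text \<open>The flag of an oscillating mode tells the conjugate mode; the term \<open>\<E> e\<^bsup>-\<eta>t\<^esup>\<close> is the mode \<open>Decay\<close>.\<close>

datatype mode = Omega bool nat | Zeta bool nat | Residual nat | Decay

instance mode :: countable by countable_datatype

definition conj_if :: "bool \<Rightarrow> complex \<Rightarrow> complex" where
  "conj_if s z = (if s then cnj z else z)"

lemma conj_if_simps [simp]:
  "conj_if False z = z" "conj_if True z = cnj z" "cmod (conj_if s z) = cmod z"
  "Re (conj_if s z) = Re z" "Im (conj_if s z) = (if s then - Im z else Im z)"
  by (simp_all add: conj_if_def)

lemma conj_if_imaginary_eqD: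
  assumes "conj_if s (\<i> * z) = conj_if s' (\<i> * w)" "Re z > 0" "Re w > 0"
  shows "s = s' \<and> z = w"
  using assms by (cases s; cases s') (auto simp: complex_eq_iff)

lemma conj_if_imaginary_neq_of_real:
  assumes "Re z > 0"
  shows "conj_if s (\<i> * z) \<noteq> complex_of_real x"
  using assms by (auto simp: complex_eq_iff)

fun mode_index :: "mode \<Rightarrow> nat" where
  "mode_index (Omega s n) = n"
| "mode_index (Zeta s n) = n"
| "mode_index (Residual n) = n"
| "mode_index Decay = 0"

lemma finite_mode_index_fibre: "finite {i \<in> A. mode_index i = n}"
proof (rule finite_subset)
  show "{i \<in> A. mode_index i = n} \<subseteq> range (\<lambda>s. Omega s n) \<union> range (\<lambda>s. Zeta s n) \<union> {Residual n, Decay}"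
  proof
    fix i assume "i \<in> {i \<in> A. mode_index i = n}"
    then show "i \<in> range (\<lambda>s. Omega s n) \<union> range (\<lambda>s. Zeta s n) \<union> {Residual n, Decay}"
      by (cases i) auto
  qed
qed simp

definition omega_modes :: "mode set" where
  "omega_modes = {Omega s n |s n. n \<ge> 1}"

definition zeta_modes :: "mode set" where
  "zeta_modes = insert Decay {Zeta s n |s n. n \<ge> 1}"

definition residual_modes :: "mode set" where
  "residual_modes = Residual ` {1..}"

definition modes_upto :: "nat \<Rightarrow> mode set" where
  "modes_upto N = {Decay} \<union> (\<Union>n\<in>{1..N}. {Omega False n, Omega True n, Zeta False n, Zeta True n, Residual n})"

lemma mem_modes [simp]:
  "Omega s n \<in> omega_modes \<longleftrightarrow> n \<ge> 1" "Omega s n \<notin> zeta_modes" "Omega s n \<notin> residual_modes"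
  "Zeta s n \<in> zeta_modes \<longleftrightarrow> n \<ge> 1" "Zeta s n \<notin> omega_modes" "Zeta s n \<notin> residual_modes"
  "Residual n \<in> residual_modes \<longleftrightarrow> n \<ge> 1" "Residual n \<notin> omega_modes" "Residual n \<notin> zeta_modes"
  "Decay \<in> zeta_modes" "Decay \<notin> omega_modes" "Decay \<notin> residual_modes"
  by (auto simp: omega_modes_def zeta_modes_def residual_modes_def)

lemma mem_modes_upto [simp]:
  "Omega s n \<in> modes_upto N \<longleftrightarrow> 1 \<le> n \<and> n \<le> N" "Zeta s n \<in> modes_upto N \<longleftrightarrow> 1 \<le> n \<and> n \<le> N"
  "Residual n \<in> modes_upto N \<longleftrightarrow> 1 \<le> n \<and> n \<le> N" "Decay \<in> modes_upto N"
  by (cases s; auto simp: modes_upto_def)+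

lemma finite_modes_upto: "finite (modes_upto N)"
  by (simp add: modes_upto_def)

lemma modes_upto_subset: "modes_upto N \<subseteq> omega_modes \<union> zeta_modes \<union> residual_modes"
  by (auto simp: modes_upto_def)

lemma sum_modes_upto:
  fixes f :: "mode \<Rightarrow> 'a::comm_monoid_add"
  shows "sum f (modes_upto N) = f Decay + (\<Sum>n=1..N. f (Omega False n) + f (Omega True n)
    + f (Zeta False n) + f (Zeta True n) + f (Residual n))"
proof -
  let ?block = "\<lambda>n. {Omega False n, Omega True n, Zeta False n, Zeta True n, Residual n}"
  have "sum f (modes_upto N) = f Decay + sum f (\<Union>n\<in>{1..N}. ?block n)"
    unfolding modes_upto_def by (subst sum.union_disjoint) auto
  also have "sum f (\<Union>n\<in>{1..N}. ?block n) = (\<Sum>n=1..N. sum f (?block n))"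
    by (rule sum.UNION_disjoint) auto
  finally show ?thesis by (simp add: add.assoc)
qed

fun mode_coeff :: "(nat \<Rightarrow> complex) \<Rightarrow> (nat \<Rightarrow> complex) \<Rightarrow> (nat \<Rightarrow> real) \<Rightarrow> real \<Rightarrow> mode \<Rightarrow> complex" where
  "mode_coeff C b R E (Omega s n) = conj_if s (C n)"
| "mode_coeff C b R E (Zeta s n) = conj_if s (b n)"
| "mode_coeff C b R E (Residual n) = of_real (R n)"
| "mode_coeff C b R E Decay = of_real E"

locale oscillator_system =
  fixes \<omega> \<zeta> c d :: "nat \<Rightarrow> complex" and r :: "nat \<Rightarrow> real"
    and \<gamma> \<alpha> \<chi>\<^sub>0 \<mu> \<nu> M c\<^sub>1 \<eta> :: real and n' :: nat
  assumes const: "\<gamma> > 0" "\<mu> > 0" "\<nu> > 1/2" "M > 0" "0 < c\<^sub>1"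
    and liminf_gap: "liminf (\<lambda>n. ereal (Re (\<omega> (Suc n)) - Re (\<omega> n))) = ereal \<gamma>"
      "liminf (\<lambda>n. ereal (Re (\<zeta> (Suc n)) - Re (\<zeta> n))) = ereal \<gamma>"
    and Im_tendsto: "(\<lambda>n. Im (\<omega> n)) \<longlonglongrightarrow> \<alpha>" "(\<lambda>n. Im (\<zeta> n)) \<longlonglongrightarrow> 0" and r_tendsto: "r \<longlonglongrightarrow> \<chi>\<^sub>0"
    and d_bound: "\<And>n. n \<ge> 1 \<Longrightarrow> c\<^sub>1 * cmod (\<zeta> n) \<le> cmod (d n)"
    and c_bound: "\<And>n. n \<ge> 1 \<Longrightarrow> cmod (c n) \<le> M / cmod (\<omega> n)"
    and inj: "inj_on \<omega> {1..}" "inj_on r {1..}" "inj_on \<zeta> {1..}"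
    and distinct: "\<And>n m. n \<ge> 1 \<Longrightarrow> m \<ge> 1 \<Longrightarrow> \<omega> n \<noteq> \<zeta> m" "\<And>n. n \<ge> 1 \<Longrightarrow> r n \<noteq> - \<eta>"
    and Re_pos: "\<And>n. n \<ge> 1 \<Longrightarrow> Re (\<omega> n) > 0" "\<And>n. n \<ge> 1 \<Longrightarrow> Re (\<zeta> n) > 0"
begin

fun exponent :: "mode \<Rightarrow> complex" where
  "exponent (Omega s n) = conj_if s (\<i> * \<omega> n)"
| "exponent (Zeta s n) = conj_if s (\<i> * \<zeta> n)"
| "exponent (Residual n) = of_real (r n)"
| "exponent Decay = of_real (- \<eta>)"

fun weight\<^sub>1 :: "mode \<Rightarrow> complex" where
  "weight\<^sub>1 (Zeta s n) = conj_if s (1 / d n)"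
| "weight\<^sub>1 Decay = 0"
| "weight\<^sub>1 _ = 1"

fun weight\<^sub>2 :: "mode \<Rightarrow> complex" where
  "weight\<^sub>2 (Omega s n) = conj_if s (c n)"
| "weight\<^sub>2 (Residual n) = 0"
| "weight\<^sub>2 _ = 1"

fun dominating_modes :: "mode \<Rightarrow> mode set" where
  "dominating_modes (Residual n) = {Omega False n, Zeta False n}"
| "dominating_modes _ = {}"

definition residual_bound :: "nat \<Rightarrow> real" where
  "residual_bound n = (if n < n' then \<mu> else \<mu> * real n powr (- \<nu>))"

lemma eventually_gap:
  "\<forall>\<gamma>'<\<gamma>. \<forall>\<^sub>F n in sequentially. \<gamma>' < Re (\<omega> (Suc n)) - Re (\<omega> n)"
  "\<forall>\<gamma>'<\<gamma>. \<forall>\<^sub>F n in sequentially. \<gamma>' < Re (\<zeta> (Suc n)) - Re (\<zeta> n)"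
proof -
  have "\<forall>\<gamma>'<\<gamma>. \<forall>\<^sub>F n in sequentially. \<gamma>' < x n" if "liminf (\<lambda>n. ereal (x n)) = ereal \<gamma>" for x
  proof (intro allI impI)
    fix \<gamma>' assume "\<gamma>' < \<gamma>"
    then show "\<forall>\<^sub>F n in sequentially. \<gamma>' < x n"
      using less_LiminfD[of "ereal \<gamma>'" sequentially "\<lambda>n. ereal (x n)"] that by simp
  qed
  from this[OF liminf_gap(1)] this[OF liminf_gap(2)]
  show "\<forall>\<gamma>'<\<gamma>. \<forall>\<^sub>F n in sequentially. \<gamma>' < Re (\<omega> (Suc n)) - Re (\<omega> n)"
    "\<forall>\<gamma>'<\<gamma>. \<forall>\<^sub>F n in sequentially. \<gamma>' < Re (\<zeta> (Suc n)) - Re (\<zeta> n)" .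
qed

lemma asymptotic_gap_modes:
  "asymptotic_gap \<gamma> omega_modes (\<lambda>i. Im (exponent i))" "asymptotic_gap \<gamma> zeta_modes (\<lambda>i. Im (exponent i))"
proof -
  show "asymptotic_gap \<gamma> omega_modes (\<lambda>i. Im (exponent i))"
    unfolding omega_modes_def
    by (rule asymptotic_gap_mirrored[OF eventually_gap(1) const(1)]) simp
  have "asymptotic_gap \<gamma> {Zeta s n |s n. n \<ge> 1} (\<lambda>i. Im (exponent i))"
    by (rule asymptotic_gap_mirrored[OF eventually_gap(2) const(1)]) simp
  then show "asymptotic_gap \<gamma> zeta_modes (\<lambda>i. Im (exponent i))"
    unfolding zeta_modes_def by (rule asymptotic_gap_insert)
qed

lemma Re_exponent_tendsto:
  "((\<lambda>i. Re (exponent i)) \<longlongrightarrow> - \<alpha>) (cofinite_on omega_modes)"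
  "((\<lambda>i. Re (exponent i)) \<longlongrightarrow> 0) (cofinite_on zeta_modes)"
proof -
  show "((\<lambda>i. Re (exponent i)) \<longlongrightarrow> - \<alpha>) (cofinite_on omega_modes)"
    using tendsto_minus[OF Im_tendsto(1)] finite_mode_index_fibre
    by (rule tendsto_cofinite_on_indexed) (rule finite_subset[of _ "{}"], auto simp: omega_modes_def)
  show "((\<lambda>i. Re (exponent i)) \<longlongrightarrow> 0) (cofinite_on zeta_modes)"
    using tendsto_minus[OF Im_tendsto(2), unfolded minus_zero] finite_mode_index_fibre
  proof (rule tendsto_cofinite_on_indexed)
    show "finite {i \<in> zeta_modes. Re (exponent i) \<noteq> - Im (\<zeta> (mode_index i))}"
      by (rule finite_subset[of _ "{Decay}"]) (auto simp: zeta_modes_def)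
  qed
qed

lemma cmod_tendsto_at_top:
  "filterlim (\<lambda>n. cmod (\<omega> n)) at_top sequentially" "filterlim (\<lambda>n. cmod (\<zeta> n)) at_top sequentially"
proof -
  have diverges: "filterlim (\<lambda>n. cmod (\<sigma> n)) at_top sequentially"
    if gap: "\<forall>\<gamma>'<\<gamma>. \<forall>\<^sub>F n in sequentially. \<gamma>' < Re (\<sigma> (Suc n)) - Re (\<sigma> n)" for \<sigma> :: "nat \<Rightarrow> complex"
  proof -
    have "\<forall>\<^sub>F n in sequentially. \<gamma> / 2 < Re (\<sigma> (Suc n)) - Re (\<sigma> n)"
      using gap[rule_format, of "\<gamma> / 2"] const(1) by simp
    then obtain N where "\<forall>n\<ge>N. \<gamma> / 2 \<le> Re (\<sigma> (Suc n)) - Re (\<sigma> n)"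
      by (auto simp: eventually_sequentially intro: less_imp_le)
    then have "filterlim (\<lambda>n. Re (\<sigma> n)) at_top sequentially"
      using const(1) by (intro filterlim_at_top_if_increments_ge[of "\<gamma> / 2"]) simp_all
    then show ?thesis
      by (rule filterlim_at_top_mono) (simp add: complex_Re_le_cmod)
  qed
  show "filterlim (\<lambda>n. cmod (\<omega> n)) at_top sequentially" "filterlim (\<lambda>n. cmod (\<zeta> n)) at_top sequentially"
    by (rule diverges, rule eventually_gap)+
qed

lemma d_nonzero:
  assumes "n \<ge> 1"
  shows "d n \<noteq> 0"
proof
  assume "d n = 0"
  then have "cmod (\<zeta> n) \<le> 0" using d_bound[OF assms] const(5) by (simp add: mult_le_0_iff)
  then show False using Re_pos(2)[OF assms] by simp
qed

lemma weights_tendsto: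
  "(weight\<^sub>1 \<longlongrightarrow> 0) (cofinite_on zeta_modes)" "(weight\<^sub>2 \<longlongrightarrow> 0) (cofinite_on omega_modes)"
proof -
  have "(\<lambda>n. cmod (1 / d n)) \<longlonglongrightarrow> 0"
  proof (rule Lim_null_comparison)
    show "\<forall>\<^sub>F n in sequentially. norm (cmod (1 / d n)) \<le> inverse c\<^sub>1 * inverse (cmod (\<zeta> n))"
      using eventually_ge_at_top[of 1]
    proof eventually_elim
      case (elim n)
      then have "0 < c\<^sub>1 * cmod (\<zeta> n)" using const(5) Re_pos(2)[of n] by (intro mult_pos_pos) auto
      then have "inverse (cmod (d n)) \<le> inverse (c\<^sub>1 * cmod (\<zeta> n))"
        using d_bound[OF elim] by (intro le_imp_inverse_le)
      then show ?case by (simp add: norm_divide norm_inverse divide_inverse)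
    qed
    show "(\<lambda>n. inverse c\<^sub>1 * inverse (cmod (\<zeta> n))) \<longlonglongrightarrow> 0"
      using tendsto_mult_left[OF tendsto_inverse_0_at_top[OF cmod_tendsto_at_top(2)], of "inverse c\<^sub>1"] by simp
  qed
  then have "((\<lambda>i. cmod (weight\<^sub>1 i)) \<longlongrightarrow> 0) (cofinite_on zeta_modes)"
    using finite_mode_index_fibre
  proof (rule tendsto_cofinite_on_indexed)
    show "finite {i \<in> zeta_modes. cmod (weight\<^sub>1 i) \<noteq> cmod (1 / d (mode_index i))}"
      by (rule finite_subset[of _ "{Decay}"]) (auto simp: zeta_modes_def)
  qed
  then show "(weight\<^sub>1 \<longlongrightarrow> 0) (cofinite_on zeta_modes)" by (rule tendsto_norm_zero_cancel)
  have "(\<lambda>n. cmod (c n)) \<longlonglongrightarrow> 0"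
  proof (rule Lim_null_comparison)
    show "\<forall>\<^sub>F n in sequentially. norm (cmod (c n)) \<le> M * inverse (cmod (\<omega> n))"
      using eventually_ge_at_top[of 1] by eventually_elim (use c_bound in \<open>auto simp: divide_inverse\<close>)
    show "(\<lambda>n. M * inverse (cmod (\<omega> n))) \<longlonglongrightarrow> 0"
      using tendsto_mult_left[OF tendsto_inverse_0_at_top[OF cmod_tendsto_at_top(1)], of M] by simp
  qed
  then have "((\<lambda>i. cmod (weight\<^sub>2 i)) \<longlongrightarrow> 0) (cofinite_on omega_modes)"
    using finite_mode_index_fibre
    by (rule tendsto_cofinite_on_indexed) (rule finite_subset[of _ "{}"], auto simp: omega_modes_def)
  then show "(weight\<^sub>2 \<longlongrightarrow> 0) (cofinite_on omega_modes)" by (rule tendsto_norm_zero_cancel)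
qed

lemma residual_exponent_le:
  assumes "i \<in> residual_modes"
  shows "cmod (exponent i) \<le> (SUP n. \<bar>r n\<bar>)"
proof -
  have "bdd_above (range (\<lambda>n. \<bar>r n\<bar>))"
    using convergent_imp_Bseq[OF convergentI[OF r_tendsto]] by (auto simp: Bseq_def bdd_above_def)
  then show ?thesis using assms by (auto simp: residual_modes_def intro: cSUP_upper2)
qed

lemma residual_bound_summable: "(\<lambda>i. (residual_bound (mode_index i))\<^sup>2) summable_on residual_modes"
proof -
  have "summable (\<lambda>n. \<mu>\<^sup>2 * real n powr (- 2 * \<nu>))"
    using const(3) by (intro summable_mult) (simp add: summable_real_powr_iff)
  moreover have "\<forall>\<^sub>F n in sequentially. \<mu>\<^sup>2 * real n powr (- 2 * \<nu>) = (residual_bound n)\<^sup>2"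
    using eventually_ge_at_top[of n']
    by eventually_elim (simp add: residual_bound_def power_mult_distrib power2_eq_square flip: powr_add)
  ultimately have "summable (\<lambda>n. (residual_bound n)\<^sup>2)"
    by (rule summable_cong[THEN iffD1, rotated])
  then have "(\<lambda>n. (residual_bound n)\<^sup>2) summable_on UNIV"
    by (simp add: summable_on_UNIV_nonneg_real_iff)
  then have "(\<lambda>n. (residual_bound n)\<^sup>2) summable_on {1..}" by (rule summable_on_subset_banach) simp
  then show ?thesis
    unfolding residual_modes_def by (subst summable_on_reindex) (auto simp: inj_on_def o_def)
qed

lemma inj_on_exponent: "inj_on exponent (omega_modes \<union> zeta_modes \<union> residual_modes)"
proof (rule inj_onI)
  fix i j
  assume ij: "i \<in> omega_modes \<union> zeta_modes \<union> residual_modes" "j \<in> omega_modes \<union> zeta_modes \<union> residual_modes"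
    and eq: "exponent i = exponent j"
  have real_neq: "conj_if s (\<i> * \<omega> n) \<noteq> of_real x" "conj_if s (\<i> * \<zeta> n) \<noteq> of_real x" if "n \<ge> 1" for s n x
    using conj_if_imaginary_neq_of_real Re_pos[OF that] by simp_all
  consider (Omega) s n s' m where "i = Omega s n" "j = Omega s' m" "n \<ge> 1" "m \<ge> 1"
    | (Zeta) s n s' m where "i = Zeta s n" "j = Zeta s' m" "n \<ge> 1" "m \<ge> 1"
    | (Omega_Zeta) s n s' m where "i = Omega s n" "j = Zeta s' m" "n \<ge> 1" "m \<ge> 1"
    | (Zeta_Omega) s n s' m where "i = Zeta s n" "j = Omega s' m" "n \<ge> 1" "m \<ge> 1"
    | (real) "i \<in> insert Decay residual_modes" "j \<in> insert Decay residual_modes"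
    using ij eq real_neq real_neq[symmetric]
    by (cases i; cases j) (simp_all flip: of_real_minus)
  then show "i = j"
  proof cases
    case Omega
    then have "s = s' \<and> \<omega> n = \<omega> m" using eq Re_pos(1) by (intro conj_if_imaginary_eqD) simp_all
    then show ?thesis using Omega inj_onD[OF inj(1), of n m] by simp
  next
    case Zeta
    then have "s = s' \<and> \<zeta> n = \<zeta> m" using eq Re_pos(2) by (intro conj_if_imaginary_eqD) simp_all
    then show ?thesis using Zeta inj_onD[OF inj(3), of n m] by simp
  next
    case Omega_Zeta
    then have "s = s' \<and> \<omega> n = \<zeta> m" using eq Re_pos by (intro conj_if_imaginary_eqD) simp_all
    then show ?thesis using Omega_Zeta distinct(1)[of n m] by simp
  next
    case Zeta_Omega
    then have "s = s' \<and> \<zeta> n = \<omega> m" using eq Re_pos by (intro conj_if_imaginary_eqD) simp_all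
    then show ?thesis using Zeta_Omega distinct(1)[of m n] by simp
  next
    case real
    then show ?thesis
      using eq distinct(2) distinct(2)[symmetric] inj_onD[OF inj(2)]
      by (auto simp: residual_modes_def simp flip: of_real_minus)
  qed
qed

sublocale dominated_mode_system exponent weight\<^sub>1 weight\<^sub>2 omega_modes zeta_modes residual_modes
  \<gamma> "- \<alpha>" 0 "SUP n. \<bar>r n\<bar>" dominating_modes "\<lambda>i. residual_bound (mode_index i)"
proof unfold_locales
  show "omega_modes \<inter> zeta_modes = {}" "(omega_modes \<union> zeta_modes) \<inter> residual_modes = {}"
    by (auto simp: omega_modes_def zeta_modes_def residual_modes_def)
  show "weight\<^sub>1 i = 1" if "i \<in> omega_modes \<union> residual_modes" for i
    using that by (cases i) simp_all
  show "weight\<^sub>2 i = 1" if "i \<in> zeta_modes" for i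
    using that by (cases i) simp_all
  show "weight\<^sub>2 i = 0" if "i \<in> residual_modes" for i
    using that by (cases i) simp_all
  show "finite (dominating_modes i)" for i
    by (cases i) simp_all
  show "dominating_modes i \<subseteq> omega_modes \<union> zeta_modes" if "i \<in> residual_modes" for i
    using that by (cases i) simp_all
  show "disjoint_family_on dominating_modes residual_modes"
    by (auto simp: disjoint_family_on_def residual_modes_def)
  show "residual_bound (mode_index i) \<ge> 0" for i
    using const(2) by (simp add: residual_bound_def)
  show "(SUP n. \<bar>r n\<bar>) \<ge> 0"
    using residual_exponent_le[of "Residual 1"] by (simp add: order_trans[OF abs_ge_zero])
qed (use const(1) in \<open>simp_all add: asymptotic_gap_modes Re_exponent_tendsto weights_tendsto
    residual_exponent_le residual_bound_summable inj_on_exponent\<close>)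

lemma exhausting_modes_upto: "exhausting modes_upto"
proof -
  have "dominating_modes i \<subseteq> modes_upto N - modes_upto K"
    if "i \<in> modes_upto N - modes_upto K" "i \<in> residual_modes" for i N K
    using that by (cases i) auto
  moreover have "dominating_modes i \<subseteq> modes_upto N" if "i \<in> modes_upto N" "i \<in> residual_modes" for i N
    using that by (cases i) auto
  moreover have "mono modes_upto"
    by (rule monoI) (auto simp: modes_upto_def)
  ultimately show ?thesis
    using modes_upto_subset
    by (simp add: exhausting_def block_closed_def finite_modes_upto subset_iff[of "_ - _"]) blast
qed

lemma u1_part_eq_exp_sum:
  "u1_part \<omega> \<zeta> r C D R N
    = exp_sum (modes_upto N) exponent (\<lambda>i. weight\<^sub>1 i * mode_coeff C (\<lambda>n. d n * D n) R \<E> i)"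
proof
  fix t
  show "u1_part \<omega> \<zeta> r C D R N t
    = exp_sum (modes_upto N) exponent (\<lambda>i. weight\<^sub>1 i * mode_coeff C (\<lambda>n. d n * D n) R \<E> i) t"
    unfolding u1_part_def exp_sum_def sum_modes_upto
    using d_nonzero by (auto intro!: sum.cong simp flip: exp_of_real)
qed

lemma u2_part_eq_exp_sum:
  "u2_part \<omega> \<zeta> c d C D \<E> \<eta> N
    = exp_sum (modes_upto N) exponent (\<lambda>i. weight\<^sub>2 i * mode_coeff C (\<lambda>n. d n * D n) R \<E> i)"
proof
  fix t
  show "u2_part \<omega> \<zeta> c d C D \<E> \<eta> N t
    = exp_sum (modes_upto N) exponent (\<lambda>i. weight\<^sub>2 i * mode_coeff C (\<lambda>n. d n * D n) R \<E> i) t"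
    unfolding u2_part_def exp_sum_def sum_modes_upto
    by (auto simp: ac_simps intro!: sum.cong simp flip: exp_of_real)
qed

lemma dominated_mode_coeff:
  assumes "\<forall>n\<ge>1. \<bar>R n\<bar> \<le> residual_bound n * sqrt ((cmod (C n))\<^sup>2 + (cmod (b n))\<^sup>2)"
  shows "dominated (mode_coeff C b R \<E>)"
  unfolding dominated_def
proof
  fix i assume "i \<in> residual_modes"
  then obtain n where "i = Residual n" "n \<ge> 1" by (auto simp: residual_modes_def)
  then show "cmod (mode_coeff C b R \<E> i)
    \<le> residual_bound (mode_index i) * sqrt (sum_sq (dominating_modes i) (mode_coeff C b R \<E>))"
    using assms by (simp add: sum_sq_def)
qed

lemma modal_energy_modes_upto:
  "modal_energy (modes_upto N) (mode_coeff C b R \<E>) = \<E>\<^sup>2 + 2 * (\<Sum>n=1..N. (cmod (C n))\<^sup>2 + (cmod (b n))\<^sup>2)"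
proof -
  let ?f = "\<lambda>i. if i \<in> omega_modes \<union> zeta_modes then (cmod (mode_coeff C b R \<E> i))\<^sup>2 else 0"
  have "modal_energy (modes_upto N) (mode_coeff C b R \<E>) = sum ?f (modes_upto N)"
    unfolding modal_energy_def sum_sq_def by (rule sum.inter_restrict[OF finite_modes_upto])
  also have "\<dots> = \<E>\<^sup>2 + (\<Sum>n=1..N. 2 * ((cmod (C n))\<^sup>2 + (cmod (b n))\<^sup>2))"
    unfolding sum_modes_upto by (intro arg_cong2[where f = "(+)"] sum.cong) simp_all
  finally show ?thesis by (simp add: sum_distrib_left)
qed

lemma modal_energy_tendsto:
  assumes "summable (\<lambda>n. (cmod (C (Suc n)))\<^sup>2 + (cmod (d (Suc n) * D (Suc n)))\<^sup>2)"
  shows "(\<lambda>N. modal_energy (modes_upto N) (mode_coeff C (\<lambda>n. d n * D n) R \<E>)) \<longlonglongrightarrow> \<E>\<^sup>2 + 2 * energy C D d"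
proof -
  have "(\<lambda>N. \<Sum>n=1..N. (cmod (C n))\<^sup>2 + (cmod (d n * D n))\<^sup>2) \<longlonglongrightarrow> energy C D d"
    using summable_LIMSEQ[OF assms] by (simp add: energy_def sum.atLeast1_atMost_eq)
  then show ?thesis
    unfolding modal_energy_modes_upto by (intro tendsto_intros)
qed

definition admissible ::
  "(nat \<Rightarrow> complex) \<Rightarrow> (nat \<Rightarrow> complex) \<Rightarrow> (nat \<Rightarrow> real) \<Rightarrow> real \<Rightarrow> bool" where
  "admissible C D R \<E> \<longleftrightarrow>
    (\<forall>n\<ge>1. \<bar>R n\<bar> \<le> residual_bound n * sqrt ((cmod (C n))\<^sup>2 + (cmod (d n * D n))\<^sup>2))
    \<and> summable (\<lambda>n. (cmod (C (Suc n)))\<^sup>2 + (cmod (d (Suc n) * D (Suc n)))\<^sup>2) \<and> \<E>\<^sup>2 \<le> M * energy C D d"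

theorem two_sided_estimate:
  assumes "T > 2 * pi / \<gamma>"
  obtains A B where "0 < A" "A \<le> B"
    "\<And>C D R \<E>. admissible C D R \<E>
      \<Longrightarrow> \<exists>U\<^sub>1 U\<^sub>2. L2_tendsto T (u1_part \<omega> \<zeta> r C D R) U\<^sub>1 \<and> L2_tendsto T (u2_part \<omega> \<zeta> c d C D \<E> \<eta>) U\<^sub>2
        \<and> A * energy C D d \<le> L2_sq T U\<^sub>1 + L2_sq T U\<^sub>2 \<and> L2_sq T U\<^sub>1 + L2_sq T U\<^sub>2 \<le> B * energy C D d"
proof -
  obtain \<delta> K where \<delta>: "\<delta> > 0" and K: "K > 0"
    and observability: "\<And>J x E. exhausting J \<Longrightarrow> dominated x \<Longrightarrow> (\<lambda>n. modal_energy (J n) x) \<longlonglongrightarrow> E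
      \<Longrightarrow> \<exists>U\<^sub>1 U\<^sub>2. L2_tendsto T (\<lambda>n. exp_sum (J n) exponent (\<lambda>i. weight\<^sub>1 i * x i)) U\<^sub>1
        \<and> L2_tendsto T (\<lambda>n. exp_sum (J n) exponent (\<lambda>i. weight\<^sub>2 i * x i)) U\<^sub>2
        \<and> \<delta> * E \<le> L2_sq T U\<^sub>1 + L2_sq T U\<^sub>2 \<and> L2_sq T U\<^sub>1 + L2_sq T U\<^sub>2 \<le> K * E"
    by (rule observability[OF assms]) blast
  show thesis
  proof (rule that[of "2 * \<delta>" "max (2 * \<delta>) (K * (M + 2))"])
    fix C D R \<E> assume "admissible C D R \<E>"
    then have R: "\<forall>n\<ge>1. \<bar>R n\<bar> \<le> residual_bound n * sqrt ((cmod (C n))\<^sup>2 + (cmod (d n * D n))\<^sup>2)"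
      and summable: "summable (\<lambda>n. (cmod (C (Suc n)))\<^sup>2 + (cmod (d (Suc n) * D (Suc n)))\<^sup>2)"
      and \<E>: "\<E>\<^sup>2 \<le> M * energy C D d" by (simp_all add: admissible_def)
    obtain U\<^sub>1 U\<^sub>2 where U: "L2_tendsto T (u1_part \<omega> \<zeta> r C D R) U\<^sub>1" "L2_tendsto T (u2_part \<omega> \<zeta> c d C D \<E> \<eta>) U\<^sub>2"
      and bounds: "\<delta> * (\<E>\<^sup>2 + 2 * energy C D d) \<le> L2_sq T U\<^sub>1 + L2_sq T U\<^sub>2"
        "L2_sq T U\<^sub>1 + L2_sq T U\<^sub>2 \<le> K * (\<E>\<^sup>2 + 2 * energy C D d)"
      using observability[OF exhausting_modes_upto dominated_mode_coeff[OF R] modal_energy_tendsto[OF summable]]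
      unfolding u1_part_eq_exp_sum[symmetric] u2_part_eq_exp_sum[symmetric] by blast
    have "energy C D d \<ge> 0"
      unfolding energy_def by (rule suminf_nonneg[OF summable]) simp
    have "2 * \<delta> * energy C D d \<le> \<delta> * (\<E>\<^sup>2 + 2 * energy C D d)"
      using \<delta> by (simp add: distrib_left)
    also note bounds(1)
    finally have lower: "2 * \<delta> * energy C D d \<le> L2_sq T U\<^sub>1 + L2_sq T U\<^sub>2" .
    note bounds(2)
    also have "K * (\<E>\<^sup>2 + 2 * energy C D d) \<le> K * (M + 2) * energy C D d"
      using K \<E> by (simp add: algebra_simps)
    also have "\<dots> \<le> max (2 * \<delta>) (K * (M + 2)) * energy C D d"
      using \<open>energy C D d \<ge> 0\<close> by (intro mult_right_mono) simp_all
    finally show "\<exists>U\<^sub>1 U\<^sub>2. L2_tendsto T (u1_part \<omega> \<zeta> r C D R) U\<^sub>1 \<and> L2_tendsto T (u2_part \<omega> \<zeta> c d C D \<E> \<eta>) U\<^sub>2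
        \<and> 2 * \<delta> * energy C D d \<le> L2_sq T U\<^sub>1 + L2_sq T U\<^sub>2
        \<and> L2_sq T U\<^sub>1 + L2_sq T U\<^sub>2 \<le> max (2 * \<delta>) (K * (M + 2)) * energy C D d"
      using U lower by blast
  qed (use \<delta> in simp_all)
qed

end

lemma critical_time_less:
  assumes "\<alpha> > 0" "\<gamma> > 4 * \<alpha>" "T > 2 * pi / sqrt (\<gamma>\<^sup>2 - 16 * \<alpha>\<^sup>2)"
  shows "T > 2 * pi / \<gamma>"
proof -
  have "(4 * \<alpha>)\<^sup>2 < \<gamma>\<^sup>2" using assms(1,2) by (intro power_strict_mono) simp_all
  then have "0 < sqrt (\<gamma>\<^sup>2 - 16 * \<alpha>\<^sup>2)" "sqrt (\<gamma>\<^sup>2 - 16 * \<alpha>\<^sup>2) \<le> \<gamma>"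
    using assms(1,2) by (simp_all add: power_mult_distrib real_le_lsqrt)
  then have "2 * pi / \<gamma> \<le> 2 * pi / sqrt (\<gamma>\<^sup>2 - 16 * \<alpha>\<^sup>2)"
    using assms(1,2) by (intro divide_left_mono mult_pos_pos) simp_all
  then show ?thesis using assms(3) by simp
qed

theorem theorem5p16:
  fixes \<omega> \<zeta> c d :: "nat \<Rightarrow> complex" and r :: "nat \<Rightarrow> real"
    and \<gamma> \<alpha> \<chi>\<^sub>0 \<mu> \<nu> M c\<^sub>1 c\<^sub>2 \<eta> T :: real and n' :: nat
  assumes S_const: "\<gamma> > 0" "\<alpha> > 0" "\<chi>\<^sub>0 < 0" "\<mu> > 0" "\<nu> > 1/2" "M > 0" "0 < c\<^sub>1" "c\<^sub>1 \<le> c\<^sub>2"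
    and H1: "liminf (\<lambda>n. ereal (Re (\<omega> (Suc n)) - Re (\<omega> n))) = ereal \<gamma>"
            "liminf (\<lambda>n. ereal (Re (\<zeta> (Suc n)) - Re (\<zeta> n))) = ereal \<gamma>"
    and H2: "(\<lambda>n. Im (\<omega> n)) \<longlonglongrightarrow> \<alpha>" "r \<longlonglongrightarrow> \<chi>\<^sub>0" "(\<lambda>n. Im (\<zeta> n)) \<longlonglongrightarrow> 0"
    and H3: "\<forall>n\<ge>1. \<omega> n \<noteq> 0 \<and> \<zeta> n \<noteq> 0 \<and> c\<^sub>1 * cmod (\<zeta> n) \<le> cmod (d n)
                \<and> cmod (d n) \<le> c\<^sub>2 * cmod (\<zeta> n) \<and> cmod (c n) \<le> M / cmod (\<omega> n)"
    and D_inj: "inj_on \<omega> {1..}" "inj_on r {1..}" "inj_on \<zeta> {1..}"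
    and D_dist: "\<forall>n\<ge>1. \<forall>m\<ge>1. \<omega> n \<noteq> \<zeta> m \<and> \<omega> n \<noteq> cnj (\<zeta> m)
                \<and> complex_of_real (r n) \<noteq> \<i> * \<omega> m \<and> complex_of_real (r n) \<noteq> \<i> * \<zeta> m
                \<and> r n \<noteq> - \<eta>"
    and D_pos: "\<forall>n\<ge>1. Re (\<omega> n) > 0 \<and> Re (\<zeta> n) > 0"
    and gap: "\<gamma> > 4 * \<alpha>"
    and T: "T > 2 * pi / sqrt (\<gamma>\<^sup>2 - 16 * \<alpha>\<^sup>2)"
  shows "\<exists>A B. 0 < A \<and> A \<le> B \<and>
    (\<forall>(C :: nat \<Rightarrow> complex) (D :: nat \<Rightarrow> complex) (R :: nat \<Rightarrow> real) (\<E> :: real).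
      (\<forall>n\<ge>n'. \<bar>R n\<bar> \<le> \<mu> * real n powr (- \<nu>) * sqrt ((cmod (C n))\<^sup>2 + (cmod (d n * D n))\<^sup>2))
      \<and> (\<forall>n. 1 \<le> n \<and> n \<le> n' \<longrightarrow> \<bar>R n\<bar> \<le> \<mu> * sqrt ((cmod (C n))\<^sup>2 + (cmod (d n * D n))\<^sup>2))
      \<and> summable (\<lambda>n. (cmod (C (Suc n)))\<^sup>2 + (cmod (d (Suc n) * D (Suc n)))\<^sup>2)
      \<and> \<E>\<^sup>2 \<le> M * energy C D d
      \<longrightarrow> (\<exists>U1 U2 :: real \<Rightarrow> complex.
            (\<lambda>t. (cmod (U1 t))\<^sup>2) integrable_on {0..T}
          \<and> (\<lambda>t. (cmod (U2 t))\<^sup>2) integrable_on {0..T}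
          \<and> (\<forall>N. (\<lambda>t. (cmod (U1 t - u1_part \<omega> \<zeta> r C D R N t))\<^sup>2) integrable_on {0..T})
          \<and> (\<forall>N. (\<lambda>t. (cmod (U2 t - u2_part \<omega> \<zeta> c d C D \<E> \<eta> N t))\<^sup>2) integrable_on {0..T})
          \<and> (\<lambda>N. integral {0..T} (\<lambda>t. (cmod (U1 t - u1_part \<omega> \<zeta> r C D R N t))\<^sup>2)) \<longlonglongrightarrow> 0
          \<and> (\<lambda>N. integral {0..T} (\<lambda>t. (cmod (U2 t - u2_part \<omega> \<zeta> c d C D \<E> \<eta> N t))\<^sup>2)) \<longlonglongrightarrow> 0
          \<and> A * energy C D d \<le> integral {0..T} (\<lambda>t. (cmod (U1 t))\<^sup>2 + (cmod (U2 t))\<^sup>2)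
          \<and> integral {0..T} (\<lambda>t. (cmod (U1 t))\<^sup>2 + (cmod (U2 t))\<^sup>2) \<le> B * energy C D d))"
proof -
  have time_bound: "T > 2 * pi / \<gamma>" using S_const(2) gap T by (rule critical_time_less)
  interpret oscillator_system \<omega> \<zeta> c d r \<gamma> \<alpha> \<chi>\<^sub>0 \<mu> \<nu> M c\<^sub>1 \<eta> n'
    using S_const H1 H2 H3 D_inj D_dist D_pos by unfold_locales auto
  obtain A B where "0 < A" "A \<le> B" and estimate: "\<And>C D R \<E>. admissible C D R \<E>
      \<Longrightarrow> \<exists>U\<^sub>1 U\<^sub>2. L2_tendsto T (u1_part \<omega> \<zeta> r C D R) U\<^sub>1 \<and> L2_tendsto T (u2_part \<omega> \<zeta> c d C D \<E> \<eta>) U\<^sub>2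
        \<and> A * energy C D d \<le> L2_sq T U\<^sub>1 + L2_sq T U\<^sub>2 \<and> L2_sq T U\<^sub>1 + L2_sq T U\<^sub>2 \<le> B * energy C D d"
    by (rule two_sided_estimate[OF time_bound]) blast
  show ?thesis
  proof (rule exI[of _ A], rule exI[of _ B], intro conjI allI impI, goal_cases)
    case (3 C D R \<E>)
    then have "admissible C D R \<E>" by (simp add: admissible_def residual_bound_def)
    then obtain U\<^sub>1 U\<^sub>2 where "L2_tendsto T (u1_part \<omega> \<zeta> r C D R) U\<^sub>1" "L2_tendsto T (u2_part \<omega> \<zeta> c d C D \<E> \<eta>) U\<^sub>2"
      "A * energy C D d \<le> L2_sq T U\<^sub>1 + L2_sq T U\<^sub>2" "L2_sq T U\<^sub>1 + L2_sq T U\<^sub>2 \<le> B * energy C D d"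
      using estimate by blast
    then show ?case
      using integral_norm_power2_add[of T U\<^sub>1 U\<^sub>2]
      by (intro exI[of _ U\<^sub>1] exI[of _ U\<^sub>2]) (simp add: L2_tendsto_def square_integrable_def L2_sq_def)
  qed fact+
qed

end
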